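(* Let $M$ be the McLain group of a non-empty totally ordered set $(\Lambda,\leq)$ over a ring $R$ with $1\neq0$, let $F$ be a field such that $R$ admits a right primitive linear character $R^+\to F^*$, let $D$ be a basic subset of $\Phi$ and $f$ a function from $D$ into the set of right primitive linear characters $R^+\to F^*$. With $H\le I\le M$ and $\Omega$ associated to $D$ as in the context, $$(V(D,f),V(D,f))_M=[I:H]=|R|^{|\Omega|}.$$
   Context: Modules are over the field $F$ and may be infinite dimensional; $(X,Y)_G=\dim_F\mathrm{Hom}_{FG}(X,Y)$; $\mathrm{ind}_H^GW=FG\otimes_{FH}W$. $R$ and $\Lambda$ may be infinite and $R$ need not be commutative. McLain group: $\Phi=\{(\alpha,\beta)\in\Lambda\times\Lambda:\alpha<\beta\}$. $J$ is the free left $R$-module with basis $e_{\alpha\beta}$, $(\alpha,\beta)\in\Phi$, made into a ring by $(re_{\alpha\beta})(se_{\beta\gamma})=rs\,e_{\alpha\gamma}$ and $(re_{\alpha\beta})(se_{\gamma\delta})=0$ if $\beta\neq\gamma$, extended additively. $J$ is nil, and $M=\{1+x:x\in J\}$ is a group under multiplication. $M_{\alpha\beta}=\{1+re_{\alpha\beta}:r\in R\}$. A subset $\Delta\subseteq\Phi$ is closed if $(\alpha,\beta),(\beta,\gamma)\in\Delta$ implies $(\alpha,\gamma)\in\Delta$; then $M(\Delta)=\langle M_{\alpha\beta}:(\alpha,\beta)\in\Delta\rangle$. A group homomorphism $R^+\to F^*$ (linear character) is right primitive if the only right ideal of $R$ contained in its kernel is $(0)$. Elementary modules: let $(\alpha,\beta)\in\Phi$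 and let $\mu:R^+\to F^*$ be right primitive. Let $L$ be the subgroup generated by all $M_{\gamma\delta}$ with $\alpha\le\gamma<\delta\le\beta$; let $P$ be the subgroup of $L$ generated by all $M_{\gamma\beta}$ with $\alpha\le\gamma<\beta$ and all $M_{\gamma\delta}$ with $\alpha<\gamma<\delta<\beta$. There is a $1$-dimensional $P$-module on which $1+re_{\alpha\beta}$ acts as $\mu(r)$ and all the other listed generators act trivially; $V(\alpha,\beta,\mu)$ is the $L$-module induced from it, viewed as an $M$-module through $M=N\rtimes L$, where $N$ is the normal subgroup generated by all $M_{\gamma\delta}$ with $\gamma<\alpha$ or $\delta>\beta$, and $N$ acts trivially. Basic modules: a finite non-empty subset $D=\{(\alpha_1,\beta_1),\dots,(\alpha_m,\beta_m)\}$ of $\Phi$ is basic if the $\alpha_i$ are distinct and the $\beta_i$ are distinct. Write $f(\alpha_i,\beta_i)=\lambda_i$. The basic $M$-module is $V(D,f)=V(\alpha_m,\beta_m,\lambda_m)\otimes_F\cdots\otimes_FV(\alpha_1,\beta_1,\lambda_1)$ with diagonal action. Notation attached to $D$: $\Gamma=\Phi\setminus\bigcup_i\{(\alpha_i,\gamma)\in\Phi:\gamma<\beta_i\}$, $H=M(\Gamma)$, $\Omega=\{(\alpha,\gamma)\in\Phi:\exists\,(\alpha,\beta),(\gamma,\delta)\in D\text{ with }\alpha<\gamma<\beta<\delta\}$ (a finite set), $\Gamma_1=\Gamma\cup\Omega$ (a closed subset of $\Phi$), $I=M(\Gamma_1)$. *)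

theory Defs
  imports
    "HOL-Algebra.Generated_Groups"
    "HOL-Algebra.AbelCoset"
    "HOL-Library.Poly_Mapping"
    "Jordan_Normal_Form.VS_Connect"
begin

unbundle cardinal_syntax

section \<open>Modules over group algebras\<close>

text \<open>
  A vector space over a field \<open>'f\<close> is a module record of HOL-Algebra over the record
  \<^term>\<open>class_ring :: 'f::field ring\<close>. The fields \<^const>\<open>monoid.mult\<close> and \<^const>\<open>one\<close> of such a
  record carry no meaning and are filled arbitrarily.
\<close>

record ('f, 'g, 'v) gmodule = "('f, 'v) module" +
  act :: "'g \<Rightarrow> 'v \<Rightarrow> 'v"

definition hom_space ::
  "('g, 'm) monoid_scheme \<Rightarrow> ('f::field, 'g, 'v, 'a) gmodule_scheme \<Rightarrow>
   ('f, 'g, 'w, 'b) gmodule_scheme \<Rightarrow> ('f, 'v \<Rightarrow> 'w) module" where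
  "hom_space G V W =
    \<lparr> carrier = {\<phi> \<in> LinearCombinations.module_hom class_ring V W \<inter> extensional (carrier V).
                  \<forall>g\<in>carrier G. \<forall>v\<in>carrier V. \<phi> (act V g v) = act W g (\<phi> v)},
      mult = (\<lambda>_ _. \<lambda>v\<in>carrier V. \<zero>\<^bsub>W\<^esub>),
      one = (\<lambda>v\<in>carrier V. \<zero>\<^bsub>W\<^esub>),
      zero = (\<lambda>v\<in>carrier V. \<zero>\<^bsub>W\<^esub>),
      add = (\<lambda>\<phi> \<psi>. \<lambda>v\<in>carrier V. \<phi> v \<oplus>\<^bsub>W\<^esub> \<psi> v),
      smult = (\<lambda>c \<phi>. \<lambda>v\<in>carrier V. c \<odot>\<^bsub>W\<^esub> \<phi> v) \<rparr>"

text \<open>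
  Dimensions and indices (\<open>coset_index\<close> below) are cardinals in the sense of the BNF cardinal
  library, so that different infinite values are distinguished.
\<close>

definition has_dim :: "('f::field, 'v, 'b) module_scheme \<Rightarrow> 'c rel \<Rightarrow> bool" where
  "has_dim V \<kappa> \<longleftrightarrow>
    vectorspace class_ring V \<and> (\<exists>B. vectorspace.basis class_ring V B \<and> |B| =o \<kappa>)"

definition free_space :: "'s set \<Rightarrow> ('f::field, 's \<Rightarrow>\<^sub>0 'f) module" where
  "free_space S =
    \<lparr> carrier = {p. Poly_Mapping.keys p \<subseteq> S}, mult = (\<lambda>_ _. 0), one = 0, zero = 0, add = (+),
      smult = (\<lambda>c. Poly_Mapping.map ((*) c)) \<rparr>"

abbreviation symb :: "'s \<Rightarrow> 's \<Rightarrow>\<^sub>0 'f::field" where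
  "symb s \<equiv> Poly_Mapping.single s 1"

definition push :: "('s \<Rightarrow> 's) \<Rightarrow> ('s \<Rightarrow>\<^sub>0 'f::field) \<Rightarrow> ('s \<Rightarrow>\<^sub>0 'f)" where
  "push \<pi> p = (\<Sum>s\<in>Poly_Mapping.keys p. Poly_Mapping.single (\<pi> s) (Poly_Mapping.lookup p s))"

text \<open>
  The vector space generated by the symbols in \<open>S\<close> subject to the relations \<open>r = 0\<close> for
  \<open>r \<in> Rel\<close>, i.e. the quotient of \<^term>\<open>free_space S\<close> by the span \<open>K\<close> of \<open>Rel\<close>, whose elements
  are the cosets of \<open>K\<close>. A group element \<open>g\<close> acts by \<open>s \<mapsto> \<pi> g s\<close> on symbols.
\<close>

definition presented ::
  "'s set \<Rightarrow> ('s \<Rightarrow>\<^sub>0 'f) set \<Rightarrow> ('g \<Rightarrow> 's \<Rightarrow> 's) \<Rightarrow> ('f::field, 'g, ('s \<Rightarrow>\<^sub>0 'f) set) gmodule" where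
  "presented S Rel \<pi> =
    (let E = free_space S; K = LinearCombinations.module.span class_ring E Rel in
      \<lparr> carrier = a_rcosets\<^bsub>E\<^esub> K, mult = (\<lambda>_ _. K), one = K, zero = K, add = set_add E,
        smult = (\<lambda>c C. \<Union>p\<in>C. K +>\<^bsub>E\<^esub> (c \<odot>\<^bsub>E\<^esub> p)),
        act = (\<lambda>g C. \<Union>p\<in>C. K +>\<^bsub>E\<^esub> push (\<pi> g) p) \<rparr>)"

text \<open>
  Elements of the group algebra of \<open>G\<close> are the \<open>a :: 'g \<Rightarrow>\<^sub>0 'f\<close> with
  \<^term>\<open>Poly_Mapping.keys a \<subseteq> carrier G\<close>. The product is written out because the one of
  \<^theory>\<open>HOL-Library.Poly_Mapping\<close> requires an additive monoid type of keys.
\<close>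

definition alg_mult ::
  "('g, 'm) monoid_scheme \<Rightarrow> ('g \<Rightarrow>\<^sub>0 'f::field) \<Rightarrow> ('g \<Rightarrow>\<^sub>0 'f) \<Rightarrow> ('g \<Rightarrow>\<^sub>0 'f)" where
  "alg_mult G a b =
    (\<Sum>x\<in>Poly_Mapping.keys a. \<Sum>y\<in>Poly_Mapping.keys b.
       Poly_Mapping.single (x \<otimes>\<^bsub>G\<^esub> y) (Poly_Mapping.lookup a x * Poly_Mapping.lookup b y))"

definition alg_act :: "('f::field, 'g, 'w, 'b) gmodule_scheme \<Rightarrow> ('g \<Rightarrow>\<^sub>0 'f) \<Rightarrow> 'w \<Rightarrow> 'w" where
  "alg_act W b w = (\<Oplus>\<^bsub>W\<^esub>h\<in>Poly_Mapping.keys b. Poly_Mapping.lookup b h \<odot>\<^bsub>W\<^esub> act W h w)"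

text \<open>\<open>FG \<otimes>\<^bsub>FH\<^esub> W\<close>; the symbol \<open>(a, w)\<close> stands for \<open>a \<otimes> w\<close>.\<close>

definition induced ::
  "('g, 'm) monoid_scheme \<Rightarrow> 'g set \<Rightarrow> ('f::field, 'g, 'w) gmodule \<Rightarrow>
   ('f, 'g, (('g \<Rightarrow>\<^sub>0 'f) \<times> 'w \<Rightarrow>\<^sub>0 'f) set) gmodule" where
  "induced G H W =
    (let FG = carrier (free_space (carrier G)); FH = carrier (free_space H) in
      presented (FG \<times> carrier W)
        ({symb (a + a', w) - symb (a, w) - symb (a', w) | a a' w.
            a \<in> FG \<and> a' \<in> FG \<and> w \<in> carrier W} \<union>
         {symb (a, w \<oplus>\<^bsub>W\<^esub> w') - symb (a, w) - symb (a, w') | a w w'.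
            a \<in> FG \<and> w \<in> carrier W \<and> w' \<in> carrier W} \<union>
         {symb (alg_mult G a b, w) - symb (a, alg_act W b w) | a b w.
            a \<in> FG \<and> b \<in> FH \<and> w \<in> carrier W} \<union>
         {symb (Poly_Mapping.map ((*) c) a, w) - Poly_Mapping.single (a, w) c | c a w.
            a \<in> FG \<and> w \<in> carrier W})
        (\<lambda>g (a, w). (alg_mult G (symb g) a, w)))"

text \<open>
  The tensor product over \<open>F\<close>, with diagonal action, of the family \<open>(V d)\<^bsub>d \<in> D\<^esub>\<close>; the symbol
  \<open>v\<close> stands for \<open>\<Otimes>\<^bsub>d \<in> D\<^esub> v d\<close>. No order on \<open>D\<close> enters.
\<close>

definition tensor ::
  "'d set \<Rightarrow> ('d \<Rightarrow> ('f::field, 'g, 'v) gmodule) \<Rightarrow> ('f, 'g, (('d \<Rightarrow> 'v) \<Rightarrow>\<^sub>0 'f) set) gmodule" where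
  "tensor D V =
    (let S = (\<Pi>\<^sub>E d\<in>D. carrier (V d)) in
      presented S
        ({symb (v(d := x \<oplus>\<^bsub>V d\<^esub> y)) - symb (v(d := x)) - symb (v(d := y)) | v d x y.
            v \<in> S \<and> d \<in> D \<and> x \<in> carrier (V d) \<and> y \<in> carrier (V d)} \<union>
         {symb (v(d := c \<odot>\<^bsub>V d\<^esub> x)) - Poly_Mapping.single (v(d := x)) c | v d c x.
            v \<in> S \<and> d \<in> D \<and> x \<in> carrier (V d)})
        (\<lambda>g v. \<lambda>d\<in>D. act (V d) g (v d)))"

definition line :: "('g \<Rightarrow> 'f::field) \<Rightarrow> ('f, 'g, 'f) gmodule" where
  "line \<chi> =
    \<lparr> carrier = UNIV, mult = (*), one = 1, zero = 0, add = (+), smult = (*),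
      act = (\<lambda>g x. \<chi> g * x) \<rparr>"


section \<open>McLain groups\<close>

definition Phi :: "('l::linorder \<times> 'l) set" where
  "Phi = {(\<alpha>, \<beta>). \<alpha> < \<beta>}"

definition J_mult :: "('l \<times> 'l \<Rightarrow>\<^sub>0 'r::ring_1) \<Rightarrow> ('l \<times> 'l \<Rightarrow>\<^sub>0 'r) \<Rightarrow> ('l \<times> 'l \<Rightarrow>\<^sub>0 'r)" where
  "J_mult x y =
    (\<Sum>(\<alpha>, \<beta>)\<in>Poly_Mapping.keys x. \<Sum>(\<gamma>, \<delta>)\<in>Poly_Mapping.keys y.
       if \<beta> = \<gamma>
       then Poly_Mapping.single (\<alpha>, \<delta>)
              (Poly_Mapping.lookup x (\<alpha>, \<beta>) * Poly_Mapping.lookup y (\<gamma>, \<delta>))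
       else 0)"

text \<open>
  The element \<open>1 + x\<close> of the group is represented by the element \<open>x\<close> of
  \<open>J = {x. keys x \<subseteq> Phi}\<close>, whence \<open>(1 + x) (1 + y) = 1 + (x + y + x y)\<close>. In particular
  \<open>1 + r e\<^bsub>\<alpha>\<beta>\<^esub>\<close> is represented by \<^term>\<open>Poly_Mapping.single (\<alpha>, \<beta>) r\<close>.
\<close>

definition McLain :: "('l::linorder \<times> 'l \<Rightarrow>\<^sub>0 'r::ring_1) monoid" where
  "McLain =
    \<lparr> carrier = {x. Poly_Mapping.keys x \<subseteq> Phi}, mult = (\<lambda>x y. x + y + J_mult x y), one = 0 \<rparr>"

definition root_group :: "'l::linorder \<times> 'l \<Rightarrow> ('l \<times> 'l \<Rightarrow>\<^sub>0 'r::ring_1) set" where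
  "root_group a = {Poly_Mapping.single a r | r. True}"

definition McLain_sub :: "('l::linorder \<times> 'l) set \<Rightarrow> ('l \<times> 'l \<Rightarrow>\<^sub>0 'r::ring_1) set" where
  "McLain_sub \<Delta> = generate McLain (\<Union>a\<in>\<Delta>. root_group a)"

definition coset_index :: "('g, 'm) monoid_scheme \<Rightarrow> 'g set \<Rightarrow> 'g set \<Rightarrow> 'g set rel" where
  "coset_index G I H = |rcosets\<^bsub>G\<lparr>carrier := I\<rparr>\<^esub> H|"

definition normal_closure :: "('g, 'm) monoid_scheme \<Rightarrow> 'g set \<Rightarrow> 'g set" where
  "normal_closure G S = \<Inter>{N. N \<lhd> G \<and> S \<subseteq> N}"


section \<open>Elementary and basic modules\<close>

definition linear_char :: "('r::ring_1 \<Rightarrow> 'f::field) \<Rightarrow> bool" where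
  "linear_char \<mu> \<longleftrightarrow> (\<forall>r. \<mu> r \<noteq> 0) \<and> (\<forall>r s. \<mu> (r + s) = \<mu> r * \<mu> s)"

definition right_ideal :: "'r::ring_1 set \<Rightarrow> bool" where
  "right_ideal A \<longleftrightarrow> 0 \<in> A \<and> (\<forall>a\<in>A. \<forall>b\<in>A. a + b \<in> A) \<and> (\<forall>a\<in>A. - a \<in> A) \<and>
    (\<forall>a\<in>A. \<forall>r. a * r \<in> A)"

definition right_primitive :: "('r::ring_1 \<Rightarrow> 'f::field) \<Rightarrow> bool" where
  "right_primitive \<mu> \<longleftrightarrow> linear_char \<mu> \<and> (\<forall>A. right_ideal A \<and> A \<subseteq> {r. \<mu> r = 1} \<longrightarrow> A = {0})"

definition L_roots :: "'l::linorder \<Rightarrow> 'l \<Rightarrow> ('l \<times> 'l) set" where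
  "L_roots \<alpha> \<beta> = {(\<gamma>, \<delta>). \<alpha> \<le> \<gamma> \<and> \<gamma> < \<delta> \<and> \<delta> \<le> \<beta>}"

definition P_roots :: "'l::linorder \<Rightarrow> 'l \<Rightarrow> ('l \<times> 'l) set" where
  "P_roots \<alpha> \<beta> = {(\<gamma>, \<beta>) | \<gamma>. \<alpha> \<le> \<gamma> \<and> \<gamma> < \<beta>} \<union> {(\<gamma>, \<delta>). \<alpha> < \<gamma> \<and> \<gamma> < \<delta> \<and> \<delta> < \<beta>}"

definition L_group :: "'l::linorder \<Rightarrow> 'l \<Rightarrow> ('l \<times> 'l \<Rightarrow>\<^sub>0 'r::ring_1) set" where
  "L_group \<alpha> \<beta> = McLain_sub (L_roots \<alpha> \<beta>)"

definition P_group :: "'l::linorder \<Rightarrow> 'l \<Rightarrow> ('l \<times> 'l \<Rightarrow>\<^sub>0 'r::ring_1) set" where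
  "P_group \<alpha> \<beta> = McLain_sub (P_roots \<alpha> \<beta>)"

definition N_group :: "'l::linorder \<Rightarrow> 'l \<Rightarrow> ('l \<times> 'l \<Rightarrow>\<^sub>0 'r::ring_1) set" where
  "N_group \<alpha> \<beta> =
    normal_closure McLain (\<Union>a\<in>{(\<gamma>, \<delta>) \<in> Phi. \<gamma> < \<alpha> \<or> \<delta> > \<beta>}. root_group a)"

definition is_P_char ::
  "'l::linorder \<Rightarrow> 'l \<Rightarrow> ('r::ring_1 \<Rightarrow> 'f::field) \<Rightarrow> (('l \<times> 'l \<Rightarrow>\<^sub>0 'r) \<Rightarrow> 'f) \<Rightarrow> bool" where
  "is_P_char \<alpha> \<beta> \<mu> \<chi> \<longleftrightarrow>
    \<chi> \<in> extensional (P_group \<alpha> \<beta>) \<and>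
    (\<forall>p\<in>P_group \<alpha> \<beta>. \<chi> p \<noteq> 0) \<and>
    (\<forall>p\<in>P_group \<alpha> \<beta>. \<forall>q\<in>P_group \<alpha> \<beta>. \<chi> (p \<otimes>\<^bsub>McLain\<^esub> q) = \<chi> p * \<chi> q) \<and>
    (\<forall>r. \<chi> (Poly_Mapping.single (\<alpha>, \<beta>) r) = \<mu> r) \<and>
    (\<forall>a\<in>P_roots \<alpha> \<beta> - {(\<alpha>, \<beta>)}. \<forall>r. \<chi> (Poly_Mapping.single a r) = 1)"

definition P_char ::
  "'l::linorder \<Rightarrow> 'l \<Rightarrow> ('r::ring_1 \<Rightarrow> 'f::field) \<Rightarrow> ('l \<times> 'l \<Rightarrow>\<^sub>0 'r) \<Rightarrow> 'f" where
  "P_char \<alpha> \<beta> \<mu> = (THE \<chi>. is_P_char \<alpha> \<beta> \<mu> \<chi>)"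

text \<open>The projection of \<open>N \<rtimes> L\<close>, the whole group, onto \<open>L\<close>.\<close>

definition L_proj ::
  "'l::linorder \<Rightarrow> 'l \<Rightarrow> ('l \<times> 'l \<Rightarrow>\<^sub>0 'r::ring_1) \<Rightarrow> ('l \<times> 'l \<Rightarrow>\<^sub>0 'r)" where
  "L_proj \<alpha> \<beta> g = (THE l. l \<in> L_group \<alpha> \<beta> \<and> (\<exists>n\<in>N_group \<alpha> \<beta>. g = n \<otimes>\<^bsub>McLain\<^esub> l))"

type_synonym ('l, 'r, 'f) elem_vec =
  "((('l \<times> 'l \<Rightarrow>\<^sub>0 'r) \<Rightarrow>\<^sub>0 'f) \<times> 'f \<Rightarrow>\<^sub>0 'f) set"

definition elem_module ::
  "'l::linorder \<Rightarrow> 'l \<Rightarrow> ('r::ring_1 \<Rightarrow> 'f::field) \<Rightarrow>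
   ('f, 'l \<times> 'l \<Rightarrow>\<^sub>0 'r, ('l, 'r, 'f) elem_vec) gmodule" where
  "elem_module \<alpha> \<beta> \<mu> =
    (let V = induced (McLain\<lparr>carrier := L_group \<alpha> \<beta>\<rparr>) (P_group \<alpha> \<beta>) (line (P_char \<alpha> \<beta> \<mu>)) in
      V\<lparr>act := (\<lambda>g. act V (L_proj \<alpha> \<beta> g))\<rparr>)"

definition basic :: "('l::linorder \<times> 'l) set \<Rightarrow> bool" where
  "basic D \<longleftrightarrow> finite D \<and> D \<noteq> {} \<and> D \<subseteq> Phi \<and> inj_on fst D \<and> inj_on snd D"

definition basic_module ::
  "('l::linorder \<times> 'l) set \<Rightarrow> ('l \<times> 'l \<Rightarrow> 'r::ring_1 \<Rightarrow> 'f::field) \<Rightarrow>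
   ('f, 'l \<times> 'l \<Rightarrow>\<^sub>0 'r, (('l \<times> 'l \<Rightarrow> ('l, 'r, 'f) elem_vec) \<Rightarrow>\<^sub>0 'f) set) gmodule" where
  "basic_module D f = tensor D (\<lambda>(\<alpha>, \<beta>). elem_module \<alpha> \<beta> (f (\<alpha>, \<beta>)))"

definition Gamma :: "('l::linorder \<times> 'l) set \<Rightarrow> ('l \<times> 'l) set" where
  "Gamma D = Phi - (\<Union>(\<alpha>, \<beta>)\<in>D. {(\<alpha>, \<gamma>) | \<gamma>. (\<alpha>, \<gamma>) \<in> Phi \<and> \<gamma> < \<beta>})"

definition Omega :: "('l::linorder \<times> 'l) set \<Rightarrow> ('l \<times> 'l) set" where
  "Omega D = {(\<alpha>, \<gamma>) \<in> Phi. \<exists>\<beta> \<delta>. (\<alpha>, \<beta>) \<in> D \<and> (\<gamma>, \<delta>) \<in> D \<and> \<alpha> < \<gamma> \<and> \<gamma> < \<beta> \<and> \<beta> < \<delta>}"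

definition H_group :: "('l::linorder \<times> 'l) set \<Rightarrow> ('l \<times> 'l \<Rightarrow>\<^sub>0 'r::ring_1) set" where
  "H_group D = McLain_sub (Gamma D)"

definition I_group :: "('l::linorder \<times> 'l) set \<Rightarrow> ('l \<times> 'l \<Rightarrow>\<^sub>0 'r::ring_1) set" where
  "I_group D = McLain_sub (Gamma D \<union> Omega D)"

end

theory Submission
  imports Defs
begin

text \<open>
  Elementary modules, and hence their tensor product \<open>V(D, f)\<close>, are monomial: basis vectors are
  labelled by tuples of row vectors, one for each \<open>(\<alpha>\<^sub>i, \<beta>\<^sub>i)\<close> in \<open>D\<close>, and \<open>g\<close> acts by right
  multiplication of the rows by \<open>g\<^sup>-\<^sup>1\<close>. The action on labels is transitive because the \<open>\<alpha>\<^sub>i\<close> are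
  distinct, and \<open>H\<close> is the stabiliser of the zero label. By Frobenius reciprocity the endomorphisms
  correspond to the vectors on which \<open>H\<close> acts as it acts on the zero label. A label supported on
  \<open>\<Omega>\<close> is itself such a vector, whereas any other label is fixed by some element of \<open>H\<close> acting on
  it by a different scalar, by right primitivity, and so cannot occur in such a vector. Hence the
  dimension is the number of labels supported on \<open>\<Omega>\<close>; these labels also represent the cosets of
  \<open>H\<close> in \<open>I\<close>.
\<close>

section \<open>Vector spaces in coordinates\<close>

text \<open>Why exactly \<open>Omega D\<close> appears: let a label have entry \<open>a\<close> at
  (\<alpha>, \<gamma>), with (\<alpha>, \<beta>) in \<open>D\<close>. Multiplying by an element of
  \<open>H\<close> adds \<open>a\<close> times row \<gamma> of that element. If \<open>D\<close>
  contains (\<gamma>, \<delta>) with \<delta> > \<beta>, row \<gamma> of every element of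
  \<open>H\<close> vanishes up to and including column \<beta>, so neither the label nor its scalar
  notices \<open>a\<close>. Otherwise the root group of (\<gamma>, \<beta>) lies in \<open>H\<close>
  and shifts the entry in column \<beta> by the multiples \<open>a * r\<close>; they form a right
  ideal, which is where right primitivity enters. As the \<beta>s are distinct, only one tensor
  factor reads its scalar from that column. The obstacle is that all modules are quotients by spans
  of relations, over possibly infinite bases. They are made explicit by a linear map to finitely
  supported functions on labels that kills the relations (independence), together with a normal form
  for each symbol (spanning).\<close>

abbreviation scale :: "'f::field \<Rightarrow> ('b \<Rightarrow>\<^sub>0 'f) \<Rightarrow> ('b \<Rightarrow>\<^sub>0 'f)" where
  "scale c \<equiv> Poly_Mapping.map ((*) c)"

text \<open>The linear extension of \<open>t\<close> from symbols to formal combinations;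
  coordinates, normal forms and group actions are all given in this form.\<close>

definition lext :: "('a \<Rightarrow> 'b \<Rightarrow>\<^sub>0 'f::field) \<Rightarrow> ('a \<Rightarrow>\<^sub>0 'f) \<Rightarrow> ('b \<Rightarrow>\<^sub>0 'f)" where
  "lext t p = (\<Sum>a\<in>Poly_Mapping.keys p. scale (Poly_Mapping.lookup p a) (t a))"

abbreviation supported :: "'a set \<Rightarrow> ('a \<Rightarrow>\<^sub>0 'f::zero) set" where
  "supported S \<equiv> {p. Poly_Mapping.keys p \<subseteq> S}"

lemma lookup_scale [simp]: "Poly_Mapping.lookup (scale c p) k = c * Poly_Mapping.lookup p k"
  by (simp add: Poly_Mapping.map.rep_eq when_def)

lemma scale_add_right: "scale c (p + q) = scale c p + scale c q"
  and scale_add_left: "scale (c + d) p = scale c p + scale d p"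
  and scale_scale [simp]: "scale c (scale d p) = scale (c * d) p"
  and scale_one [simp]: "scale 1 p = p"
  and scale_zero_left [simp]: "scale 0 p = 0"
  and scale_zero_right [simp]: "scale c 0 = 0"
  and scale_diff_right: "scale c (p - q) = scale c p - scale c q"
  and scale_minus_one: "scale (-1) p = - p"
  by (auto intro!: poly_mapping_eqI simp: lookup_add lookup_minus algebra_simps)

lemma scale_sum_right: "scale c (sum f A) = (\<Sum>x\<in>A. scale c (f x))"
  by (rule poly_mapping_eqI) (simp add: lookup_sum sum_distrib_left)

lemma scale_single [simp]: "scale c (Poly_Mapping.single k v) = Poly_Mapping.single k (c * v)"
  by (rule poly_mapping_eqI) (simp add: lookup_single when_def)

lemma keys_scale: "Poly_Mapping.keys (scale c p) \<subseteq> Poly_Mapping.keys p"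
  by (auto simp: in_keys_iff)

lemma supported_add: "p \<in> supported S \<Longrightarrow> q \<in> supported S \<Longrightarrow> p + q \<in> supported S"
  using keys_add[of p q] by auto

lemma supported_diff: "p \<in> supported S \<Longrightarrow> q \<in> supported S \<Longrightarrow> p - q \<in> supported S"
  for p q :: "'a \<Rightarrow>\<^sub>0 'b::ab_group_add"
  by (auto simp: in_keys_iff lookup_minus subset_iff) (metis diff_zero)

lemma supported_scale: "p \<in> supported S \<Longrightarrow> scale c p \<in> supported S"
  using keys_scale[of c p] by auto

lemma supported_sum: "(\<And>x. x \<in> A \<Longrightarrow> f x \<in> supported S) \<Longrightarrow> sum f A \<in> supported S"
  by (induct A rule: infinite_finite_induct) (auto dest!: keys_add[THEN subsetD])

lemma lext_superset:
  assumes "finite A" "Poly_Mapping.keys p \<subseteq> A"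
  shows "lext t p = (\<Sum>a\<in>A. scale (Poly_Mapping.lookup p a) (t a))"
  unfolding lext_def by (rule sum.mono_neutral_left) (use assms in \<open>auto simp: in_keys_iff\<close>)

lemma lext_add: "lext t (p + q) = lext t p + lext t q"
proof -
  let ?A = "Poly_Mapping.keys p \<union> Poly_Mapping.keys q"
  have "lext t (p + q) = (\<Sum>a\<in>?A. scale (Poly_Mapping.lookup (p + q) a) (t a))"
    by (rule lext_superset) (auto dest: keys_add[THEN subsetD])
  moreover have "lext t p = (\<Sum>a\<in>?A. scale (Poly_Mapping.lookup p a) (t a))"
    "lext t q = (\<Sum>a\<in>?A. scale (Poly_Mapping.lookup q a) (t a))"
    by (rule lext_superset; auto)+
  ultimately show ?thesis by (simp add: lookup_add scale_add_left sum.distrib)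
qed

lemma lext_scale: "lext t (scale c p) = scale c (lext t p)"
  by (subst lext_superset[of "Poly_Mapping.keys p"])
    (auto simp: keys_scale lext_def scale_sum_right)

lemma lext_zero [simp]: "lext t 0 = 0"
  by (simp add: lext_def)

lemma lext_diff: "lext t (p - q) = lext t p - lext t q"
  using lext_add[of t "p - q" q] by (simp add: algebra_simps)

lemma lext_sum: "lext t (sum f A) = (\<Sum>x\<in>A. lext t (f x))"
  by (induct A rule: infinite_finite_induct) (auto simp: lext_add)

lemma lext_single [simp]: "lext t (Poly_Mapping.single a c) = scale c (t a)"
  by (cases "c = 0") (auto simp: lext_def)

lemma lext_cong: "(\<And>a. a \<in> Poly_Mapping.keys p \<Longrightarrow> t a = s a) \<Longrightarrow> lext t p = lext s p"
  by (simp add: lext_def)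

lemma lext_lext: "lext s (lext t p) = lext (\<lambda>a. lext s (t a)) p"
  by (simp add: lext_def[of t] lext_def[of "\<lambda>a. lext s (t a)"] lext_sum lext_scale)

lemma lext_symb [simp]: "lext symb p = p"
  by (rule poly_mapping_eqI)
    (auto simp: lext_def lookup_sum lookup_single when_def in_keys_iff sum.delta if_distrib cong: if_cong)

lemma lookup_lext: "Poly_Mapping.lookup (lext t p) k
    = (\<Sum>a\<in>Poly_Mapping.keys p. Poly_Mapping.lookup p a * Poly_Mapping.lookup (t a) k)"
  by (simp add: lext_def lookup_sum)

lemma supported_lext:
  "(\<And>a. a \<in> Poly_Mapping.keys p \<Longrightarrow> t a \<in> supported S) \<Longrightarrow> lext t p \<in> supported S"
  unfolding lext_def by (rule supported_sum) (use supported_scale in blast)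

lemma push_eq_lext: "push \<pi> p = lext (\<lambda>s. symb (\<pi> s)) p"
  by (simp add: push_def lext_def)

text \<open>The module axioms are not assumed: they are pulled back along \<open>T\<close> from
  finitely supported functions. Quotients and Hom spaces thus need only closure and linearity of
  \<open>T\<close> to be checked.\<close>

locale coordinates =
  fixes V :: "('f::field, 'v, 'z) module_scheme" and B :: "'b set" and T :: "'v \<Rightarrow> 'b \<Rightarrow>\<^sub>0 'f"
  assumes bij: "bij_betw T (carrier V) (supported B)"
    and zero_closed: "\<zero>\<^bsub>V\<^esub> \<in> carrier V" and T_zero: "T \<zero>\<^bsub>V\<^esub> = 0"
    and add_closed: "x \<in> carrier V \<Longrightarrow> y \<in> carrier V \<Longrightarrow> x \<oplus>\<^bsub>V\<^esub> y \<in> carrier V"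
    and T_add: "x \<in> carrier V \<Longrightarrow> y \<in> carrier V \<Longrightarrow> T (x \<oplus>\<^bsub>V\<^esub> y) = T x + T y"
    and smult_closed: "x \<in> carrier V \<Longrightarrow> c \<odot>\<^bsub>V\<^esub> x \<in> carrier V"
    and T_smult: "x \<in> carrier V \<Longrightarrow> T (c \<odot>\<^bsub>V\<^esub> x) = scale c (T x)"
begin

definition vec :: "('b \<Rightarrow>\<^sub>0 'f) \<Rightarrow> 'v" where "vec = the_inv_into (carrier V) T"

lemma T_closed: "x \<in> carrier V \<Longrightarrow> T x \<in> supported B"
  using bij by (auto simp: bij_betw_def)

lemma T_eq_iff: "x \<in> carrier V \<Longrightarrow> y \<in> carrier V \<Longrightarrow> T x = T y \<longleftrightarrow> x = y"
  using bij by (auto simp: bij_betw_def inj_on_def)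

lemma vec_closed: "p \<in> supported B \<Longrightarrow> vec p \<in> carrier V"
  and T_vec: "p \<in> supported B \<Longrightarrow> T (vec p) = p"
  unfolding vec_def using bij
  by (auto simp: bij_betw_def f_the_inv_into_f intro!: the_inv_into_into[of T])

lemma vec_T: "x \<in> carrier V \<Longrightarrow> vec (T x) = x"
  unfolding vec_def using bij by (simp add: bij_betw_def the_inv_into_f_f)

lemma vec_add: "p \<in> supported B \<Longrightarrow> q \<in> supported B \<Longrightarrow> vec (p + q) = vec p \<oplus>\<^bsub>V\<^esub> vec q"
  using vec_T[of "vec p \<oplus>\<^bsub>V\<^esub> vec q"] by (simp only: T_add vec_closed add_closed T_vec)

lemma vec_scale: "p \<in> supported B \<Longrightarrow> vec (scale c p) = c \<odot>\<^bsub>V\<^esub> vec p"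
  using vec_T[of "c \<odot>\<^bsub>V\<^esub> vec p"] by (simp only: T_smult vec_closed smult_closed T_vec)

lemma is_abelian_group: "abelian_group V"
proof (rule abelian_groupI)
  fix x assume x: "x \<in> carrier V"
  have "(-1) \<odot>\<^bsub>V\<^esub> x \<oplus>\<^bsub>V\<^esub> x = \<zero>\<^bsub>V\<^esub>"
    by (subst T_eq_iff[symmetric])
      (simp_all add: x smult_closed add_closed zero_closed T_add T_smult T_zero scale_minus_one)
  then show "\<exists>y\<in>carrier V. y \<oplus>\<^bsub>V\<^esub> x = \<zero>\<^bsub>V\<^esub>" using smult_closed[OF x] by blast
qed (simp_all add: zero_closed add_closed T_eq_iff[symmetric] T_add T_zero ac_simps)

lemma is_module: "module class_ring V"
proof -
  have "cring (class_ring :: 'f ring)"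
    by (rule class_cring.cring_axioms)
  then show ?thesis
    using is_abelian_group
    by (rule moduleI)
      (simp_all add: smult_closed add_closed T_eq_iff[symmetric] T_smult T_add scale_add_left
        scale_add_right)
qed

lemma is_vectorspace: "vectorspace class_ring V"
  unfolding vectorspace_def using is_module class_field.field_axioms by blast

sublocale vs: vectorspace class_ring V by (rule is_vectorspace)

lemma T_lincomb:
  assumes "finite A" "A \<subseteq> carrier V"
  shows "T (vs.lincomb a A) = (\<Sum>v\<in>A. scale (a v) (T v))"
proof -
  have "h \<in> A \<rightarrow> carrier V \<Longrightarrow> T (finsum V h A) = (\<Sum>v\<in>A. T (h v))" for h
    using assms(1)
  proof (induct A)
    case (insert x F)
    then show ?case by (auto simp: T_add vs.M.finsum_insert Pi_def)
  qed (simp add: T_zero)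
  from this[of "\<lambda>v. a v \<odot>\<^bsub>V\<^esub> v"] show ?thesis
    unfolding vs.lincomb_def using assms by (auto simp: T_smult smult_closed subset_iff)
qed

lemma basis: "vs.basis ((\<lambda>b. vec (symb b)) ` B)" and card_basis: "|(\<lambda>b. vec (symb b)) ` B| =o |B|"
proof -
  let ?e = "\<lambda>b. vec (symb b)"
  have e: "?e b \<in> carrier V" "T (?e b) = symb b" if "b \<in> B" for b
    using that by (auto intro!: vec_closed T_vec)
  have inj: "inj_on ?e B"
    by (rule inj_onI) (metis e(2) lookup_single_eq lookup_single_not_eq zero_neq_one)
  show "|?e ` B| =o |B|"
    using inj by (metis card_of_ordIsoI inj_on_imp_bij_betw ordIso_symmetric)
  have sub: "?e ` B \<subseteq> carrier V" using e by auto
  have "vs.lin_indpt (?e ` B)"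
  proof
    assume "vs.lin_dep (?e ` B)"
    then obtain A a v where A: "finite A" "A \<subseteq> ?e ` B" "vs.lincomb a A = \<zero>\<^bsub>V\<^esub>" "v \<in> A" "a v \<noteq> 0"
      unfolding vs.lin_dep_def by auto
    from A(2,4) obtain b where b: "b \<in> B" "v = ?e b" by auto
    \<comment> \<open>Coordinate \<open>b\<close> of the vanishing combination isolates the
      coefficient of \<open>v\<close>.\<close>
    have "Poly_Mapping.lookup (T w) b = (if w = v then 1 else 0)" if "w \<in> A" for w
      using that A(2) b e inj by (auto simp: lookup_single when_def)
    then have "(\<Sum>w\<in>A. a w * Poly_Mapping.lookup (T w) b) = (\<Sum>w\<in>A. if w = v then a w else 0)"
      by (intro sum.cong) auto
    then have "(\<Sum>w\<in>A. a w * Poly_Mapping.lookup (T w) b) = a v"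
      using A(1,4) by simp
    moreover have "(\<Sum>w\<in>A. scale (a w) (T w)) = 0"
      using T_lincomb[of A a] A sub T_zero by auto
    then have "Poly_Mapping.lookup (\<Sum>w\<in>A. scale (a w) (T w)) b = 0" by simp
    ultimately show False using A(5) by (simp add: lookup_sum)
  qed
  moreover have "vs.span (?e ` B) = carrier V"
  proof
    show "vs.span (?e ` B) \<subseteq> carrier V" using vs.span_is_subset2[OF sub] .
    interpret S: submodule class_ring "vs.span (?e ` B)" V using vs.span_is_submodule[OF sub] .
    have "vec (\<Sum>b\<in>K. scale (Poly_Mapping.lookup p b) (symb b)) \<in> vs.span (?e ` B)"
      if "finite K" "K \<subseteq> B" for p K
      using that
    proof (induct K)
      case empty
      then show ?case using vec_T[OF zero_closed] by (simp add: T_zero)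
    next
      case (insert b K)
      have "?e b \<in> vs.span (?e ` B)" using insert vs.in_own_span[OF sub] by auto
      moreover have "vec (scale (Poly_Mapping.lookup p b) (symb b) + (\<Sum>b\<in>K. scale (Poly_Mapping.lookup p b) (symb b)))
        = Poly_Mapping.lookup p b \<odot>\<^bsub>V\<^esub> ?e b \<oplus>\<^bsub>V\<^esub> vec (\<Sum>b\<in>K. scale (Poly_Mapping.lookup p b) (symb b))"
        by (subst vec_add; (subst vec_scale[symmetric])?; (intro supported_sum supported_scale)?)
           (use insert in auto)
      ultimately show ?case using insert S.m_closed S.smult_closed by auto
    qed
    then have "vec (lext symb p) \<in> vs.span (?e ` B)" if "p \<in> supported B" for p
      unfolding lext_def using that by simp
    then show "carrier V \<subseteq> vs.span (?e ` B)"
      using vec_T T_closed by (metis lext_symb subsetI)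
  qed
  ultimately show "vs.basis (?e ` B)" unfolding vs.basis_def using sub by auto
qed

lemma has_dim: "|B| =o \<kappa> \<Longrightarrow> has_dim V \<kappa>"
  unfolding has_dim_def using is_vectorspace basis card_basis ordIso_transitive by blast

end

section \<open>Induced modules and tensor products\<close>

lemma coordinates_free_space: "coordinates (free_space S) S (\<lambda>p. p)"
  by unfold_locales (auto simp: free_space_def bij_betw_def dest: supported_add supported_scale
      dest!: keys_add[THEN subsetD] keys_scale[THEN subsetD])

text \<open>Translates the span into the operations of \<open>Poly_Mapping\<close>. The last item is
  the source of all independence statements: a linear extension that kills the relations kills their
  span.\<close>

lemma presented_span:
  fixes Rel :: "('s \<Rightarrow>\<^sub>0 'f::field) set"
  assumes "Rel \<subseteq> supported S"
  defines "K \<equiv> LinearCombinations.module.span class_ring (free_space S) Rel"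
  shows span_subset_supported: "K \<subseteq> supported S"
    and span_zero: "0 \<in> K"
    and span_add: "p \<in> K \<Longrightarrow> q \<in> K \<Longrightarrow> p + q \<in> K"
    and span_scale: "p \<in> K \<Longrightarrow> scale c p \<in> K"
    and span_diff: "p \<in> K \<Longrightarrow> q \<in> K \<Longrightarrow> p - q \<in> K"
    and span_sum: "(\<And>x. x \<in> X \<Longrightarrow> h x \<in> K) \<Longrightarrow> sum h X \<in> K"
    and Rel_subset_span: "Rel \<subseteq> K"
    and span_lext_zero: "(\<And>r. r \<in> Rel \<Longrightarrow> lext \<theta> r = 0) \<Longrightarrow> p \<in> K \<Longrightarrow> lext \<theta> p = 0"
proof -
  interpret F: coordinates "free_space S" S "\<lambda>p. p" by (rule coordinates_free_space)
  have Rel: "Rel \<subseteq> carrier (free_space S)" using assms by (simp add: free_space_def)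
  interpret K: submodule class_ring K "free_space S"
    unfolding K_def by (rule F.vs.span_is_submodule[OF Rel])
  show "K \<subseteq> supported S" using K.subset by (simp add: free_space_def)
  show K0: "0 \<in> K" using K.zero_closed by (simp add: free_space_def)
  show Kadd: "p \<in> K \<Longrightarrow> q \<in> K \<Longrightarrow> p + q \<in> K" for p q
    using K.m_closed[of p q] by (simp add: free_space_def)
  show Ks: "p \<in> K \<Longrightarrow> scale c p \<in> K" for p c
    using K.smult_closed[of c p] by (simp add: free_space_def)
  show "p - q \<in> K" if "p \<in> K" "q \<in> K"
    using Kadd[OF that(1) Ks[OF that(2), of "-1"]] by (simp add: scale_minus_one)
  show "sum h X \<in> K" if "\<And>x. x \<in> X \<Longrightarrow> h x \<in> K"
    using that by (induct X rule: infinite_finite_induct) (auto simp: K0 Kadd)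
  show "Rel \<subseteq> K" unfolding K_def by (rule F.vs.in_own_span[OF Rel])
  show "lext \<theta> p = 0" if \<theta>: "\<And>r. r \<in> Rel \<Longrightarrow> lext \<theta> r = 0" and p: "p \<in> K"
  proof -
    have "submodule class_ring {q \<in> supported S. lext \<theta> q = 0} (free_space S)"
      by (rule submodule.intro[OF F.is_module])
        (auto simp: free_space_def lext_add lext_scale dest!: keys_add[THEN subsetD] keys_scale[THEN subsetD])
    then have "K \<subseteq> {q \<in> supported S. lext \<theta> q = 0}"
      unfolding K_def by (rule F.vs.span_is_subset[rotated]) (use assms \<theta> in auto)
    then show ?thesis using p by auto
  qed
qed

text \<open>If \<theta> kills the relations and every symbol is congruent to its normal form, the
  span of the relations is exactly the kernel of \<open>lext \<theta>\<close>, so the elements of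
  the quotient are the fibres \<open>F z\<close>. The quantifiers are arranged so that one
  \<open>T\<close> serves every \<open>g\<close> and every matrix \<open>a\<close> compatible with
  the action on symbols.\<close>

lemma presented_coordinates:
  fixes Rel :: "('s \<Rightarrow>\<^sub>0 'f::field) set" and \<theta> :: "'s \<Rightarrow> 'b \<Rightarrow>\<^sub>0 'f" and \<pi> :: "'g \<Rightarrow> 's \<Rightarrow> 's"
  assumes Rel: "Rel \<subseteq> supported S"
    and \<theta>: "\<And>s. s \<in> S \<Longrightarrow> \<theta> s \<in> supported B"
    and \<theta>_Rel: "\<And>r. r \<in> Rel \<Longrightarrow> lext \<theta> r = 0"
    and \<sigma>: "\<And>b. b \<in> B \<Longrightarrow> \<sigma> b \<in> S" "\<And>b. b \<in> B \<Longrightarrow> \<theta> (\<sigma> b) = symb b"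
    and gen: "\<And>s. s \<in> S \<Longrightarrow> symb s - lext (\<lambda>b. symb (\<sigma> b)) (\<theta> s)
      \<in> LinearCombinations.module.span class_ring (free_space S) Rel"
  shows "\<exists>T. coordinates (presented S Rel \<pi>) B T \<and>
    (\<forall>g a. (\<forall>s\<in>S. \<pi> g s \<in> S \<and> \<theta> (\<pi> g s) = lext a (\<theta> s)) \<longrightarrow>
      (\<forall>x\<in>carrier (presented S Rel \<pi>).
        act (presented S Rel \<pi>) g x \<in> carrier (presented S Rel \<pi>) \<and>
        T (act (presented S Rel \<pi>) g x) = lext a (T x)))"
proof -
  define K where "K = LinearCombinations.module.span class_ring (free_space S) Rel"
  note K_props = presented_span[OF Rel, folded K_def]
  define F where "F z = {q \<in> supported S. lext \<theta> q = z}" for z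
  let ?P = "presented S Rel \<pi>"
  have K_eq: "K = F 0"
  proof
    show "K \<subseteq> F 0" using K_props(1) K_props(8)[of \<theta>] \<theta>_Rel by (auto simp: F_def)
    show "F 0 \<subseteq> K"
    proof
      fix q assume q: "q \<in> F 0"
      \<comment> \<open>Replacing each symbol of \<open>q\<close> by its normal form changes
        \<open>q\<close> by an element of \<open>K\<close>; the result is the normal form of
        \<open>lext \<theta> q\<close>, which is 0.\<close>
      have "(\<Sum>s\<in>Poly_Mapping.keys q. scale (Poly_Mapping.lookup q s) (symb s - lext (\<lambda>b. symb (\<sigma> b)) (\<theta> s))) \<in> K"
        by (intro K_props(4,6)) (use q gen in \<open>auto simp: F_def K_def\<close>)
      also have "(\<Sum>s\<in>Poly_Mapping.keys q. scale (Poly_Mapping.lookup q s) (symb s - lext (\<lambda>b. symb (\<sigma> b)) (\<theta> s)))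
        = lext symb q - lext (\<lambda>s. lext (\<lambda>b. symb (\<sigma> b)) (\<theta> s)) q"
        by (simp add: lext_def[of symb] lext_def[of "\<lambda>s. lext (\<lambda>b. symb (\<sigma> b)) (\<theta> s)"] scale_diff_right sum_subtractf
            del: lext_symb scale_single)
      also have "\<dots> = q" using q by (simp add: lext_lext[symmetric] F_def)
      finally show "q \<in> K" .
    qed
  qed
  have coset: "K +>\<^bsub>free_space S\<^esub> p = F (lext \<theta> p)" if "p \<in> supported S" for p
  proof -
    have "K +>\<^bsub>free_space S\<^esub> p = {k + p | k. k \<in> K}"
      by (auto simp: a_r_coset_def' free_space_def)
    also have "\<dots> = F (lext \<theta> p)"
    proof (intro Set.set_eqI iffI)
      fix q assume "q \<in> F (lext \<theta> p)"
      then have "q - p \<in> K"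
        using that supported_diff[of q S p] by (auto simp: K_eq F_def lext_diff)
      then show "q \<in> {k + p | k. k \<in> K}" by (intro CollectI exI[of _ "q - p"]) simp
    next
      fix q assume "q \<in> {k + p | k. k \<in> K}"
      then obtain k where "q = k + p" "k \<in> K" by auto
      then show "q \<in> F (lext \<theta> p)"
        using that supported_add[of k S p] by (auto simp: K_eq F_def lext_add)
    qed
    finally show ?thesis .
  qed
  have surj: "\<exists>p\<in>supported S. lext \<theta> p = z" if "z \<in> supported B" for z
  proof
    show "lext (\<lambda>b. symb (\<sigma> b)) z \<in> supported S"
      by (rule supported_lext) (use that \<sigma> in auto)
    have "lext \<theta> (lext (\<lambda>b. symb (\<sigma> b)) z) = lext symb z"
      unfolding lext_lext by (rule lext_cong) (use that \<sigma> in auto)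
    then show "lext \<theta> (lext (\<lambda>b. symb (\<sigma> b)) z) = z" by simp
  qed
  have lext_closed: "lext \<theta> p \<in> supported B" if "p \<in> supported S" for p
    using that \<theta> by (intro supported_lext) auto
  have carrier: "carrier ?P = F ` supported B"
  proof -
    have "carrier ?P = (\<lambda>p. F (lext \<theta> p)) ` supported S"
      using coset by (auto simp: presented_def Let_def A_RCOSETS_def' K_def[symmetric])
        (auto simp: free_space_def)
    also have "\<dots> = F ` lext \<theta> ` supported S" by (simp only: image_image)
    also have "lext \<theta> ` supported S = supported B"
      using surj lext_closed by (intro equalityI subsetI) (blast, metis image_eqI)
    finally show ?thesis .
  qed
  \<comment> \<open>Any representative will do, because \<open>lext \<theta>\<close> is constant on
    a coset.\<close>
  define T where "T C = lext \<theta> (SOME p. p \<in> C)" for C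
  have T_F: "T (F z) = z" if "z \<in> supported B" for z
  proof -
    have "\<exists>p. p \<in> F z" using surj[OF that] by (auto simp: F_def)
    then have "(SOME p. p \<in> F z) \<in> F z" by (rule someI_ex)
    then show ?thesis unfolding T_def by (simp only: F_def mem_Collect_eq)
  qed
  have ne: "F z \<noteq> {}" if "z \<in> supported B" for z using surj[OF that] by (auto simp: F_def)
  have zero: "\<zero>\<^bsub>?P\<^esub> = F 0" by (simp add: presented_def Let_def K_def[symmetric] K_eq)
  have add: "F z \<oplus>\<^bsub>?P\<^esub> F w = F (z + w)" if "z \<in> supported B" "w \<in> supported B" for z w
  proof -
    have "F z \<oplus>\<^bsub>?P\<^esub> F w = {p + q | p q. p \<in> F z \<and> q \<in> F w}"
      by (auto simp: presented_def Let_def set_add_def set_mult_def free_space_def)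
    also have "\<dots> = F (z + w)"
    proof (intro Set.set_eqI iffI)
      fix r assume r: "r \<in> F (z + w)"
      obtain p where p: "p \<in> F z" using ne[OF \<open>z \<in> supported B\<close>] by auto
      then have "r - p \<in> F w"
        using r supported_diff[of r S p] by (auto simp: F_def lext_diff)
      then show "r \<in> {p + q | p q. p \<in> F z \<and> q \<in> F w}"
        using p by (intro CollectI exI[of _ p] exI[of _ "r - p"]) auto
    next
      fix r assume "r \<in> {p + q | p q. p \<in> F z \<and> q \<in> F w}"
      then obtain p q where "r = p + q" "p \<in> F z" "q \<in> F w" by blast
      then show "r \<in> F (z + w)"
        using supported_add[of p S q] by (auto simp: F_def lext_add)
    qed
    finally show ?thesis .
  qed
  have smult: "c \<odot>\<^bsub>?P\<^esub> F z = F (scale c z)" if "z \<in> supported B" for c z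
  proof -
    have "c \<odot>\<^bsub>?P\<^esub> F z = (\<Union>p\<in>F z. K +>\<^bsub>free_space S\<^esub> scale c p)"
      by (simp add: presented_def Let_def K_def[symmetric]) (simp add: free_space_def)
    also have "\<dots> = (\<Union>p\<in>F z. F (scale c z))"
      by (rule SUP_cong[OF refl]) (subst coset, auto simp: F_def lext_scale dest!: keys_scale[THEN subsetD])
    finally show ?thesis using ne[OF that] by simp
  qed
  have act: "act ?P g (F z) = F (lext a z)"
    if "z \<in> supported B" and a: "\<forall>s\<in>S. \<pi> g s \<in> S \<and> \<theta> (\<pi> g s) = lext a (\<theta> s)" for g a z
  proof -
    have push: "push (\<pi> g) p \<in> supported S" "lext \<theta> (push (\<pi> g) p) = lext a z" if p: "p \<in> F z" for p
    proof -
      show "push (\<pi> g) p \<in> supported S"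
        unfolding push_eq_lext by (rule supported_lext) (use p a in \<open>auto simp: F_def\<close>)
      have "lext \<theta> (push (\<pi> g) p) = lext (\<lambda>s. lext a (\<theta> s)) p"
        unfolding push_eq_lext lext_lext by (rule lext_cong) (use p a in \<open>auto simp: F_def\<close>)
      then show "lext \<theta> (push (\<pi> g) p) = lext a z" using p by (simp add: lext_lext[symmetric] F_def)
    qed
    have "act ?P g (F z) = (\<Union>p\<in>F z. K +>\<^bsub>free_space S\<^esub> push (\<pi> g) p)"
      by (simp add: presented_def Let_def K_def[symmetric])
    also have "\<dots> = (\<Union>p\<in>F z. F (lext a z))"
      by (rule SUP_cong[OF refl]) (use push coset in auto)
    finally show ?thesis using ne[OF that(1)] by simp
  qed
  have act_closed: "lext a z \<in> supported B"
    if "z \<in> supported B" and a: "\<forall>s\<in>S. \<pi> g s \<in> S \<and> \<theta> (\<pi> g s) = lext a (\<theta> s)" for g a z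
  proof (rule supported_lext)
    fix b assume "b \<in> Poly_Mapping.keys z"
    then have "b \<in> B" using that(1) by auto
    \<comment> \<open>The compatibility condition on symbols, evaluated at the normal form of
      \<open>b\<close>, identifies \<open>a b\<close>.\<close>
    then have "\<theta> (\<pi> g (\<sigma> b)) = a b" "\<pi> g (\<sigma> b) \<in> S" using a \<sigma> by auto
    then show "a b \<in> supported B" using \<theta> by metis
  qed
  show ?thesis
  proof (intro exI conjI allI impI)
    show "coordinates ?P B T"
    proof
      show "bij_betw T (carrier ?P) (supported B)"
        unfolding carrier by (rule bij_betw_byWitness[of _ F]) (auto simp: T_F)
    qed (auto simp: carrier zero T_F add smult supported_add[simplified] supported_scale[simplified]
        intro!: imageI)
    fix g a
    assume a: "\<forall>s\<in>S. \<pi> g s \<in> S \<and> \<theta> (\<pi> g s) = lext a (\<theta> s)"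
    show "\<forall>x\<in>carrier ?P. act ?P g x \<in> carrier ?P \<and> T (act ?P g x) = lext a (T x)"
      using act[OF _ a] act_closed[OF _ a] by (auto simp: carrier T_F)
  qed
qed

section \<open>Modules induced from a line\<close>

lemma alg_mult_eq_lext: "alg_mult G a b = lext (\<lambda>x. lext (\<lambda>y. symb (x \<otimes>\<^bsub>G\<^esub> y)) b) a"
  by (simp add: alg_mult_def lext_def scale_sum_right)

text \<open>On the record \<open>line \<chi>\<close> the abstract \<open>finsum\<close> is the
  ordinary sum of the field, so an element of the group algebra acts by a scalar.\<close>

lemma alg_act_line:
  fixes \<chi> :: "'g \<Rightarrow> 'f::field"
  shows "alg_act (line \<chi>) b w = (\<Sum>h\<in>Poly_Mapping.keys b. Poly_Mapping.lookup b h * \<chi> h) * w"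
proof -
  interpret L: abelian_monoid "line \<chi>"
    by (rule abelian_monoidI) (auto simp: line_def algebra_simps)
  have "finsum (line \<chi>) f A = sum f A" if "finite A" for f and A :: "'g set"
    using that by (induct A) (auto simp: line_def L.finsum_insert[unfolded line_def, simplified]
      L.finsum_empty[unfolded line_def, simplified])
  from this[of "Poly_Mapping.keys b" "\<lambda>h. Poly_Mapping.lookup b h \<odot>\<^bsub>line \<chi>\<^esub> act (line \<chi>) h w"]
  show ?thesis by (simp add: alg_act_def) (simp add: line_def sum_distrib_right mult.assoc)
qed

text \<open>There is one basis vector per coset g H, labelled by \<open>\<kappa> g\<close>, and
  \<open>coef g\<close> is the scalar by which g \<otimes> 1 differs from rep (\<kappa> g) \<otimes>
  1. It equals \<open>\<chi> h\<close> for g = rep (\<kappa> g) h; leaving it abstract allows a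
  closed formula to be supplied.\<close>

lemma induced_line_coordinates:
  fixes G :: "('g, 'm) monoid_scheme" and \<chi> coef :: "'g \<Rightarrow> 'f::field"
    and \<kappa> :: "'g \<Rightarrow> 'b" and rep :: "'b \<Rightarrow> 'g"
  assumes "group G" and H: "H \<subseteq> carrier G" "\<one>\<^bsub>G\<^esub> \<in> H" "\<chi> \<one>\<^bsub>G\<^esub> = 1"
    and \<kappa>: "\<And>g. g \<in> carrier G \<Longrightarrow> \<kappa> g \<in> B"
    and rep: "\<And>b. b \<in> B \<Longrightarrow> rep b \<in> carrier G" "\<And>b. b \<in> B \<Longrightarrow> \<kappa> (rep b) = b"
      "\<And>b. b \<in> B \<Longrightarrow> coef (rep b) = 1"
    and \<kappa>_mult: "\<And>g h. g \<in> carrier G \<Longrightarrow> h \<in> H \<Longrightarrow> \<kappa> (g \<otimes>\<^bsub>G\<^esub> h) = \<kappa> g"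
    and coef_mult: "\<And>g h. g \<in> carrier G \<Longrightarrow> h \<in> H \<Longrightarrow> coef (g \<otimes>\<^bsub>G\<^esub> h) = coef g * \<chi> h"
    and decomp: "\<And>g. g \<in> carrier G \<Longrightarrow> \<exists>h\<in>H. g = rep (\<kappa> g) \<otimes>\<^bsub>G\<^esub> h"
  defines "V \<equiv> induced G H (line \<chi>)"
  shows "\<exists>T. coordinates V B T \<and> (\<forall>g\<in>carrier G. \<forall>x\<in>carrier V. act V g x \<in> carrier V \<and>
    T (act V g x) = lext (\<lambda>b. Poly_Mapping.single (\<kappa> (g \<otimes>\<^bsub>G\<^esub> rep b)) (coef (g \<otimes>\<^bsub>G\<^esub> rep b))) (T x))"
proof -
  interpret G: group G by fact
  define FG :: "('g \<Rightarrow>\<^sub>0 'f) set" where "FG = supported (carrier G)"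
  define FH :: "('g \<Rightarrow>\<^sub>0 'f) set" where "FH = supported H"
  define R1 :: "(('g \<Rightarrow>\<^sub>0 'f) \<times> 'f \<Rightarrow>\<^sub>0 'f) set" where
    "R1 = {symb (a + a', w) - symb (a, w) - symb (a', w) | a a' w. a \<in> FG \<and> a' \<in> FG}"
  define R2 :: "(('g \<Rightarrow>\<^sub>0 'f) \<times> 'f \<Rightarrow>\<^sub>0 'f) set" where
    "R2 = {symb (a, w + w') - symb (a, w) - symb (a, w') | a w w'. a \<in> FG}"
  define R3 :: "(('g \<Rightarrow>\<^sub>0 'f) \<times> 'f \<Rightarrow>\<^sub>0 'f) set" where
    "R3 = {symb (alg_mult G a b, w) - symb (a, alg_act (line \<chi>) b w) | a b w. a \<in> FG \<and> b \<in> FH}"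
  define R4 :: "(('g \<Rightarrow>\<^sub>0 'f) \<times> 'f \<Rightarrow>\<^sub>0 'f) set" where
    "R4 = {symb (scale c a, w) - Poly_Mapping.single (a, w) c | c a w. a \<in> FG}"
  define S :: "(('g \<Rightarrow>\<^sub>0 'f) \<times> 'f) set" where "S = FG \<times> UNIV"
  define Rel where "Rel = R1 \<union> R2 \<union> R3 \<union> R4"
  define \<pi> :: "'g \<Rightarrow> ('g \<Rightarrow>\<^sub>0 'f) \<times> 'f \<Rightarrow> ('g \<Rightarrow>\<^sub>0 'f) \<times> 'f" where "\<pi> g = (\<lambda>(a, w). (alg_mult G (symb g) a, w))" for g
  have V: "V = presented S Rel \<pi>"
    unfolding V_def induced_def Let_def Rel_def S_def R1_def R2_def R3_def R4_def \<pi>_def FG_def FH_def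
    by (simp add: free_space_def line_def)
  have FG_mult: "alg_mult G a b \<in> FG" if "a \<in> FG" "b \<in> FG" for a b
    unfolding alg_mult_eq_lext FG_def
    by (intro supported_lext) (use that in \<open>auto simp: FG_def subset_iff\<close>)
  have FG_add: "a + b \<in> FG" if "a \<in> FG" "b \<in> FG" for a b
    using supported_add that unfolding FG_def by blast
  have FG_scale: "scale c a \<in> FG" if "a \<in> FG" for a c
    using supported_scale that unfolding FG_def by blast
  have FH: "b \<in> FG" if "b \<in> FH" for b using that H by (auto simp: FG_def FH_def)
  have FG_single: "Poly_Mapping.single g c \<in> FG" if "g \<in> carrier G" for g c using that by (simp add: FG_def)
  have Rel: "Rel \<subseteq> supported S"
    unfolding Rel_def R1_def R2_def R3_def R4_def
    by (intro Un_least subsetI; elim CollectE exE conjE; hypsubst; intro supported_diff)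
      (auto simp: S_def FG_mult FG_add FG_scale FH)
  \<comment> \<open>\<open>t g\<close> is the coordinate vector of g \<otimes> 1;
    \<open>\<theta>\<close> extends it to all symbols, and \<open>\<sigma> b\<close> is the symbol
    of rep b \<otimes> 1.\<close>
  define t where "t g = Poly_Mapping.single (\<kappa> g) (coef g)" for g
  define \<theta> where "\<theta> = (\<lambda>(a, w). scale w (lext t a))"
  define \<sigma> :: "'b \<Rightarrow> ('g \<Rightarrow>\<^sub>0 'f) \<times> 'f" where "\<sigma> b = (symb (rep b), 1)" for b
  have t_mult: "t (g \<otimes>\<^bsub>G\<^esub> h) = scale (\<chi> h) (t g)" if "g \<in> carrier G" "h \<in> H" for g h
    using that by (simp add: t_def \<kappa>_mult coef_mult mult.commute)
  have lext_alg_mult: "lext t (alg_mult G a b) = lext (\<lambda>x. lext (\<lambda>y. t (x \<otimes>\<^bsub>G\<^esub> y)) b) a" for a b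
    by (simp add: alg_mult_eq_lext lext_lext)
  define K where "K = LinearCombinations.module.span class_ring (free_space S) Rel"
  note K_props = presented_span[OF Rel, folded K_def]
  have K1: "symb (a + a', w) - symb (a, w) - symb (a', w) \<in> K" if "a \<in> FG" "a' \<in> FG" for a a' w
    using K_props(7) that unfolding Rel_def R1_def by blast
  have K3: "symb (alg_mult G a b, w) - symb (a, alg_act (line \<chi>) b w) \<in> K" if "a \<in> FG" "b \<in> FH" for a b w
    using K_props(7) that unfolding Rel_def R3_def by blast
  have K4: "symb (scale c a, w) - Poly_Mapping.single (a, w) c \<in> K" if "a \<in> FG" for c a w
    using K_props(7) that unfolding Rel_def R4_def by blast
  \<comment> \<open>The scalar \<open>w\<close> crosses the tensor sign as the element w 1 of
    \<open>FH\<close>: it sends 1 to \<open>w\<close> on the line, and multiplying \<open>a\<close>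
    by it gives \<open>scale w a\<close>.\<close>
  have s1: "symb (a, w) - Poly_Mapping.single (a, 1) w \<in> K" if a: "a \<in> FG" for a w
  proof -
    have "alg_mult G a (Poly_Mapping.single \<one>\<^bsub>G\<^esub> w) = lext (\<lambda>x. scale w (symb x)) a"
      unfolding alg_mult_eq_lext by (rule lext_cong) (use a in \<open>auto simp: FG_def subset_iff\<close>)
    also have "\<dots> = scale w (lext symb a)" by (simp add: lext_def scale_sum_right mult.commute del: lext_symb)
    finally have m: "alg_mult G a (Poly_Mapping.single \<one>\<^bsub>G\<^esub> w) = scale w a" by simp
    have b: "alg_act (line \<chi>) (Poly_Mapping.single \<one>\<^bsub>G\<^esub> w) 1 = w"
      using H(3) by (cases "w = 0") (auto simp: alg_act_line)
    have "Poly_Mapping.single \<one>\<^bsub>G\<^esub> w \<in> FH" using H by (simp add: FH_def)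
    from K_props(5)[OF K4[OF a, of w 1] K3[OF a this, of 1]] show ?thesis by (simp add: m b)
  qed
  \<comment> \<open>With g = rep (\<kappa> g) h, the factor h crosses the tensor sign and becomes
    the scalar \<chi> h = coef g.\<close>
  have s2: "symb (symb g, 1) - scale (coef g) (symb (\<sigma> (\<kappa> g))) \<in> K" if g: "g \<in> carrier G" for g
  proof -
    obtain h where h: "h \<in> H" "g = rep (\<kappa> g) \<otimes>\<^bsub>G\<^esub> h" using decomp[OF g] by blast
    have c: "coef g = \<chi> h"
      using h coef_mult[OF rep(1)[OF \<kappa>[OF g]] h(1)] rep(3)[OF \<kappa>[OF g]] by simp
    have "symb (alg_mult G (symb (rep (\<kappa> g))) (symb h), 1) - symb (symb (rep (\<kappa> g)), alg_act (line \<chi>) (symb h) 1) \<in> K"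
      by (rule K3) (use h rep(1)[OF \<kappa>[OF g]] in \<open>auto simp: FH_def FG_def\<close>)
    then have "symb (symb g, 1) - symb (symb (rep (\<kappa> g)), \<chi> h) \<in> K"
      using h(2) by (simp add: alg_mult_eq_lext alg_act_line)
    from K_props(3)[OF this s1[OF FG_single[OF rep(1)[OF \<kappa>[OF g]], of 1], of "\<chi> h"]] show ?thesis
      by (simp add: c \<sigma>_def)
  qed
  have s3: "symb (\<Sum>g\<in>A. scale (c g) (symb g), 1) - (\<Sum>g\<in>A. scale (c g) (symb (symb g, 1))) \<in> K"
    if "finite A" "A \<subseteq> carrier G" for A c
    using that
  proof (induct A)
    case empty
    \<comment> \<open>The symbol of the zero element is not zero in the free space; the scalar
      relation with factor 0 removes it.\<close>
    then show ?case using K4[of 0 0 1] by (simp add: FG_def)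
  next
    case (insert g A)
    let ?a = "\<Sum>g\<in>A. scale (c g) (symb g)"
    have a: "?a \<in> FG" unfolding FG_def by (intro supported_sum supported_scale) (use insert in auto)
    have "symb (scale (c g) (symb g) + ?a, 1) - symb (scale (c g) (symb g), 1) - symb (?a, 1) \<in> K"
      by (rule K1[OF _ a]) (use insert in \<open>auto simp: FG_def\<close>)
    moreover have "symb (scale (c g) (symb g), 1) - Poly_Mapping.single (symb g, 1) (c g) \<in> K"
      by (rule K4) (use insert in \<open>auto simp: FG_def\<close>)
    moreover have "symb (?a, 1) - (\<Sum>g\<in>A. scale (c g) (symb (symb g, 1))) \<in> K"
      using insert by auto
    ultimately have "(symb (scale (c g) (symb g) + ?a, 1) - symb (scale (c g) (symb g), 1) - symb (?a, 1)) +
      ((symb (scale (c g) (symb g), 1) - Poly_Mapping.single (symb g, 1) (c g)) +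
      (symb (?a, 1) - (\<Sum>g\<in>A. scale (c g) (symb (symb g, 1))))) \<in> K"
      by (intro K_props(3))
    then show ?case using insert by (simp add: algebra_simps)
  qed
  have gen: "symb s - lext (\<lambda>b. symb (\<sigma> b)) (\<theta> s) \<in> K" if "s \<in> S" for s
  proof -
    obtain a w where s: "s = (a, w)" "a \<in> FG" using \<open>s \<in> S\<close> by (auto simp: S_def)
    let ?A = "Poly_Mapping.keys a" and ?c = "Poly_Mapping.lookup a"
    have A: "?A \<subseteq> carrier G" using s by (simp add: FG_def)
    have "(\<Sum>g\<in>?A. scale (?c g) (symb g)) = a" using lext_symb[of a] by (simp only: lext_def)
    with s3[OF _ A, of ?c] have 1: "symb (a, 1) - (\<Sum>g\<in>?A. scale (?c g) (symb (symb g, 1))) \<in> K" by simp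
    have 2: "(\<Sum>g\<in>?A. scale (?c g) (symb (symb g, 1) - scale (coef g) (symb (\<sigma> (\<kappa> g))))) \<in> K"
      using A by (intro K_props(4,6) s2) auto
    have "symb (a, w) - Poly_Mapping.single (a, 1) w + scale w (symb (a, 1) - (\<Sum>g\<in>?A. scale (?c g) (symb (symb g, 1)))
      + (\<Sum>g\<in>?A. scale (?c g) (symb (symb g, 1) - scale (coef g) (symb (\<sigma> (\<kappa> g)))))) \<in> K"
      by (intro K_props(3,4) s1 1 2 s(2))
    also have "symb (a, w) - Poly_Mapping.single (a, 1) w + scale w (symb (a, 1) - (\<Sum>g\<in>?A. scale (?c g) (symb (symb g, 1)))
      + (\<Sum>g\<in>?A. scale (?c g) (symb (symb g, 1) - scale (coef g) (symb (\<sigma> (\<kappa> g))))))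
      = symb (a, w) - scale w (\<Sum>g\<in>?A. scale (?c g) (scale (coef g) (symb (\<sigma> (\<kappa> g)))))"
      by (simp add: scale_add_right scale_diff_right sum_subtractf del: scale_scale)
    also have "(\<Sum>g\<in>?A. scale (?c g) (scale (coef g) (symb (\<sigma> (\<kappa> g))))) = lext (\<lambda>b. symb (\<sigma> b)) (lext t a)"
      unfolding lext_lext by (simp add: lext_def[of _ a] t_def)
    finally show ?thesis by (simp add: s \<theta>_def lext_scale)
  qed
  have "\<exists>T. coordinates (presented S Rel \<pi>) B T \<and>
    (\<forall>g a. (\<forall>s\<in>S. \<pi> g s \<in> S \<and> \<theta> (\<pi> g s) = lext a (\<theta> s)) \<longrightarrow>
      (\<forall>x\<in>carrier (presented S Rel \<pi>).
        act (presented S Rel \<pi>) g x \<in> carrier (presented S Rel \<pi>) \<and>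
        T (act (presented S Rel \<pi>) g x) = lext a (T x)))"
  proof (rule presented_coordinates[OF Rel])
    show "\<theta> s \<in> supported B" if "s \<in> S" for s
      unfolding \<theta>_def split_def using that \<kappa>
      by (intro supported_scale supported_lext) (auto simp: S_def FG_def t_def)
    show "lext \<theta> r = 0" if "r \<in> Rel" for r
    proof -
      \<comment> \<open>Multiplying \<open>a\<close> by \<open>b\<close> scales the coordinates by
        the same factor by which \<open>b\<close> acts on the line, so the balancing relation is
        killed.\<close>
      have "lext t (alg_mult G a b) = scale (\<Sum>h\<in>Poly_Mapping.keys b. Poly_Mapping.lookup b h * \<chi> h) (lext t a)"
        if "a \<in> FG" "b \<in> FH" for a b
      proof -
        have "lext t (alg_mult G a b)
          = lext (\<lambda>x. scale (\<Sum>h\<in>Poly_Mapping.keys b. Poly_Mapping.lookup b h * \<chi> h) (t x)) a"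
          unfolding lext_alg_mult
        proof (rule lext_cong)
          fix x assume "x \<in> Poly_Mapping.keys a"
          then have "lext (\<lambda>y. t (x \<otimes>\<^bsub>G\<^esub> y)) b = lext (\<lambda>y. scale (\<chi> y) (t x)) b"
            by (intro lext_cong t_mult) (use that in \<open>auto simp: FG_def FH_def\<close>)
          also have "\<dots> = scale (\<Sum>h\<in>Poly_Mapping.keys b. Poly_Mapping.lookup b h * \<chi> h) (t x)"
            by (rule poly_mapping_eqI) (simp add: lext_def lookup_sum sum_distrib_right mult.assoc)
          finally show "lext (\<lambda>y. t (x \<otimes>\<^bsub>G\<^esub> y)) b = scale (\<Sum>h\<in>Poly_Mapping.keys b. Poly_Mapping.lookup b h * \<chi> h) (t x)" .
        qed
        also have "\<dots> = scale (\<Sum>h\<in>Poly_Mapping.keys b. Poly_Mapping.lookup b h * \<chi> h) (lext t a)"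
          by (simp add: lext_def scale_sum_right mult.commute)
        finally show ?thesis .
      qed
      then show ?thesis using that unfolding Rel_def R1_def R2_def R3_def R4_def
        by (auto simp: lext_diff \<theta>_def lext_add scale_add_left scale_add_right lext_scale alg_act_line mult.commute)
    qed
    show "\<sigma> b \<in> S" "\<theta> (\<sigma> b) = symb b" if "b \<in> B" for b
      using that by (auto simp: \<sigma>_def S_def FG_single rep \<theta>_def t_def)
    show "symb s - lext (\<lambda>b. symb (\<sigma> b)) (\<theta> s) \<in> LinearCombinations.module.span class_ring (free_space S) Rel" if "s \<in> S" for s
      using gen[OF that] unfolding K_def .
  qed
  then obtain T where T: "coordinates V B T"
    "\<And>g a. (\<forall>s\<in>S. \<pi> g s \<in> S \<and> \<theta> (\<pi> g s) = lext a (\<theta> s)) \<Longrightarrow>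
      \<forall>x\<in>carrier V. act V g x \<in> carrier V \<and> T (act V g x) = lext a (T x)"
    unfolding V by blast
  \<comment> \<open>An element \<open>x\<close> differs from its representative by a factor of
    \<open>H\<close> on the right, which left multiplication by \<open>g\<close> does not disturb;
    hence the matrix of \<open>g\<close> is determined by the representatives.\<close>
  have "\<pi> g s \<in> S \<and> \<theta> (\<pi> g s) = lext (\<lambda>b. t (g \<otimes>\<^bsub>G\<^esub> rep b)) (\<theta> s)" if g: "g \<in> carrier G" and "s \<in> S" for g s
  proof -
    obtain a w where s: "s = (a, w)" "a \<in> FG" using \<open>s \<in> S\<close> by (auto simp: S_def)
    have "lext t (alg_mult G (symb g) a) = lext (\<lambda>x. t (g \<otimes>\<^bsub>G\<^esub> x)) a"
      by (simp add: lext_alg_mult)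
    also have "\<dots> = lext (\<lambda>x. lext (\<lambda>b. t (g \<otimes>\<^bsub>G\<^esub> rep b)) (t x)) a"
    proof (rule lext_cong)
      fix x assume "x \<in> Poly_Mapping.keys a"
      then have x: "x \<in> carrier G" using s(2) by (auto simp: FG_def)
      obtain h where h: "h \<in> H" "x = rep (\<kappa> x) \<otimes>\<^bsub>G\<^esub> h" using decomp[OF x] by blast
      note r = rep(1)[OF \<kappa>[OF x]]
      have c: "coef x = \<chi> h" using h coef_mult[OF r h(1)] rep(3)[OF \<kappa>[OF x]] by simp
      have hG: "h \<in> carrier G" using h(1) H(1) by blast
      have "g \<otimes>\<^bsub>G\<^esub> x = g \<otimes>\<^bsub>G\<^esub> (rep (\<kappa> x) \<otimes>\<^bsub>G\<^esub> h)" by (subst h(2)) simp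
      also have "\<dots> = (g \<otimes>\<^bsub>G\<^esub> rep (\<kappa> x)) \<otimes>\<^bsub>G\<^esub> h" using g hG r by (simp add: G.m_assoc)
      also have "t \<dots> = scale (\<chi> h) (t (g \<otimes>\<^bsub>G\<^esub> rep (\<kappa> x)))"
        by (rule t_mult) (use g r h(1) in auto)
      finally show "t (g \<otimes>\<^bsub>G\<^esub> x) = lext (\<lambda>b. t (g \<otimes>\<^bsub>G\<^esub> rep b)) (t x)"
        by (simp add: t_def[of x] c)
    qed
    finally show ?thesis using s g
      by (auto simp: \<pi>_def \<theta>_def S_def lext_scale lext_lext intro!: FG_mult FG_single)
  qed
  then show ?thesis using T unfolding t_def by blast
qed

section \<open>Tensor products in coordinates\<close>

definition tens :: "'d set \<Rightarrow> ('d \<Rightarrow> 'b \<Rightarrow>\<^sub>0 'f::field) \<Rightarrow> (('d \<Rightarrow> 'b) \<Rightarrow>\<^sub>0 'f)" where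
  "tens D q = Abs_poly_mapping
    (\<lambda>u. if u \<in> extensional D then \<Prod>d\<in>D. Poly_Mapping.lookup (q d) (u d) else 0)"

text \<open>The support lies in a finite product of finite supports, which justifies
  \<open>Abs_poly_mapping\<close>. Labels are confined to \<open>extensional D\<close>, since free
  values outside \<open>D\<close> could make the support infinite.\<close>

lemma lookup_tens:
  assumes "finite D"
  shows "Poly_Mapping.lookup (tens D q) u
    = (if u \<in> extensional D then \<Prod>d\<in>D. Poly_Mapping.lookup (q d) (u d) else 0)"
proof -
  have "{u. (if u \<in> extensional D then \<Prod>d\<in>D. Poly_Mapping.lookup (q d) (u d) else 0) \<noteq> 0}
    \<subseteq> (\<Pi>\<^sub>E d\<in>D. Poly_Mapping.keys (q d))"
    using assms by (auto simp: PiE_iff in_keys_iff extensional_def split: if_splits)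
  then have "finite {u. (if u \<in> extensional D then \<Prod>d\<in>D. Poly_Mapping.lookup (q d) (u d) else 0) \<noteq> 0}"
    by (rule finite_subset) (use assms in \<open>auto intro: finite_PiE\<close>)
  then show ?thesis unfolding tens_def by simp
qed

lemma keys_tens: "finite D \<Longrightarrow> Poly_Mapping.keys (tens D q) = (\<Pi>\<^sub>E d\<in>D. Poly_Mapping.keys (q d))"
  by (auto simp: in_keys_iff lookup_tens PiE_iff extensional_def split: if_splits)

lemma tens_cong: "(\<And>d. d \<in> D \<Longrightarrow> q d = q' d) \<Longrightarrow> tens D q = tens D q'"
proof -
  assume "\<And>d. d \<in> D \<Longrightarrow> q d = q' d"
  then have "(\<Prod>d\<in>D. Poly_Mapping.lookup (q d) (u d)) = (\<Prod>d\<in>D. Poly_Mapping.lookup (q' d) (u d))" for u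
    by (intro prod.cong) auto
  then show ?thesis
    unfolding tens_def by (intro arg_cong[where f = Abs_poly_mapping] ext) (simp only:)
qed

text \<open>With the factor at \<open>d\<close> isolated, linearity in that slot is plain
  distributivity and associativity.\<close>

lemma lookup_tens_upd:
  assumes "finite D" "d \<in> D"
  shows "Poly_Mapping.lookup (tens D (q(d := x))) u = Poly_Mapping.lookup x (u d) *
    (if u \<in> extensional D then \<Prod>e\<in>D - {d}. Poly_Mapping.lookup (q e) (u e) else 0)"
  using assms by (simp add: lookup_tens prod.remove[of D d])

lemma tens_add:
  assumes "finite D" "d \<in> D"
  shows "tens D (q(d := x + y)) = tens D (q(d := x)) + tens D (q(d := y))"
  by (rule poly_mapping_eqI) (simp only: lookup_tens_upd[OF assms] lookup_add distrib_right)

lemma tens_scale: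
  assumes "finite D" "d \<in> D"
  shows "tens D (q(d := scale c x)) = scale c (tens D (q(d := x)))"
  by (rule poly_mapping_eqI) (simp only: lookup_tens_upd[OF assms] lookup_scale mult.assoc)

lemma tens_symb:
  assumes "finite D" "u \<in> extensional D"
  shows "tens D (\<lambda>d. symb (u d)) = symb u"
proof (rule poly_mapping_eqI)
  fix u'
  show "Poly_Mapping.lookup (tens D (\<lambda>d. symb (u d))) u' = Poly_Mapping.lookup (symb u) u'"
  proof (cases "u' = u")
    case True
    then show ?thesis using assms by (simp add: lookup_tens)
  next
    case False
    then have "u' \<in> extensional D \<Longrightarrow> \<exists>d\<in>D. u d \<noteq> u' d"
      using assms by (metis extensionalityI)
    then show ?thesis using assms False by (auto simp: lookup_tens lookup_single when_def prod_zero_iff)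
  qed
qed

text \<open>Distributing the product over the sums (\<open>prod_sum_PiE\<close>) gives a sum over
  label tuples; the product of the conditions that each single label is hit is the condition that
  the whole tuple is hit.\<close>

lemma tens_lext_monomial:
  assumes "finite D"
  shows "tens D (\<lambda>d. lext (\<lambda>b. Poly_Mapping.single (p d b) (c d b)) (q d))
    = lext (\<lambda>u. Poly_Mapping.single (\<lambda>d\<in>D. p d (u d)) (\<Prod>d\<in>D. c d (u d))) (tens D q)" (is "?l = ?r")
proof (rule poly_mapping_eqI)
  fix v
  have r: "Poly_Mapping.lookup ?r v = (\<Sum>u\<in>(\<Pi>\<^sub>E d\<in>D. Poly_Mapping.keys (q d)).
      (\<Prod>d\<in>D. Poly_Mapping.lookup (q d) (u d)) * ((\<Prod>d\<in>D. c d (u d)) when (\<lambda>d\<in>D. p d (u d)) = v))"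
    unfolding lookup_lext keys_tens[OF assms]
    by (rule sum.cong) (auto simp: lookup_tens assms lookup_single PiE_iff)
  show "Poly_Mapping.lookup ?l v = Poly_Mapping.lookup ?r v"
  proof (cases "v \<in> extensional D")
    case False
    then have "(\<lambda>d\<in>D. p d (u d)) \<noteq> v" for u by auto
    then show ?thesis using False unfolding r by (simp add: lookup_tens assms)
  next
    case True
    have eq: "(\<lambda>d\<in>D. p d (u d)) = v \<longleftrightarrow> (\<forall>d\<in>D. p d (u d) = v d)" for u
      using True by (auto simp: fun_eq_iff extensional_def)
    have "Poly_Mapping.lookup ?l v = (\<Prod>d\<in>D. \<Sum>b\<in>Poly_Mapping.keys (q d).
        Poly_Mapping.lookup (q d) b * (c d b when p d b = v d))"
      using True by (simp add: lookup_tens assms lookup_lext lookup_single)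
    also have "\<dots> = (\<Sum>u\<in>(\<Pi>\<^sub>E d\<in>D. Poly_Mapping.keys (q d)).
        \<Prod>d\<in>D. Poly_Mapping.lookup (q d) (u d) * (c d (u d) when p d (u d) = v d))"
      using assms by (subst prod_sum_PiE) auto
    also have "\<dots> = Poly_Mapping.lookup ?r v"
      unfolding r
    proof (rule sum.cong[OF refl])
      fix u
      have "(\<Prod>d\<in>D. c d (u d) when p d (u d) = v d) = ((\<Prod>d\<in>D. c d (u d)) when (\<lambda>d\<in>D. p d (u d)) = v)"
      proof (cases "\<forall>d\<in>D. p d (u d) = v d")
        case True
        then show ?thesis unfolding eq by simp
      next
        case False
        then show ?thesis unfolding eq using assms by (auto simp: prod_zero_iff when_def)
      qed
      then show "(\<Prod>d\<in>D. Poly_Mapping.lookup (q d) (u d) * (c d (u d) when p d (u d) = v d)) =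
        (\<Prod>d\<in>D. Poly_Mapping.lookup (q d) (u d)) * ((\<Prod>d\<in>D. c d (u d)) when (\<lambda>d\<in>D. p d (u d)) = v)"
        by (simp add: prod.distrib)
    qed
    finally show ?thesis .
  qed
qed

text \<open>The map \<open>\<theta>\<close> sends a symbol to its pure tensor in coordinates. For
  spanning, components are replaced by basis vectors one position at a time, using
  multilinearity.\<close>

lemma tensor_coordinates:
  fixes V :: "'d \<Rightarrow> ('f::field, 'g, 'v) gmodule" and T :: "'d \<Rightarrow> 'v \<Rightarrow> 'b \<Rightarrow>\<^sub>0 'f"
  assumes fin: "finite D"
    and coords: "\<And>d. d \<in> D \<Longrightarrow> coordinates (V d) (B d) (T d)"
    and act: "\<And>d g x. d \<in> D \<Longrightarrow> g \<in> X \<Longrightarrow> x \<in> carrier (V d) \<Longrightarrow> act (V d) g x \<in> carrier (V d) \<and>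
      T d (act (V d) g x) = lext (\<lambda>b. Poly_Mapping.single (p d g b) (c d g b)) (T d x)"
  shows "\<exists>T'. coordinates (tensor D V) (Pi\<^sub>E D B) T' \<and>
    (\<forall>g\<in>X. \<forall>x\<in>carrier (tensor D V). act (tensor D V) g x \<in> carrier (tensor D V) \<and>
      T' (act (tensor D V) g x)
      = lext (\<lambda>u. Poly_Mapping.single (\<lambda>d\<in>D. p d g (u d)) (\<Prod>d\<in>D. c d g (u d))) (T' x))"
proof -
  define S where "S = (\<Pi>\<^sub>E d\<in>D. carrier (V d))"
  define R1 :: "(('d \<Rightarrow> 'v) \<Rightarrow>\<^sub>0 'f) set" where "R1 =
    {symb (v(d := x \<oplus>\<^bsub>V d\<^esub> y)) - symb (v(d := x)) - symb (v(d := y)) | v d x y.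
      v \<in> S \<and> d \<in> D \<and> x \<in> carrier (V d) \<and> y \<in> carrier (V d)}"
  define R2 :: "(('d \<Rightarrow> 'v) \<Rightarrow>\<^sub>0 'f) set" where "R2 =
    {symb (v(d := c \<odot>\<^bsub>V d\<^esub> x)) - Poly_Mapping.single (v(d := x)) c | v d c x.
      v \<in> S \<and> d \<in> D \<and> x \<in> carrier (V d)}"
  define Rel where "Rel = R1 \<union> R2"
  define \<pi> where "\<pi> g v = (\<lambda>d\<in>D. act (V d) g (v d))" for g v
  have V: "tensor D V = presented S Rel \<pi>"
    unfolding tensor_def Let_def Rel_def S_def R1_def R2_def \<pi>_def ..
  have upd: "v(d := x) \<in> S" if "v \<in> S" "d \<in> D" "x \<in> carrier (V d)" for v d x
    using that by (auto simp: S_def PiE_iff extensional_def)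
  have add_closed: "x \<oplus>\<^bsub>V d\<^esub> y \<in> carrier (V d)" and smult_closed: "a \<odot>\<^bsub>V d\<^esub> x \<in> carrier (V d)"
    if "d \<in> D" "x \<in> carrier (V d)" "y \<in> carrier (V d)" for d x y a
    using coordinates.add_closed[OF coords[OF that(1)]] coordinates.smult_closed[OF coords[OF that(1)]] that by auto
  have Rel: "Rel \<subseteq> supported S"
    unfolding Rel_def R1_def R2_def
    by (intro Un_least subsetI; elim CollectE exE conjE; hypsubst; intro supported_diff)
      (auto simp: upd add_closed smult_closed)
  define K where "K = LinearCombinations.module.span class_ring (free_space S) Rel"
  note K_props = presented_span[OF Rel, folded K_def]
  have K1: "symb (v(d := x \<oplus>\<^bsub>V d\<^esub> y)) - symb (v(d := x)) - symb (v(d := y)) \<in> K"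
    if "v \<in> S" "d \<in> D" "x \<in> carrier (V d)" "y \<in> carrier (V d)" for v d x y
    using K_props(7) that unfolding Rel_def R1_def by blast
  have K2: "symb (v(d := a \<odot>\<^bsub>V d\<^esub> x)) - Poly_Mapping.single (v(d := x)) a \<in> K"
    if "v \<in> S" "d \<in> D" "x \<in> carrier (V d)" for v d x a
    using K_props(7) that unfolding Rel_def R2_def by blast
  define \<theta> where "\<theta> v = tens D (\<lambda>d. T d (v d))" for v
  define \<sigma> where "\<sigma> u = (\<lambda>d\<in>D. coordinates.vec (V d) (T d) (symb (u d)))" for u
  have \<theta>_upd: "\<theta> (v(d := x)) = tens D ((\<lambda>d. T d (v d))(d := T d x))" for v d x
    unfolding \<theta>_def by (rule tens_cong) auto
  have \<theta>_add: "\<theta> (v(d := x \<oplus>\<^bsub>V d\<^esub> y)) = \<theta> (v(d := x)) + \<theta> (v(d := y))"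
    if "d \<in> D" "x \<in> carrier (V d)" "y \<in> carrier (V d)" for v d x y
    using that by (simp only: \<theta>_upd coordinates.T_add[OF coords] tens_add[OF fin])
  have \<theta>_smult: "\<theta> (v(d := a \<odot>\<^bsub>V d\<^esub> x)) = scale a (\<theta> (v(d := x)))"
    if "d \<in> D" "x \<in> carrier (V d)" for v d x a
    using that by (simp only: \<theta>_upd coordinates.T_smult[OF coords] tens_scale[OF fin])
  have \<sigma>: "\<sigma> u \<in> S" "\<theta> (\<sigma> u) = symb u" if "u \<in> Pi\<^sub>E D B" for u
  proof -
    show "\<sigma> u \<in> S" using that coordinates.vec_closed[OF coords] by (auto simp: \<sigma>_def S_def PiE_iff)
    have "\<theta> (\<sigma> u) = tens D (\<lambda>d. symb (u d))"
      unfolding \<theta>_def \<sigma>_def using that coordinates.T_vec[OF coords]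
      by (intro tens_cong) (auto simp: PiE_iff)
    then show "\<theta> (\<sigma> u) = symb u" using tens_symb[OF fin] that by (auto simp: PiE_iff)
  qed
  \<comment> \<open>Combinations congruent to their normal form modulo \<open>K\<close>. They form a
    subspace, which contains \<open>K\<close> because \<open>\<theta>\<close> kills
    \<open>K\<close>; the goal is that it contains every symbol.\<close>
  define E where "E = {q. q - lext (\<lambda>u. symb (\<sigma> u)) (lext \<theta> q) \<in> K}"
  have E_add: "q + q' \<in> E" if "q \<in> E" "q' \<in> E" for q q'
    using K_props(3)[of "q - lext (\<lambda>u. symb (\<sigma> u)) (lext \<theta> q)" "q' - lext (\<lambda>u. symb (\<sigma> u)) (lext \<theta> q')"] that
    by (simp add: E_def lext_add algebra_simps)
  have E_scale: "scale a q \<in> E" if "q \<in> E" for a q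
    using K_props(4)[of "q - lext (\<lambda>u. symb (\<sigma> u)) (lext \<theta> q)" a] that
    by (simp add: E_def lext_scale scale_diff_right)
  have \<theta>_Rel: "lext \<theta> r = 0" if "r \<in> Rel" for r
    using that unfolding Rel_def R1_def R2_def
    by (auto simp: lext_diff \<theta>_add \<theta>_smult)
  have K_E: "q \<in> E" if "q \<in> K" for q
    using K_props(8)[OF \<theta>_Rel that] that by (simp add: E_def)
  have E_upd_add: "symb (v(d := x \<oplus>\<^bsub>V d\<^esub> y)) \<in> E"
    if "v \<in> S" "d \<in> D" "x \<in> carrier (V d)" "y \<in> carrier (V d)" "symb (v(d := x)) \<in> E" "symb (v(d := y)) \<in> E" for v d x y
    using E_add[OF E_add[OF K_E[OF K1[OF that(1-4)]] that(5)] that(6)] by (simp add: algebra_simps)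
  have E_upd_smult: "symb (v(d := a \<odot>\<^bsub>V d\<^esub> x)) \<in> E"
    if "v \<in> S" "d \<in> D" "x \<in> carrier (V d)" "symb (v(d := x)) \<in> E" for v d x a
    using E_add[OF K_E[OF K2[OF that(1-3), of a]] E_scale[OF that(4), of a]] by (simp add: algebra_simps)
  have E_vec: "symb (v(d := coordinates.vec (V d) (T d) q)) \<in> E"
    if v: "v \<in> S" and d: "d \<in> D" and q: "q \<in> supported (B d)"
      and IH: "\<And>b. b \<in> B d \<Longrightarrow> symb (v(d := coordinates.vec (V d) (T d) (symb b))) \<in> E" for v d q
  proof -
    interpret C: coordinates "V d" "B d" "T d" by (rule coords[OF d])
    have "symb (v(d := C.vec (\<Sum>b\<in>A. scale (Poly_Mapping.lookup q b) (symb b)))) \<in> E" if "finite A" "A \<subseteq> B d" for A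
      using that
    proof (induct A)
      case empty
      \<comment> \<open>Writing the zero vector as a multiple by 0 makes the scalar relation
        applicable.\<close>
      have "C.vec 0 = 0 \<odot>\<^bsub>V d\<^esub> C.vec 0" using C.vec_scale[of 0 0] by simp
      moreover have "symb (v(d := 0 \<odot>\<^bsub>V d\<^esub> C.vec 0)) \<in> E"
        using K_E[OF K2[OF v d C.vec_closed[of 0], of 0]] by simp
      ultimately show ?case by (simp only: sum.empty)
    next
      case (insert b A)
      let ?q = "\<Sum>b\<in>A. scale (Poly_Mapping.lookup q b) (symb b)"
      have 1: "symb b \<in> supported (B d)" using insert by simp
      have 2: "?q \<in> supported (B d)" by (intro supported_sum supported_scale) (use insert in auto)
      have "(\<Sum>b\<in>insert b A. scale (Poly_Mapping.lookup q b) (symb b)) = scale (Poly_Mapping.lookup q b) (symb b) + ?q"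
        using insert by simp
      then have eq: "C.vec (\<Sum>b\<in>insert b A. scale (Poly_Mapping.lookup q b) (symb b))
        = Poly_Mapping.lookup q b \<odot>\<^bsub>V d\<^esub> C.vec (symb b) \<oplus>\<^bsub>V d\<^esub> C.vec ?q"
        by (simp only: C.vec_add[OF supported_scale[OF 1] 2] C.vec_scale[OF 1])
      have "symb (v(d := C.vec (symb b))) \<in> E" "symb (v(d := C.vec ?q)) \<in> E"
        using insert(4) by (blast intro: IH insert(3))+
      then show ?case
        unfolding eq
        by (intro E_upd_add E_upd_smult v d C.smult_closed C.vec_closed 1 2)
    qed
    from this[of "Poly_Mapping.keys q"] q have "symb (v(d := C.vec (lext symb q))) \<in> E"
      by (simp add: lext_def del: lext_symb)
    then show ?thesis by simp
  qed
  have E: "symb v \<in> E" if "v \<in> S" for v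
  proof -
    \<comment> \<open>Induction on a set of positions outside of which all components are already
      basis vectors.\<close>
    have "symb v \<in> E" if "finite A" "A \<subseteq> D" "v \<in> S"
      "\<And>d. d \<in> D - A \<Longrightarrow> \<exists>b\<in>B d. v d = coordinates.vec (V d) (T d) (symb b)" for A v
      using that
    proof (induct A arbitrary: v)
      case empty
      then obtain u where u: "\<And>d. d \<in> D \<Longrightarrow> u d \<in> B d \<and> v d = coordinates.vec (V d) (T d) (symb (u d))"
        by (metis Diff_empty)
      have "restrict u D \<in> Pi\<^sub>E D B" using u by auto
      moreover have "v = \<sigma> (restrict u D)"
        using u empty(2) by (auto simp: \<sigma>_def S_def PiE_iff fun_eq_iff extensional_def)
      ultimately have "lext \<theta> (symb v) = symb (restrict u D)" "\<sigma> (restrict u D) = v" using \<sigma> by auto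
      then show ?case using K_props(2) by (simp add: E_def)
    next
      case (insert d A)
      then have d: "d \<in> D" by simp
      interpret C: coordinates "V d" "B d" "T d" by (rule coords[OF d])
      have vd: "v d \<in> carrier (V d)" using insert(5) d by (auto simp: S_def)
      have "symb (v(d := C.vec (T d (v d)))) \<in> E"
      proof (rule E_vec[OF insert(5) d C.T_closed[OF vd]])
        fix b assume b: "b \<in> B d"
        show "symb (v(d := C.vec (symb b))) \<in> E"
        proof (rule insert(3))
          show "v(d := C.vec (symb b)) \<in> S" using insert(5) d b by (intro upd C.vec_closed) auto
        qed (use insert b in auto)
      qed
      then show ?case by (simp add: C.vec_T[OF vd])
    qed
    from this[OF fin _ that] show ?thesis by auto
  qed
  have "\<exists>T'. coordinates (presented S Rel \<pi>) (Pi\<^sub>E D B) T' \<and>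
    (\<forall>g a. (\<forall>s\<in>S. \<pi> g s \<in> S \<and> \<theta> (\<pi> g s) = lext a (\<theta> s)) \<longrightarrow>
      (\<forall>x\<in>carrier (presented S Rel \<pi>).
        act (presented S Rel \<pi>) g x \<in> carrier (presented S Rel \<pi>) \<and>
        T' (act (presented S Rel \<pi>) g x) = lext a (T' x)))"
  proof (rule presented_coordinates[OF Rel])
    show "\<theta> v \<in> supported (Pi\<^sub>E D B)" if "v \<in> S" for v
      using that coordinates.T_closed[OF coords]
      by (auto simp: \<theta>_def keys_tens fin S_def PiE_iff)
    show "symb v - lext (\<lambda>u. symb (\<sigma> u)) (\<theta> v) \<in> LinearCombinations.module.span class_ring (free_space S) Rel"
      if "v \<in> S" for v
      using E[OF that] by (simp add: E_def K_def)
  qed (use \<theta>_Rel \<sigma> in auto)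
  then obtain T' where T': "coordinates (tensor D V) (Pi\<^sub>E D B) T'"
    "\<And>g a. (\<forall>s\<in>S. \<pi> g s \<in> S \<and> \<theta> (\<pi> g s) = lext a (\<theta> s)) \<Longrightarrow>
      \<forall>x\<in>carrier (tensor D V). act (tensor D V) g x \<in> carrier (tensor D V) \<and> T' (act (tensor D V) g x) = lext a (T' x)"
    unfolding V by blast
  have "\<pi> g v \<in> S \<and> \<theta> (\<pi> g v)
      = lext (\<lambda>u. Poly_Mapping.single (\<lambda>d\<in>D. p d g (u d)) (\<Prod>d\<in>D. c d g (u d))) (\<theta> v)"
    if "g \<in> X" "v \<in> S" for g v
  proof
    have v: "v d \<in> carrier (V d)" if "d \<in> D" for d using \<open>v \<in> S\<close> that by (auto simp: S_def)
    show "\<pi> g v \<in> S" using act[OF _ \<open>g \<in> X\<close> v] by (auto simp: \<pi>_def S_def)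
    have "\<theta> (\<pi> g v) = tens D (\<lambda>d. lext (\<lambda>b. Poly_Mapping.single (p d g b) (c d g b)) (T d (v d)))"
      unfolding \<theta>_def by (rule tens_cong) (use act[OF _ \<open>g \<in> X\<close> v] in \<open>simp add: \<pi>_def\<close>)
    then show "\<theta> (\<pi> g v) = lext (\<lambda>u. Poly_Mapping.single (\<lambda>d\<in>D. p d g (u d)) (\<Prod>d\<in>D. c d g (u d))) (\<theta> v)"
      by (simp only: tens_lext_monomial[OF fin] \<theta>_def)
  qed
  then show ?thesis using T' by blast
qed

section \<open>Endomorphisms of monomial modules\<close>

text \<open>Brings an arbitrary endomorphism into the form \<open>lext\<close>, in which it can be
  compared with the monomial matrices of the group elements.\<close>

lemma (in coordinates) T_linear_image:
  assumes \<phi>: "\<And>x. x \<in> carrier V \<Longrightarrow> \<phi> x \<in> carrier V"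
    "\<And>x y. x \<in> carrier V \<Longrightarrow> y \<in> carrier V \<Longrightarrow> \<phi> (x \<oplus>\<^bsub>V\<^esub> y) = \<phi> x \<oplus>\<^bsub>V\<^esub> \<phi> y"
    "\<And>a x. x \<in> carrier V \<Longrightarrow> \<phi> (a \<odot>\<^bsub>V\<^esub> x) = a \<odot>\<^bsub>V\<^esub> \<phi> x"
    and x: "x \<in> carrier V"
  shows "T (\<phi> x) = lext (\<lambda>b. T (\<phi> (vec (symb b)))) (T x)"
proof -
  have "T (\<phi> (vec (\<Sum>b\<in>A. scale (k b) (symb b)))) = (\<Sum>b\<in>A. scale (k b) (T (\<phi> (vec (symb b)))))"
    if "finite A" "A \<subseteq> B" for A k
    using that
  proof (induct A)
    case empty
    have "vec 0 = 0 \<odot>\<^bsub>V\<^esub> vec 0" using vec_scale[of 0 0] by simp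
    then have "T (\<phi> (vec 0)) = T (\<phi> (0 \<odot>\<^bsub>V\<^esub> vec 0))" by (rule arg_cong)
    also have "\<dots> = 0" using vec_closed[of 0] by (simp add: \<phi> T_smult)
    finally show ?case by simp
  next
    case (insert b A)
    let ?q = "\<Sum>b\<in>A. scale (k b) (symb b)"
    have 1: "symb b \<in> supported B" using insert by simp
    have 2: "?q \<in> supported B" by (intro supported_sum supported_scale) (use insert in auto)
    have "(\<Sum>b\<in>insert b A. scale (k b) (symb b)) = scale (k b) (symb b) + ?q" using insert by simp
    then have "vec (\<Sum>b\<in>insert b A. scale (k b) (symb b)) = k b \<odot>\<^bsub>V\<^esub> vec (symb b) \<oplus>\<^bsub>V\<^esub> vec ?q"
      by (simp only: vec_add[OF supported_scale[OF 1] 2] vec_scale[OF 1])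
    moreover have "T (\<phi> (k b \<odot>\<^bsub>V\<^esub> vec (symb b) \<oplus>\<^bsub>V\<^esub> vec ?q)) = scale (k b) (T (\<phi> (vec (symb b)))) + T (\<phi> (vec ?q))"
      using vec_closed[OF 1] vec_closed[OF 2] by (simp only: \<phi> T_add T_smult smult_closed)
    ultimately show ?case using insert by simp
  qed
  from this[of "Poly_Mapping.keys (T x)" "Poly_Mapping.lookup (T x)"] T_closed[OF x]
  have "T (\<phi> (vec (lext symb (T x)))) = lext (\<lambda>b. T (\<phi> (vec (symb b)))) (T x)"
    by (simp add: lext_def del: lext_symb scale_single)
  then show ?thesis by (simp add: vec_T[OF x])
qed

text \<open>By Frobenius reciprocity an endomorphism is determined by the image of the basis vector
  \<open>b0\<close>, which may be any vector on which the stabiliser of \<open>b0\<close> acts as it acts on \<open>b0\<close>.\<close>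

lemma hom_space_monomial_coordinates:
  fixes V :: "('f::field, 'g, 'v) gmodule" and T :: "'v \<Rightarrow> 'b \<Rightarrow>\<^sub>0 'f"
    and p :: "'g \<Rightarrow> 'b \<Rightarrow> 'b" and c :: "'g \<Rightarrow> 'b \<Rightarrow> 'f"
  assumes "group G" and coords: "coordinates V B T"
    and act: "\<And>g x. g \<in> carrier G \<Longrightarrow> x \<in> carrier V \<Longrightarrow> act V g x \<in> carrier V \<and>
      T (act V g x) = lext (\<lambda>b. Poly_Mapping.single (p g b) (c g b)) (T x)"
    and p_closed: "\<And>g b. g \<in> carrier G \<Longrightarrow> b \<in> B \<Longrightarrow> p g b \<in> B"
    and c_nonzero: "\<And>g b. c g b \<noteq> 0"
    and p_one: "\<And>b. b \<in> B \<Longrightarrow> p \<one>\<^bsub>G\<^esub> b = b"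
    and p_mult: "\<And>g h b. g \<in> carrier G \<Longrightarrow> h \<in> carrier G \<Longrightarrow> b \<in> B \<Longrightarrow>
      p (g \<otimes>\<^bsub>G\<^esub> h) b = p g (p h b)"
    and c_mult: "\<And>g h b. g \<in> carrier G \<Longrightarrow> h \<in> carrier G \<Longrightarrow> b \<in> B \<Longrightarrow>
      c (g \<otimes>\<^bsub>G\<^esub> h) b = c g (p h b) * c h b"
    and b0: "b0 \<in> B"
    and transitive: "\<And>b. b \<in> B \<Longrightarrow> \<exists>g\<in>carrier G. p g b0 = b"
    and B1: "B1 \<subseteq> B"
    and fixed: "\<And>h b. h \<in> carrier G \<Longrightarrow> p h b0 = b0 \<Longrightarrow> b \<in> B1 \<Longrightarrow> p h b = b \<and> c h b = c h b0"
    and separated: "\<And>b. b \<in> B - B1 \<Longrightarrow>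
      \<exists>h\<in>carrier G. p h b0 = b0 \<and> p h b = b \<and> c h b \<noteq> c h b0"
  shows "\<exists>T'. coordinates (hom_space G V V) B1 T'"
proof -
  interpret G: group G by fact
  interpret coordinates V B T by fact
  define A where "A g = lext (\<lambda>b. Poly_Mapping.single (p g b) (c g b))" for g
  have actV: "act V g x \<in> carrier V" "T (act V g x) = A g (T x)"
    if "g \<in> carrier G" "x \<in> carrier V" for g x
    using act[OF that] by (auto simp: A_def)
  have A_mult: "A (g \<otimes>\<^bsub>G\<^esub> h) q = A g (A h q)"
    if "g \<in> carrier G" "h \<in> carrier G" "q \<in> supported B" for g h q
    unfolding A_def lext_lext
    by (rule lext_cong) (use that in \<open>auto simp: p_mult c_mult subset_iff mult.commute\<close>)
  have A_scale: "A g (scale k q) = scale k (A g q)" and A_add: "A g (q + q') = A g q + A g q'" for g k q q'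
    by (simp_all add: A_def lext_scale lext_add)
  have A_closed: "A g q \<in> supported B" if "g \<in> carrier G" "q \<in> supported B" for g q
    unfolding A_def by (rule supported_lext) (use that p_closed in auto)
  have eigen: "A h q = scale (c h b0) q" if "h \<in> carrier G" "p h b0 = b0" "q \<in> supported B1" for h q
  proof -
    have "A h q = lext (\<lambda>b. scale (c h b0) (symb b)) q"
      unfolding A_def by (rule lext_cong) (use that fixed[OF that(1,2)] in auto)
    also have "\<dots> = scale (c h b0) (lext symb q)"
      unfolding lext_def scale_sum_right by (intro sum.cong refl) (simp add: mult.commute)
    finally show ?thesis by simp
  qed
  have eigen_conv: "q \<in> supported B1"
    if q: "q \<in> supported B" and e: "\<And>h. h \<in> carrier G \<Longrightarrow> p h b0 = b0 \<Longrightarrow> A h q = scale (c h b0) q" for q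
  proof (intro CollectI subsetI, rule ccontr)
    fix b assume b: "b \<in> Poly_Mapping.keys q" "b \<notin> B1"
    then obtain h where h: "h \<in> carrier G" "p h b0 = b0" "p h b = b" "c h b \<noteq> c h b0"
      using separated[of b] q by blast
    \<comment> \<open>\<open>h\<close> permutes the labels, so the coefficient of
      \<open>A h q\<close> at \<open>b\<close> comes from \<open>b\<close> alone. It acquires the
      factor \<open>c h b\<close>, whereas the eigenvalue is \<open>c h b0\<close>.\<close>
    have inj: "a = b" if "a \<in> Poly_Mapping.keys q" "p h a = b" for a
    proof -
      have ab: "a \<in> B" "b \<in> B" using that b q by auto
      have "a = p (inv\<^bsub>G\<^esub> h) (p h a)" "b = p (inv\<^bsub>G\<^esub> h) (p h b)"
        using p_mult[of "inv\<^bsub>G\<^esub> h" h] h(1) ab p_one by (auto simp: G.l_inv)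
      then show ?thesis using that h(3) by simp
    qed
    have "Poly_Mapping.lookup (A h q) b = (\<Sum>a\<in>Poly_Mapping.keys q. if a = b then Poly_Mapping.lookup q b * c h b else 0)"
      unfolding A_def lookup_lext by (rule sum.cong) (use inj h(3) in \<open>auto simp: lookup_single when_def\<close>)
    also have "\<dots> = Poly_Mapping.lookup q b * c h b" using b by simp
    finally show False using e[OF h(1,2)] h(4) b by (simp add: in_keys_iff)
  qed
  obtain gen where gen: "\<And>b. b \<in> B \<Longrightarrow> gen b \<in> carrier G" "\<And>b. b \<in> B \<Longrightarrow> p (gen b) b0 = b"
    using transitive by metis
  \<comment> \<open>The matrix of the endomorphism that sends the basis vector of \<open>b0\<close>
    to \<open>q\<close>: applying \<open>gen b\<close> to the former gives the basis vector of
    \<open>b\<close> times \<open>c (gen b) b0\<close>, and this scalar has to be divided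
    out.\<close>
  define \<Psi> where "\<Psi> q = lext (\<lambda>b. scale (inverse (c (gen b) b0)) (A (gen b) q))" for q
  define e0 where "e0 = vec (symb b0)"
  have e0: "e0 \<in> carrier V" "T e0 = symb b0"
    using b0 vec_closed T_vec by (auto simp: e0_def)
  define T' where "T' \<phi> = T (\<phi> e0)" for \<phi>
  let ?H = "hom_space G V V"
  have H: "\<phi> \<in> carrier ?H \<longleftrightarrow> \<phi> \<in> extensional (carrier V) \<and> (\<forall>x\<in>carrier V. \<phi> x \<in> carrier V) \<and>
    (\<forall>x\<in>carrier V. \<forall>y\<in>carrier V. \<phi> (x \<oplus>\<^bsub>V\<^esub> y) = \<phi> x \<oplus>\<^bsub>V\<^esub> \<phi> y) \<and>
    (\<forall>a. \<forall>x\<in>carrier V. \<phi> (a \<odot>\<^bsub>V\<^esub> x) = a \<odot>\<^bsub>V\<^esub> \<phi> x) \<and>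
    (\<forall>g\<in>carrier G. \<forall>x\<in>carrier V. \<phi> (act V g x) = act V g (\<phi> x))" for \<phi>
    by (auto simp: hom_space_def LinearCombinations.module_hom_def)
  have stab: "act V h e0 = c h b0 \<odot>\<^bsub>V\<^esub> e0" if "h \<in> carrier G" "p h b0 = b0" for h
    by (subst T_eq_iff[symmetric]) (use that e0 in \<open>simp_all add: actV smult_closed T_smult A_def\<close>)
  have T'_closed: "T' \<phi> \<in> supported B1" if \<phi>: "\<phi> \<in> carrier ?H" for \<phi>
  proof (rule eigen_conv)
    show "T' \<phi> \<in> supported B" using \<phi> e0 unfolding T'_def H by (intro T_closed) auto
    fix h assume h: "h \<in> carrier G" "p h b0 = b0"
    have "A h (T' \<phi>) = T (act V h (\<phi> e0))" using \<phi> e0 h unfolding H T'_def by (subst actV) auto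
    also have "act V h (\<phi> e0) = c h b0 \<odot>\<^bsub>V\<^esub> \<phi> e0"
      using \<phi> e0 stab[OF h] h(1) unfolding H by metis
    also have "T \<dots> = scale (c h b0) (T' \<phi>)" using \<phi> e0 unfolding H T'_def by (subst T_smult) auto
    finally show "A h (T' \<phi>) = scale (c h b0) (T' \<phi>)" .
  qed
  have T_\<phi>: "T (\<phi> x) = \<Psi> (T' \<phi>) (T x)" if \<phi>: "\<phi> \<in> carrier ?H" and x: "x \<in> carrier V" for \<phi> x
  proof -
    have "T (\<phi> x) = lext (\<lambda>b. T (\<phi> (vec (symb b)))) (T x)"
      by (rule T_linear_image) (use \<phi> x in \<open>auto simp: H\<close>)
    also have "\<dots> = \<Psi> (T' \<phi>) (T x)"
      unfolding \<Psi>_def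
    proof (rule lext_cong)
      fix b assume "b \<in> Poly_Mapping.keys (T x)"
      then have b: "b \<in> B" using T_closed[OF x] by auto
      have e: "vec (symb b) \<in> carrier V" "T (vec (symb b)) = symb b" using b vec_closed T_vec by auto
      have "act V (gen b) e0 = c (gen b) b0 \<odot>\<^bsub>V\<^esub> vec (symb b)"
        by (subst T_eq_iff[symmetric])
          (use b e e0 gen in \<open>simp_all add: actV smult_closed T_smult A_def\<close>)
      then have "act V (gen b) (\<phi> e0) = c (gen b) b0 \<odot>\<^bsub>V\<^esub> \<phi> (vec (symb b))"
        using \<phi> e e0 gen(1)[OF b] unfolding H by metis
      moreover have "\<phi> e0 \<in> carrier V" "\<phi> (vec (symb b)) \<in> carrier V" using \<phi> e e0 unfolding H by auto
      ultimately have "A (gen b) (T' \<phi>) = scale (c (gen b) b0) (T (\<phi> (vec (symb b))))"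
        unfolding T'_def using gen(1)[OF b] by (metis actV(2) T_smult)
      then show "T (\<phi> (vec (symb b))) = scale (inverse (c (gen b) b0)) (A (gen b) (T' \<phi>))"
        by (simp add: c_nonzero)
    qed
    finally show ?thesis .
  qed
  have \<Psi>_closed: "\<Psi> q z \<in> supported B" if "q \<in> supported B" "z \<in> supported B" for q z
    unfolding \<Psi>_def by (intro supported_lext supported_scale A_closed) (use that gen in auto)
  have \<Psi>_A: "\<Psi> q (A g z) = A g (\<Psi> q z)"
    if g: "g \<in> carrier G" and q: "q \<in> supported B1" and z: "z \<in> supported B" for g q z
  proof -
    have qB: "q \<in> supported B" using q B1 by auto
    have "\<Psi> q (A g z) = lext (\<lambda>b. \<Psi> q (Poly_Mapping.single (p g b) (c g b))) z"
      unfolding A_def by (simp add: \<Psi>_def lext_lext)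
    also have "\<dots> = lext (\<lambda>b. A g (\<Psi> q (symb b))) z"
    proof (rule lext_cong)
      fix b assume "b \<in> Poly_Mapping.keys z"
      then have b: "b \<in> B" using z by auto
      define b' where "b' = p g b"
      have b': "b' \<in> B" using b g p_closed by (simp add: b'_def)
      \<comment> \<open>The product of \<open>g\<close> and \<open>gen b\<close> carries
        \<open>b0\<close> to \<open>b'\<close>, as does \<open>gen b'\<close>. Their quotient
        \<open>h\<close> stabilises \<open>b0\<close> and therefore acts on \<open>q\<close> by the
        scalar \<open>c h b0\<close>.\<close>
      define h where "h = inv\<^bsub>G\<^esub> gen b' \<otimes>\<^bsub>G\<^esub> (g \<otimes>\<^bsub>G\<^esub> gen b)"
      note gs = gen(1)[OF b] gen(1)[OF b'] g
      have hG: "h \<in> carrier G" using gs by (simp add: h_def)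
      have gb: "g \<otimes>\<^bsub>G\<^esub> gen b = gen b' \<otimes>\<^bsub>G\<^esub> h"
        using gs by (simp add: h_def G.m_assoc[symmetric])
      have "p h b0 = p (inv\<^bsub>G\<^esub> gen b') (p (g \<otimes>\<^bsub>G\<^esub> gen b) b0)"
        unfolding h_def using gs b0 by (intro p_mult) auto
      also have "p (g \<otimes>\<^bsub>G\<^esub> gen b) b0 = b'" using gs b0 b gen(2) by (simp add: p_mult b'_def)
      also have "p (inv\<^bsub>G\<^esub> gen b') b' = p (inv\<^bsub>G\<^esub> gen b') (p (gen b') b0)"
        using b' gen(2) by simp
      also have "\<dots> = p (inv\<^bsub>G\<^esub> gen b' \<otimes>\<^bsub>G\<^esub> gen b') b0"
        using gs b0 by (intro p_mult[symmetric]) auto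
      also have "\<dots> = b0" using gs b0 by (simp add: p_one)
      finally have h0: "p h b0 = b0" .
      \<comment> \<open>The cocycle identity on the two factorisations of one element relates the
        scalars.\<close>
      have "c g b * c (gen b) b0 = c (g \<otimes>\<^bsub>G\<^esub> gen b) b0" using gs b0 b gen(2) by (simp add: c_mult)
      also have "\<dots> = c (gen b') b0 * c h b0" unfolding gb using gs hG b0 h0 by (simp add: c_mult)
      finally have cc: "c g b * c (gen b) b0 = c (gen b') b0 * c h b0" .
      have "A g (A (gen b) q) = A (g \<otimes>\<^bsub>G\<^esub> gen b) q" using gs qB by (simp add: A_mult)
      also have "\<dots> = A (gen b') (A h q)" unfolding gb using gs hG qB by (intro A_mult)
      also have "\<dots> = scale (c h b0) (A (gen b') q)" using eigen[OF hG h0 q] by (simp add: A_scale)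
      finally have "A g (A (gen b) q) = scale (c h b0) (A (gen b') q)" .
      then have "A g (\<Psi> q (symb b)) = scale (inverse (c (gen b) b0) * c h b0) (A (gen b') q)"
        by (simp add: \<Psi>_def A_scale)
      moreover have "inverse (c (gen b) b0) * c h b0 = c g b * inverse (c (gen b') b0)"
        using cc by (simp add: field_simps c_nonzero)
      ultimately show "\<Psi> q (Poly_Mapping.single (p g b) (c g b)) = A g (\<Psi> q (symb b))"
        by (simp add: \<Psi>_def b'_def)
    qed
    also have "\<dots> = A g (\<Psi> q z)" by (simp add: A_def \<Psi>_def lext_lext)
    finally show ?thesis .
  qed
  have surj: "\<exists>\<phi>\<in>carrier ?H. T' \<phi> = q" if q: "q \<in> supported B1" for q
  proof
    have qB: "q \<in> supported B" using q B1 by auto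
    let ?\<phi> = "\<lambda>x\<in>carrier V. vec (\<Psi> q (T x))"
    have \<phi>: "vec (\<Psi> q (T x)) \<in> carrier V" "T (vec (\<Psi> q (T x))) = \<Psi> q (T x)" if "x \<in> carrier V" for x
      using \<Psi>_closed[OF qB T_closed[OF that]] vec_closed T_vec by auto
    have \<Psi>_lin: "\<Psi> q (z + z') = \<Psi> q z + \<Psi> q z'" "\<Psi> q (scale k z) = scale k (\<Psi> q z)" for z z' k
      by (simp_all add: \<Psi>_def lext_add lext_scale)
    have k: "Poly_Mapping.keys (\<Psi> q (T x)) \<subseteq> B" if "x \<in> carrier V" for x
      using \<Psi>_closed[OF qB T_closed[OF that]] by simp
    have vec_act: "vec (A g z) = act V g (vec z)" if "g \<in> carrier G" "z \<in> supported B" for g z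
      using that by (subst T_eq_iff[symmetric]) (simp_all only: vec_closed T_vec actV A_closed)
    show "?\<phi> \<in> carrier ?H"
      unfolding H
      by (auto simp: add_closed smult_closed actV \<phi> T_add T_smult \<Psi>_lin k vec_add vec_scale vec_act
          \<Psi>_A[OF _ q T_closed])
    \<comment> \<open>\<open>gen b0\<close> need not be the identity, but it stabilises
      \<open>b0\<close>, so its scalar on \<open>q\<close> cancels the normalising factor.\<close>
    have "gen b0 \<in> carrier G" "p (gen b0) b0 = b0" using gen b0 by auto
    from eigen[OF this q] show "T' ?\<phi> = q"
      using e0 \<phi>[OF e0(1)] by (simp add: T'_def \<Psi>_def c_nonzero)
  qed
  have inj: "inj_on T' (carrier ?H)"
  proof (rule inj_onI)
    fix \<phi> \<psi> assume \<phi>: "\<phi> \<in> carrier ?H" and \<psi>: "\<psi> \<in> carrier ?H" and eq: "T' \<phi> = T' \<psi>"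
    show "\<phi> = \<psi>"
    proof (rule extensionalityI)
      show "\<phi> \<in> extensional (carrier V)" "\<psi> \<in> extensional (carrier V)" using \<phi> \<psi> unfolding H by auto
      fix x assume x: "x \<in> carrier V"
      then have "\<phi> x \<in> carrier V" "\<psi> x \<in> carrier V" using \<phi> \<psi> unfolding H by auto
      moreover have "T (\<phi> x) = T (\<psi> x)" using T_\<phi>[OF \<phi> x] T_\<phi>[OF \<psi> x] eq by simp
      ultimately show "\<phi> x = \<psi> x" using T_eq_iff by blast
    qed
  qed
  have "coordinates ?H B1 T'"
  proof
    show "bij_betw T' (carrier ?H) (supported B1)"
      unfolding bij_betw_def using inj T'_closed surj by blast
    show "\<zero>\<^bsub>?H\<^esub> \<in> carrier ?H" unfolding H
      by (auto simp: hom_space_def zero_closed add_closed smult_closed actV T_eq_iff[symmetric] T_add T_smult T_zero A_def)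
    show "T' \<zero>\<^bsub>?H\<^esub> = 0" by (simp add: T'_def hom_space_def e0 T_zero)
  next
    fix \<phi> \<psi> assume "\<phi> \<in> carrier ?H" "\<psi> \<in> carrier ?H"
    then show "\<phi> \<oplus>\<^bsub>?H\<^esub> \<psi> \<in> carrier ?H"
      unfolding H
      by (auto simp: hom_space_def zero_closed add_closed smult_closed actV T_eq_iff[symmetric] T_add T_smult T_zero
          A_add A_scale scale_add_right)
    show "T' (\<phi> \<oplus>\<^bsub>?H\<^esub> \<psi>) = T' \<phi> + T' \<psi>"
      using \<open>\<phi> \<in> carrier ?H\<close> \<open>\<psi> \<in> carrier ?H\<close> unfolding H
      by (simp add: T'_def hom_space_def e0 T_add)
  next
    fix k \<phi> assume "\<phi> \<in> carrier ?H"
    then show "k \<odot>\<^bsub>?H\<^esub> \<phi> \<in> carrier ?H"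
      unfolding H
      by (auto simp: hom_space_def zero_closed add_closed smult_closed actV T_eq_iff[symmetric] T_add T_smult T_zero
          A_add A_scale scale_add_right mult.commute)
    show "T' (k \<odot>\<^bsub>?H\<^esub> \<phi>) = scale k (T' \<phi>)"
      using \<open>\<phi> \<in> carrier ?H\<close> unfolding H
      by (simp add: T'_def hom_space_def e0 T_smult)
  qed
  then show ?thesis by blast
qed

section \<open>McLain groups\<close>

definition restr :: "'a set \<Rightarrow> ('a \<Rightarrow>\<^sub>0 'b::comm_monoid_add) \<Rightarrow> ('a \<Rightarrow>\<^sub>0 'b)" where
  "restr S x = (\<Sum>k\<in>Poly_Mapping.keys x \<inter> S. Poly_Mapping.single k (Poly_Mapping.lookup x k))"

lemma lookup_restr: "Poly_Mapping.lookup (restr S x) k = (if k \<in> S then Poly_Mapping.lookup x k else 0)"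
proof -
  have "Poly_Mapping.lookup (restr S x) k
    = (\<Sum>j\<in>Poly_Mapping.keys x \<inter> S. if j = k then Poly_Mapping.lookup x k else 0)"
    unfolding restr_def lookup_sum by (rule sum.cong) (auto simp: lookup_single when_def)
  then show ?thesis by (auto simp: in_keys_iff)
qed

lemma keys_restr: "Poly_Mapping.keys (restr S x) = Poly_Mapping.keys x \<inter> S"
  by (auto simp: in_keys_iff lookup_restr split: if_splits)

lemma restr_id: "Poly_Mapping.keys x \<subseteq> S \<Longrightarrow> restr S x = x"
  by (rule poly_mapping_eqI) (auto simp: lookup_restr in_keys_iff)

lemma restr_eq_zero_iff: "restr S x = 0 \<longleftrightarrow> Poly_Mapping.keys x \<inter> S = {}"
  by (metis keys_restr keys_zero poly_mapping_eqI in_keys_iff lookup_zero empty_iff)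

lemma restr_restr: "restr S (restr S' x) = restr (S \<inter> S') x"
  by (rule poly_mapping_eqI) (simp add: lookup_restr)

lemma restr_zero [simp]: "restr S 0 = 0"
  by (simp add: restr_def)

text \<open>Matrix multiplication, with the sum over an arbitrary finite set \<open>C\<close>
  containing the columns of \<open>x\<close>; a common \<open>C\<close> lets products of different
  factors be compared term by term.\<close>

lemma lookup_J_mult:
  assumes C: "finite C" "snd ` Poly_Mapping.keys x \<subseteq> C"
  shows "Poly_Mapping.lookup (J_mult x y) (a, d)
    = (\<Sum>b\<in>C. Poly_Mapping.lookup x (a, b) * Poly_Mapping.lookup y (b, d))"
proof -
  let ?x = "Poly_Mapping.lookup x" and ?y = "Poly_Mapping.lookup y"
  have inC: "b \<in> C" if "(a, b) \<in> Poly_Mapping.keys x" for a b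
    using C(2) that by force
  have inner: "(\<Sum>(\<gamma>, \<delta>)\<in>Poly_Mapping.keys y. Poly_Mapping.lookup
      (if \<beta> = \<gamma> then Poly_Mapping.single (\<alpha>, \<delta>) (?x (\<alpha>, \<beta>) * ?y (\<gamma>, \<delta>)) else 0) (a, d))
    = (if \<alpha> = a then ?x (a, \<beta>) * ?y (\<beta>, d) else 0)" for \<alpha> \<beta>
  proof -
    have "(\<Sum>(\<gamma>, \<delta>)\<in>Poly_Mapping.keys y. Poly_Mapping.lookup
        (if \<beta> = \<gamma> then Poly_Mapping.single (\<alpha>, \<delta>) (?x (\<alpha>, \<beta>) * ?y (\<gamma>, \<delta>)) else 0) (a, d))
      = (\<Sum>k\<in>Poly_Mapping.keys y. if k = (\<beta>, d) then (if \<alpha> = a then ?x (a, \<beta>) * ?y (\<beta>, d) else 0) else 0)"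
      by (rule sum.cong) (auto simp: lookup_single when_def split: if_splits)
    then show ?thesis by (auto simp: in_keys_iff)
  qed
  have "Poly_Mapping.lookup (J_mult x y) (a, d)
    = (\<Sum>(\<alpha>, \<beta>)\<in>Poly_Mapping.keys x. if \<alpha> = a then ?x (a, \<beta>) * ?y (\<beta>, d) else 0)"
    unfolding J_mult_def lookup_sum split_def inner[unfolded split_def] by simp
  also have "\<dots> = (\<Sum>(\<alpha>, \<beta>)\<in>Poly_Mapping.keys x \<union> {a} \<times> C. if \<alpha> = a then ?x (a, \<beta>) * ?y (\<beta>, d) else 0)"
    by (rule sum.mono_neutral_left) (use C in \<open>auto simp: in_keys_iff\<close>)
  also have "\<dots> = (\<Sum>(\<alpha>, \<beta>)\<in>{a} \<times> C. if \<alpha> = a then ?x (a, \<beta>) * ?y (\<beta>, d) else 0)"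
    by (rule sum.mono_neutral_right) (use C(1) inC in \<open>auto split: if_splits\<close>)
  also have "\<dots> = (\<Sum>b\<in>C. ?x (a, b) * ?y (b, d))"
    by (simp add: sum.cartesian_product[symmetric])
  finally show ?thesis .
qed

abbreviation mc_mult (infixl \<open>\<star>\<close> 70) where "x \<star> y \<equiv> x \<otimes>\<^bsub>McLain\<^esub> y"
abbreviation mc_inv where "mc_inv x \<equiv> inv\<^bsub>McLain\<^esub> x"

lemma mc_mult: "x \<star> y = x + y + J_mult x y"
  by (simp add: McLain_def)

lemma carrier_McLain: "carrier McLain = supported Phi" and one_McLain: "\<one>\<^bsub>McLain\<^esub> = 0"
  by (simp_all add: McLain_def)

lemma lookup_mult:
  assumes "finite C" "snd ` Poly_Mapping.keys x \<subseteq> C"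
  shows "Poly_Mapping.lookup (x \<star> y) (a, d) = Poly_Mapping.lookup x (a, d) + Poly_Mapping.lookup y (a, d)
    + (\<Sum>b\<in>C. Poly_Mapping.lookup x (a, b) * Poly_Mapping.lookup y (b, d))"
  by (simp add: mc_mult lookup_add lookup_J_mult[OF assms])

lemma keys_J_mult:
  assumes "(a, d) \<in> Poly_Mapping.keys (J_mult x y)"
  shows "\<exists>b. (a, b) \<in> Poly_Mapping.keys x \<and> (b, d) \<in> Poly_Mapping.keys y"
proof (rule ccontr)
  assume *: "\<not> ?thesis"
  have "Poly_Mapping.lookup (J_mult x y) (a, d) = 0"
    unfolding lookup_J_mult[OF finite_imageI[OF finite_keys] subset_refl]
  proof (intro sum.neutral ballI)
    fix b
    have "Poly_Mapping.lookup x (a, b) = 0 \<or> Poly_Mapping.lookup y (b, d) = 0"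
      using * by (auto simp: in_keys_iff)
    then show "Poly_Mapping.lookup x (a, b) * Poly_Mapping.lookup y (b, d) = 0" by auto
  qed
  with assms show False by (simp add: in_keys_iff)
qed

text \<open>The quadratic term at (a, d) is a sum over intermediate indices b; without such a path
  it vanishes. Most entry computations below reduce to excluding paths.\<close>

lemma lookup_mult_eq_add:
  assumes "\<And>b. (a, b) \<in> Poly_Mapping.keys x \<Longrightarrow> (b, d) \<notin> Poly_Mapping.keys y"
  shows "Poly_Mapping.lookup (x \<star> y) (a, d) = Poly_Mapping.lookup x (a, d) + Poly_Mapping.lookup y (a, d)"
proof -
  have "Poly_Mapping.lookup (J_mult x y) (a, d) = 0"
    using keys_J_mult[of a d x y] assms by (auto simp: in_keys_iff)
  then show ?thesis by (simp add: mc_mult lookup_add)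
qed

lemma mc_mult_eq_add:
  assumes "\<And>a b c. (a, b) \<in> Poly_Mapping.keys x \<Longrightarrow> (b, c) \<notin> Poly_Mapping.keys y"
  shows "x \<star> y = x + y"
  by (rule poly_mapping_eqI) (use assms in \<open>auto simp: lookup_mult_eq_add lookup_add\<close>)

section \<open>Closed sets of roots and the group structure\<close>

definition closed_roots :: "('l \<times> 'l) set \<Rightarrow> bool" where
  "closed_roots \<Delta> \<longleftrightarrow> (\<forall>a b c. (a, b) \<in> \<Delta> \<longrightarrow> (b, c) \<in> \<Delta> \<longrightarrow> (a, c) \<in> \<Delta>)"

lemma closed_Phi: "closed_roots Phi"
  by (auto simp: closed_roots_def Phi_def)

lemma supported_mult:
  assumes "closed_roots \<Delta>" "x \<in> supported \<Delta>" "y \<in> supported \<Delta>"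
  shows "x \<star> y \<in> supported \<Delta>"
proof (clarify)
  fix a d assume k: "(a, d) \<in> Poly_Mapping.keys (x \<star> y)"
  show "(a, d) \<in> \<Delta>"
  proof (rule ccontr)
    assume n: "(a, d) \<notin> \<Delta>"
    then have "Poly_Mapping.lookup (x \<star> y) (a, d) = Poly_Mapping.lookup x (a, d) + Poly_Mapping.lookup y (a, d)"
      by (intro lookup_mult_eq_add) (use assms in \<open>unfold closed_roots_def, blast\<close>)
    also have "\<dots> = 0"
    proof -
      have "(a, d) \<notin> Poly_Mapping.keys x" "(a, d) \<notin> Poly_Mapping.keys y" using n assms by auto
      then show ?thesis by (simp add: in_keys_iff)
    qed
    finally show False using k by (simp add: in_keys_iff)
  qed
qed

lemma mc_assoc: "(x \<star> y) \<star> z = x \<star> (y \<star> z)"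
proof (rule poly_mapping_eqI, clarify)
  fix a d
  let ?x = "Poly_Mapping.lookup x" and ?y = "Poly_Mapping.lookup y" and ?z = "Poly_Mapping.lookup z"
  \<comment> \<open>One column set that serves every product on either side.\<close>
  define C where "C = snd ` (Poly_Mapping.keys x \<union> Poly_Mapping.keys y \<union> Poly_Mapping.keys (x \<star> y))"
  have C: "finite C" "snd ` Poly_Mapping.keys x \<subseteq> C" "snd ` Poly_Mapping.keys y \<subseteq> C"
    "snd ` Poly_Mapping.keys (x \<star> y) \<subseteq> C"
    by (auto simp: C_def)
  have "(\<Sum>b\<in>C. (\<Sum>b'\<in>C. ?x (a, b') * ?y (b', b)) * ?z (b, d))
    = (\<Sum>b\<in>C. \<Sum>b'\<in>C. ?x (a, b) * (?y (b, b') * ?z (b', d)))"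
    by (subst sum.swap) (simp add: sum_distrib_right mult.assoc)
  then show "Poly_Mapping.lookup ((x \<star> y) \<star> z) (a, d) = Poly_Mapping.lookup (x \<star> (y \<star> z)) (a, d)"
    unfolding lookup_mult[OF C(1,4)] lookup_mult[OF C(1,2)] lookup_mult[OF C(1,3)]
    by (simp add: distrib_left distrib_right sum.distrib sum_distrib_left add.assoc)
qed

lemma zero_mult [simp]: "0 \<star> x = x" and mult_zero [simp]: "x \<star> 0 = x"
  by (subst mc_mult_eq_add; simp)+

lemma mult_single_neg: "k \<in> Phi \<Longrightarrow> Poly_Mapping.single k (- r) \<star> Poly_Mapping.single k r = 0"
  by (subst mc_mult_eq_add) (auto simp: Phi_def single_uminus split: if_splits)

text \<open>Splitting off a root in the lowest row factorises \<open>1 + x\<close> without any commutator term.\<close>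

lemma supported_induct [consumes 2, case_names zero mult]:
  fixes x :: "'l::linorder \<times> 'l \<Rightarrow>\<^sub>0 'r::ring_1"
  assumes "x \<in> supported \<Delta>" "\<Delta> \<subseteq> Phi"
    and "P 0"
    and "\<And>k r y. k \<in> \<Delta> \<Longrightarrow> y \<in> supported \<Delta> \<Longrightarrow> P y \<Longrightarrow> P (Poly_Mapping.single k r \<star> y)"
  shows "P x"
  using assms(1)
proof (induct "card (Poly_Mapping.keys x)" arbitrary: x)
  case 0
  then have "x = 0" by (metis card_0_eq finite_keys keys_eq_empty)
  then show ?case using assms(3) by simp
next
  case (Suc n)
  then have "Poly_Mapping.keys x \<noteq> {}" by auto
  then have "Max (fst ` Poly_Mapping.keys x) \<in> fst ` Poly_Mapping.keys x" by (intro Max_in) auto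
  then obtain a b where ab: "(a, b) \<in> Poly_Mapping.keys x" and a: "a = Max (fst ` Poly_Mapping.keys x)" by auto
  define y where "y = restr (- {(a, b)}) x"
  have ky: "Poly_Mapping.keys y = Poly_Mapping.keys x - {(a, b)}"
    by (auto simp: y_def keys_restr)
  have "P y" using Suc ab by (intro Suc.hyps(1)) (auto simp: ky)
  \<comment> \<open>All rows of \<open>x\<close> are at most \<open>a\<close> and \<open>b\<close>
    exceeds \<open>a\<close>, so \<open>y\<close> has no entry in row \<open>b\<close>.\<close>
  moreover have "x = Poly_Mapping.single (a, b) (Poly_Mapping.lookup x (a, b)) \<star> y"
  proof (subst mc_mult_eq_add)
    fix a' b' c assume "(a', b') \<in> Poly_Mapping.keys (Poly_Mapping.single (a, b) (Poly_Mapping.lookup x (a, b)))"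
    then have "b' = b" by (auto split: if_splits)
    moreover have "a < b" using ab Suc(3) assms(2) by (auto simp: Phi_def)
    moreover have "(b, c) \<in> Poly_Mapping.keys x \<Longrightarrow> b \<le> a" unfolding a by (force intro: Max_ge)
    ultimately show "(b', c) \<notin> Poly_Mapping.keys y" by (auto simp: ky)
  next
    show "x = Poly_Mapping.single (a, b) (Poly_Mapping.lookup x (a, b)) + y"
      by (rule poly_mapping_eqI) (auto simp: lookup_add y_def lookup_restr lookup_single when_def)
  qed
  ultimately show ?case using assms(4)[of "(a, b)" y "Poly_Mapping.lookup x (a, b)"] ab Suc(3) by (auto simp: ky)
qed

text \<open>The inverses of the root factors are multiplied in reverse order, and closedness keeps
  the result supported on \<Delta>. The full set \<open>Phi\<close> gives the group axiom, smaller
  sets give subgroups.\<close>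

lemma supported_left_inverse:
  assumes "closed_roots \<Delta>" "\<Delta> \<subseteq> Phi" "x \<in> supported \<Delta>"
  shows "\<exists>y\<in>supported \<Delta>. y \<star> x = 0"
  using assms(3,2)
proof (induct rule: supported_induct)
  case zero
  show ?case by (rule bexI[of _ 0]) auto
next
  case (mult k r y)
  then obtain y' where y': "y' \<in> supported \<Delta>" "y' \<star> y = 0" by blast
  have "(y' \<star> Poly_Mapping.single k (- r)) \<star> (Poly_Mapping.single k r \<star> y)
    = y' \<star> ((Poly_Mapping.single k (- r) \<star> Poly_Mapping.single k r) \<star> y)"
    by (simp only: mc_assoc)
  also have "\<dots> = 0" using mult(1) assms(2) y' by (subst mult_single_neg) auto
  finally show ?case using mult(1) y'(1)
    by (intro bexI[of _ "y' \<star> Poly_Mapping.single k (- r)"] supported_mult assms(1)) auto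
qed

lemma group_McLain: "group (McLain :: ('l::linorder \<times> 'l \<Rightarrow>\<^sub>0 'r::ring_1) monoid)"
proof (rule groupI)
  show "\<And>x y :: 'l \<times> 'l \<Rightarrow>\<^sub>0 'r. x \<in> carrier McLain \<Longrightarrow> y \<in> carrier McLain \<Longrightarrow> x \<star> y \<in> carrier McLain"
    unfolding carrier_McLain by (rule supported_mult[OF closed_Phi])
  show "\<And>x :: 'l \<times> 'l \<Rightarrow>\<^sub>0 'r. x \<in> carrier McLain \<Longrightarrow> \<exists>y\<in>carrier McLain. y \<star> x = \<one>\<^bsub>McLain\<^esub>"
    unfolding carrier_McLain one_McLain by (rule supported_left_inverse[OF closed_Phi subset_refl])
qed (auto simp: carrier_McLain one_McLain mc_assoc)

interpretation McLain: group McLain by (rule group_McLain)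

lemma supported_subset_carrier: "\<Delta> \<subseteq> Phi \<Longrightarrow> supported \<Delta> \<subseteq> carrier McLain"
  by (auto simp: carrier_McLain)

lemma mc_cancel:
  assumes "x \<in> carrier McLain"
  shows "mc_inv x \<star> x = 0" "x \<star> mc_inv x = 0"
    "mc_inv x \<star> (x \<star> y) = y" "x \<star> (mc_inv x \<star> y) = y"
proof -
  show 1: "mc_inv x \<star> x = 0" "x \<star> mc_inv x = 0"
    using McLain.l_inv[OF assms] McLain.r_inv[OF assms] by (simp_all add: one_McLain)
  show "mc_inv x \<star> (x \<star> y) = y" "x \<star> (mc_inv x \<star> y) = y"
    by (simp_all add: mc_assoc[symmetric] 1)
qed

lemma mc_inv_zero [simp]: "mc_inv (0 :: 'l::linorder \<times> 'l \<Rightarrow>\<^sub>0 'r::ring_1) = 0"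
  using McLain.inv_one[where 'a='l and 'b='r] unfolding one_McLain .

lemma subgroup_supported:
  fixes \<Delta> :: "('l::linorder \<times> 'l) set"
  assumes "closed_roots \<Delta>" "\<Delta> \<subseteq> Phi"
  shows "subgroup (supported \<Delta> :: ('l \<times> 'l \<Rightarrow>\<^sub>0 'r::ring_1) set) McLain"
proof (rule McLain.subgroupI)
  show "supported \<Delta> \<subseteq> (carrier McLain :: ('l \<times> 'l \<Rightarrow>\<^sub>0 'r) set)" by (rule supported_subset_carrier[OF assms(2)])
  show "(supported \<Delta> :: ('l \<times> 'l \<Rightarrow>\<^sub>0 'r) set) \<noteq> {}"
    by (rule ex_in_conv[THEN iffD1, OF exI[of _ 0]]) simp
  fix x :: "'l \<times> 'l \<Rightarrow>\<^sub>0 'r" assume x: "x \<in> supported \<Delta>"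
  obtain y where y: "y \<in> supported \<Delta>" "y \<star> x = 0" using supported_left_inverse[OF assms x] by blast
  then have "mc_inv x = y"
    by (intro McLain.inv_equality) (use x y supported_subset_carrier[OF assms(2)] in \<open>auto simp: one_McLain\<close>)
  then show "mc_inv x \<in> supported \<Delta>" using y by simp
next
  fix x y :: "'l \<times> 'l \<Rightarrow>\<^sub>0 'r" assume "x \<in> supported \<Delta>" "y \<in> supported \<Delta>"
  then show "x \<star> y \<in> supported \<Delta>" by (rule supported_mult[OF assms(1)])
qed

lemma supported_subset_McLain_sub:
  assumes "\<Delta> \<subseteq> Phi"
  shows "supported \<Delta> \<subseteq> (McLain_sub \<Delta> :: ('l::linorder \<times> 'l \<Rightarrow>\<^sub>0 'r::ring_1) set)"
proof
  fix x :: "'l \<times> 'l \<Rightarrow>\<^sub>0 'r" assume "x \<in> supported \<Delta>"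
  then show "x \<in> McLain_sub \<Delta>" using assms
  proof (induct rule: supported_induct)
    case zero
    then show ?case unfolding McLain_sub_def using generate.one[of McLain] by (simp add: one_McLain)
  next
    case (mult k r y)
    have "Poly_Mapping.single k r \<in> (\<Union>a\<in>\<Delta>. root_group a)"
      using mult(1) by (auto simp: root_group_def)
    then show ?case using mult(3) unfolding McLain_sub_def
      by (intro generate.eng[OF generate.incl])
  qed
qed

text \<open>Replaces generated subgroups by a condition on supports: the elements supported on a
  closed set form a subgroup, and each of them is a product of root elements.\<close>

lemma McLain_sub_eq_supported:
  assumes "closed_roots \<Delta>" "\<Delta> \<subseteq> Phi"
  shows "McLain_sub \<Delta> = (supported \<Delta> :: ('l::linorder \<times> 'l \<Rightarrow>\<^sub>0 'r::ring_1) set)"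
proof
  show "McLain_sub \<Delta> \<subseteq> (supported \<Delta> :: ('l \<times> 'l \<Rightarrow>\<^sub>0 'r) set)" unfolding McLain_sub_def
    by (rule McLain.generate_subgroup_incl[OF _ subgroup_supported[OF assms]])
      (auto simp: root_group_def split: if_splits)
qed (rule supported_subset_McLain_sub[OF assms(2)])

text \<open>An entry in column d of a product uses the left factor only in columns up to d of the
  same row. If \<Delta> is an initial segment in each row, truncating the left factor is therefore
  invisible, and truncated rows carry a right action.\<close>

lemma restr_mult_left:
  assumes \<Delta>: "\<And>a b c. (a, c) \<in> \<Delta> \<Longrightarrow> a < b \<Longrightarrow> b < c \<Longrightarrow> (a, b) \<in> \<Delta>"
    and xy: "x \<in> carrier McLain" "y \<in> carrier McLain"
  shows "restr \<Delta> (restr \<Delta> x \<star> y) = restr \<Delta> (x \<star> y)"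
proof (rule poly_mapping_eqI, clarify)
  fix a d
  let ?C = "snd ` Poly_Mapping.keys x"
  have C: "finite ?C" "snd ` Poly_Mapping.keys x \<subseteq> ?C" "snd ` Poly_Mapping.keys (restr \<Delta> x) \<subseteq> ?C"
    by (auto simp: keys_restr)
  have "(\<Sum>b\<in>?C. Poly_Mapping.lookup (restr \<Delta> x) (a, b) * Poly_Mapping.lookup y (b, d))
    = (\<Sum>b\<in>?C. Poly_Mapping.lookup x (a, b) * Poly_Mapping.lookup y (b, d))" if "(a, d) \<in> \<Delta>"
  proof (rule sum.cong[OF refl])
    fix b
    show "Poly_Mapping.lookup (restr \<Delta> x) (a, b) * Poly_Mapping.lookup y (b, d)
      = Poly_Mapping.lookup x (a, b) * Poly_Mapping.lookup y (b, d)"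
    proof (cases "(a, b) \<in> Poly_Mapping.keys x \<and> (b, d) \<in> Poly_Mapping.keys y")
      case True
      then have "a < b" "b < d" using xy by (auto simp: carrier_McLain Phi_def)
      then show ?thesis using \<Delta>[OF that] by (simp add: lookup_restr)
    qed (auto simp: in_keys_iff lookup_restr)
  qed
  then show "Poly_Mapping.lookup (restr \<Delta> (restr \<Delta> x \<star> y)) (a, d) = Poly_Mapping.lookup (restr \<Delta> (x \<star> y)) (a, d)"
    by (simp add: lookup_restr lookup_mult[OF C(1,2)] lookup_mult[OF C(1,3)])
qed

text \<open>Both steps of a path leading to a position of \<Delta> stay in \<Delta>, so truncating
  both factors loses nothing; closedness keeps the product of the truncations inside \<Delta>. For
  \<open>L_roots\<close> this yields the projection onto \<open>L\<close>.\<close>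

lemma restr_mult_hom:
  assumes \<Delta>: "closed_roots \<Delta>" "\<And>a b c. (a, c) \<in> \<Delta> \<Longrightarrow> a < b \<Longrightarrow> b < c \<Longrightarrow> (a, b) \<in> \<Delta> \<and> (b, c) \<in> \<Delta>"
    and xy: "x \<in> carrier McLain" "y \<in> carrier McLain"
  shows "restr \<Delta> (x \<star> y) = restr \<Delta> x \<star> restr \<Delta> y"
proof (rule poly_mapping_eqI, clarify)
  fix a d
  show "Poly_Mapping.lookup (restr \<Delta> (x \<star> y)) (a, d) = Poly_Mapping.lookup (restr \<Delta> x \<star> restr \<Delta> y) (a, d)"
  proof (cases "(a, d) \<in> \<Delta>")
    case False
    have "restr \<Delta> x \<star> restr \<Delta> y \<in> supported \<Delta>"
      by (intro supported_mult \<Delta>(1)) (auto simp: keys_restr)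
    then show ?thesis using False by (auto simp: lookup_restr in_keys_iff subset_iff)
  next
    case True
    let ?C = "snd ` Poly_Mapping.keys x"
    have C: "finite ?C" "snd ` Poly_Mapping.keys x \<subseteq> ?C" "snd ` Poly_Mapping.keys (restr \<Delta> x) \<subseteq> ?C"
      by (auto simp: keys_restr)
    have "(\<Sum>b\<in>?C. Poly_Mapping.lookup (restr \<Delta> x) (a, b) * Poly_Mapping.lookup (restr \<Delta> y) (b, d))
      = (\<Sum>b\<in>?C. Poly_Mapping.lookup x (a, b) * Poly_Mapping.lookup y (b, d))"
    proof (rule sum.cong[OF refl])
      fix b
      show "Poly_Mapping.lookup (restr \<Delta> x) (a, b) * Poly_Mapping.lookup (restr \<Delta> y) (b, d)
        = Poly_Mapping.lookup x (a, b) * Poly_Mapping.lookup y (b, d)"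
      proof (cases "(a, b) \<in> Poly_Mapping.keys x \<and> (b, d) \<in> Poly_Mapping.keys y")
        case T: True
        then have "a < b" "b < d" using xy by (auto simp: carrier_McLain Phi_def)
        then show ?thesis using \<Delta>(2)[OF True] by (simp add: lookup_restr)
      qed (auto simp: in_keys_iff lookup_restr)
    qed
    then show ?thesis using True by (simp add: lookup_restr lookup_mult[OF C(1,2)] lookup_mult[OF C(1,3)])
  qed
qed

section \<open>Elementary modules\<close>

definition row_roots :: "'l::linorder \<times> 'l \<Rightarrow> ('l \<times> 'l) set" where
  "row_roots d = {(fst d, \<gamma>) | \<gamma>. fst d < \<gamma> \<and> \<gamma> < snd d}"

text \<open>The coset of \<open>P\<close> containing \<open>g\<close> is labelled by the part of row \<open>\<alpha>\<close> of \<open>g\<^sup>-\<^sup>1\<close>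
  strictly between the columns \<open>\<alpha>\<close> and \<open>\<beta>\<close>. In these labels the elementary module is monomial:
  \<open>g\<close> multiplies the row by \<open>g\<^sup>-\<^sup>1\<close> on the right, and the scalar is read off column \<open>\<beta>\<close>.\<close>

definition row_act ::
  "'l::linorder \<times> 'l \<Rightarrow> ('l \<times> 'l \<Rightarrow>\<^sub>0 'r::ring_1) \<Rightarrow> ('l \<times> 'l \<Rightarrow>\<^sub>0 'r) \<Rightarrow> ('l \<times> 'l \<Rightarrow>\<^sub>0 'r)" where
  "row_act d g b = restr (row_roots d) (b \<star> mc_inv g)"

text \<open>The coset labelled \<open>b\<close> is represented by b^-1. For \<open>g\<close> in
  \<open>L\<close> and b' = \<open>row_act d g b\<close>, the element b' g b^-1 lies in
  \<open>P\<close>, and the scalar is \<mu> of its entry at \<open>d\<close>. The factor b^-1 has no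
  entry in column \<open>snd d\<close>, so b' g has the same entry.\<close>

definition row_coef ::
  "'l::linorder \<times> 'l \<Rightarrow> ('r::ring_1 \<Rightarrow> 'f) \<Rightarrow> ('l \<times> 'l \<Rightarrow>\<^sub>0 'r) \<Rightarrow> ('l \<times> 'l \<Rightarrow>\<^sub>0 'r) \<Rightarrow> 'f" where
  "row_coef d \<mu> g b = \<mu> (Poly_Mapping.lookup (row_act d g b \<star> g) d)"

lemma row_subset_Phi: "row_roots d \<subseteq> Phi"
  by (auto simp: row_roots_def Phi_def)

lemma row_initial: "(a, c) \<in> row_roots d \<Longrightarrow> a < b \<Longrightarrow> b < c \<Longrightarrow> (a, b) \<in> row_roots d"
  by (auto simp: row_roots_def)

lemma end_notin_row: "d \<notin> row_roots d"
  by (cases d) (simp add: row_roots_def)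

lemma closed_row: "closed_roots (row_roots d)"
  by (auto simp: closed_roots_def row_roots_def)

lemma supported_row_carrier: "b \<in> supported (row_roots d) \<Longrightarrow> b \<in> carrier McLain"
  using supported_subset_carrier[OF row_subset_Phi] by blast

lemma row_act_closed: "row_act d g b \<in> supported (row_roots d)"
  by (auto simp: row_act_def keys_restr)

lemma row_act_one: "b \<in> supported (row_roots d) \<Longrightarrow> row_act d 0 b = b"
  by (simp add: row_act_def restr_id)

text \<open>Truncation may be postponed until after the multiplication, which is what makes
  \<open>row_act\<close> an action.\<close>

lemma row_act_restr:
  assumes "g \<in> carrier McLain" "x \<in> carrier McLain"
  shows "row_act d g (restr (row_roots d) x) = restr (row_roots d) (x \<star> mc_inv g)"
  unfolding row_act_def by (rule restr_mult_left) (use assms in \<open>auto intro: row_initial\<close>)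

lemma row_act_mult:
  assumes "g \<in> carrier McLain" "h \<in> carrier McLain" "b \<in> supported (row_roots d)"
  shows "row_act d (g \<star> h) b = row_act d g (row_act d h b)"
  unfolding row_act_def[of d h]
  using assms supported_row_carrier[OF assms(3)]
  by (subst row_act_restr) (auto simp: row_act_def McLain.inv_mult_group mc_assoc)

text \<open>Apart from the entry of \<open>x\<close> at \<open>d\<close>, which splits off
  additively, only the truncated row of \<open>x\<close> meets \<open>y\<close>. The cocycle
  identity for \<open>row_coef\<close> rests on this.\<close>

lemma lookup_mult_row:
  fixes x y :: "'l::linorder \<times> 'l \<Rightarrow>\<^sub>0 'r::ring_1"
  assumes "x \<in> carrier McLain" "y \<in> carrier McLain"
  shows "Poly_Mapping.lookup (x \<star> y) d
    = Poly_Mapping.lookup x d + Poly_Mapping.lookup (restr (row_roots d) x \<star> y) d"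
proof -
  let ?C = "snd ` Poly_Mapping.keys x"
  have C: "finite ?C" "snd ` Poly_Mapping.keys x \<subseteq> ?C" "snd ` Poly_Mapping.keys (restr (row_roots d) x) \<subseteq> ?C"
    by (auto simp: keys_restr)
  have "(\<Sum>b\<in>?C. Poly_Mapping.lookup (restr (row_roots d) x) (fst d, b) * Poly_Mapping.lookup y (b, snd d))
    = (\<Sum>b\<in>?C. Poly_Mapping.lookup x (fst d, b) * Poly_Mapping.lookup y (b, snd d))"
  proof (rule sum.cong[OF refl])
    fix b
    show "Poly_Mapping.lookup (restr (row_roots d) x) (fst d, b) * Poly_Mapping.lookup y (b, snd d)
      = Poly_Mapping.lookup x (fst d, b) * Poly_Mapping.lookup y (b, snd d)"
    proof (cases "(fst d, b) \<in> Poly_Mapping.keys x \<and> (b, snd d) \<in> Poly_Mapping.keys y")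
      case True
      then have "fst d < b" "b < snd d" using assms by (auto simp: carrier_McLain Phi_def)
      then show ?thesis by (simp add: lookup_restr row_roots_def)
    qed (auto simp: in_keys_iff lookup_restr)
  qed
  moreover have "Poly_Mapping.lookup (restr (row_roots d) x) d = 0"
    by (cases d) (auto simp: lookup_restr row_roots_def)
  ultimately show ?thesis
    using lookup_mult[OF C(1,2), of y "fst d" "snd d"] lookup_mult[OF C(1,3), of y "fst d" "snd d"]
    by (simp add: add.assoc)
qed

lemma linear_char_zero: "linear_char \<mu> \<Longrightarrow> \<mu> 0 = 1"
  unfolding linear_char_def by (metis add.right_neutral mult_cancel_left1)

lemma row_coef_nonzero: "linear_char \<mu> \<Longrightarrow> row_coef d \<mu> g b \<noteq> 0"
  by (simp add: row_coef_def linear_char_def)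

text \<open>Let b' be the final label. Multiplying b' by \<open>g\<close> and truncating undoes the
  action of \<open>g\<close>, so the entry of b' g h at \<open>d\<close> is the sum of the entries
  from which the two scalars are read; \<mu> turns the sum into a product.\<close>

lemma row_coef_mult:
  assumes \<mu>: "linear_char \<mu>" and g: "g \<in> carrier McLain" and h: "h \<in> carrier McLain"
    and b: "b \<in> supported (row_roots d)"
  shows "row_coef d \<mu> (g \<star> h) b = row_coef d \<mu> g (row_act d h b) * row_coef d \<mu> h b"
proof -
  define b' where "b' = row_act d (g \<star> h) b"
  have b': "b' \<in> supported (row_roots d)" "b' \<in> carrier McLain"
    using row_act_closed supported_row_carrier unfolding b'_def by blast+
  have b'_eq: "b' = row_act d g (row_act d h b)" unfolding b'_def by (rule row_act_mult[OF g h b])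
  have bh: "row_act d h b \<in> supported (row_roots d)" by (rule row_act_closed)
  have "restr (row_roots d) (b' \<star> g) = row_act d (mc_inv g) b'"
    using g by (simp add: row_act_def)
  also have "\<dots> = row_act d (mc_inv g \<star> g) (row_act d h b)"
    unfolding b'_eq using g by (intro row_act_mult[symmetric] bh) auto
  also have "\<dots> = row_act d h b" using g by (simp add: one_McLain row_act_one[OF bh])
  finally have "Poly_Mapping.lookup ((b' \<star> g) \<star> h) d
      = Poly_Mapping.lookup (b' \<star> g) d + Poly_Mapping.lookup (row_act d h b \<star> h) d"
    using lookup_mult_row[of "b' \<star> g" h d] g h b' McLain.m_closed by simp
  then show ?thesis
    using \<mu> unfolding row_coef_def b'_def[symmetric] b'_eq[symmetric]
    by (simp add: mc_assoc linear_char_def)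
qed

section \<open>The subgroups \<open>L\<close>, \<open>P\<close> and \<open>N\<close> and the induced
  module in coordinates\<close>

lemma closed_L_roots: "closed_roots (L_roots \<alpha> \<beta>)" and L_roots_subset_Phi: "L_roots \<alpha> \<beta> \<subseteq> Phi"
  and closed_P_roots: "closed_roots (P_roots \<alpha> \<beta>)" and P_roots_subset_Phi: "P_roots \<alpha> \<beta> \<subseteq> Phi"
  by (auto simp: closed_roots_def L_roots_def P_roots_def Phi_def)

lemma L_group_eq: "L_group \<alpha> \<beta> = supported (L_roots \<alpha> \<beta>)"
  unfolding L_group_def by (rule McLain_sub_eq_supported[OF closed_L_roots L_roots_subset_Phi])

lemma P_group_eq: "P_group \<alpha> \<beta> = supported (P_roots \<alpha> \<beta>)"
  unfolding P_group_def by (rule McLain_sub_eq_supported[OF closed_P_roots P_roots_subset_Phi])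

lemma P_roots_eq: "\<alpha> < \<beta> \<Longrightarrow> P_roots \<alpha> \<beta> = L_roots \<alpha> \<beta> - row_roots (\<alpha>, \<beta>)"
  by (auto simp: P_roots_def L_roots_def row_roots_def)

lemma row_subset_L_roots: "row_roots (\<alpha>, \<beta>) \<subseteq> L_roots \<alpha> \<beta>"
  by (auto simp: L_roots_def row_roots_def)

lemma restr_L_mult:
  "x \<in> carrier McLain \<Longrightarrow> y \<in> carrier McLain \<Longrightarrow>
    restr (L_roots \<alpha> \<beta>) (x \<star> y) = restr (L_roots \<alpha> \<beta>) x \<star> restr (L_roots \<alpha> \<beta>) y"
  by (rule restr_mult_hom[OF closed_L_roots]) (auto simp: L_roots_def)

lemma restr_L_hom:
  "group_hom McLain (McLain :: ('l::linorder \<times> 'l \<Rightarrow>\<^sub>0 'r::ring_1) monoid) (restr (L_roots \<alpha> \<beta>))"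
proof unfold_locales
  show "restr (L_roots \<alpha> \<beta>) \<in> hom McLain (McLain :: ('l \<times> 'l \<Rightarrow>\<^sub>0 'r) monoid)"
    by (rule homI) (auto simp: restr_L_mult carrier_McLain keys_restr)
qed

text \<open>Truncation to \<open>L_roots\<close> is a homomorphism that fixes \<open>L\<close> and
  kills the generators of \<open>N\<close>, hence their normal closure. Conversely, dividing
  \<open>g\<close> by its truncation leaves an element supported on the roots that generate
  \<open>N\<close>.\<close>

lemma L_proj_eq:
  fixes g :: "'l::linorder \<times> 'l \<Rightarrow>\<^sub>0 'r::ring_1"
  assumes g: "g \<in> carrier McLain"
  shows "L_proj \<alpha> \<beta> g = restr (L_roots \<alpha> \<beta>) g"
proof -
  let ?L = "L_roots \<alpha> \<beta>" and ?N = "{(\<gamma>, \<delta>) \<in> Phi. \<gamma> < \<alpha> \<or> \<delta> > \<beta>}"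
  interpret R: group_hom McLain "McLain :: ('l \<times> 'l \<Rightarrow>\<^sub>0 'r) monoid" "restr ?L" by (rule restr_L_hom)
  have ker: "restr ?L n = 0" if "n \<in> N_group \<alpha> \<beta>" for n :: "'l \<times> 'l \<Rightarrow>\<^sub>0 'r"
  proof -
    have "kernel McLain McLain (restr ?L) \<lhd> (McLain :: ('l \<times> 'l \<Rightarrow>\<^sub>0 'r) monoid)" by (rule R.normal_kernel)
    moreover have "(\<Union>a\<in>?N. root_group a) \<subseteq> kernel McLain (McLain :: ('l \<times> 'l \<Rightarrow>\<^sub>0 'r) monoid) (restr ?L)"
      by (auto simp: kernel_def root_group_def carrier_McLain one_McLain restr_eq_zero_iff L_roots_def split: if_splits)
    ultimately have "n \<in> kernel McLain McLain (restr ?L)"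
      using that unfolding N_group_def normal_closure_def by blast
    then show ?thesis by (simp add: kernel_def one_McLain)
  qed
  have N: "n \<in> N_group \<alpha> \<beta>" if "n \<in> supported ?N" for n :: "'l \<times> 'l \<Rightarrow>\<^sub>0 'r"
  proof -
    have n: "n \<in> McLain_sub ?N" using supported_subset_McLain_sub[of ?N] that by auto
    show ?thesis
      unfolding N_group_def normal_closure_def
    proof (intro InterI, elim CollectE conjE)
      fix M :: "('l \<times> 'l \<Rightarrow>\<^sub>0 'r) set" assume M: "M \<lhd> McLain" "(\<Union>a\<in>?N. root_group a) \<subseteq> M"
      show "n \<in> M"
        using McLain.generate_subgroup_incl[OF M(2) normal_imp_subgroup[OF M(1)]] n
        unfolding McLain_sub_def by blast
    qed
  qed
  let ?l = "restr ?L g"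
  have l: "?l \<in> supported ?L" by (auto simp: keys_restr)
  have lG: "?l \<in> carrier McLain" using g by (auto simp: keys_restr carrier_McLain)
  have "restr ?L (g \<star> mc_inv ?l) = 0"
    using g lG l R.hom_inv[OF lG]
    by (simp add: restr_L_mult restr_restr R.hom_inv one_McLain)
  moreover have "g \<star> mc_inv ?l \<in> supported Phi"
    using McLain.m_closed[OF g McLain.inv_closed[OF lG]] by (simp add: carrier_McLain)
  moreover have L: "Phi - ?L \<subseteq> ?N" by (auto simp: L_roots_def Phi_def)
  ultimately have "g \<star> mc_inv ?l \<in> supported ?N"
    using restr_eq_zero_iff[of ?L "g \<star> mc_inv ?l"] L by blast
  moreover have "g = (g \<star> mc_inv ?l) \<star> ?l"
    using lG by (simp add: mc_assoc one_McLain)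
  ultimately have ex: "\<exists>n\<in>N_group \<alpha> \<beta>. g = n \<star> ?l" using N by blast
  have uniq: "l' = ?l" if "l' \<in> L_group \<alpha> \<beta>" "n \<in> N_group \<alpha> \<beta>" "g = n \<star> l'" for l' n :: "'l \<times> 'l \<Rightarrow>\<^sub>0 'r"
  proof -
    have l': "l' \<in> supported ?L" using that by (simp add: L_group_eq)
    then have l'G: "l' \<in> carrier McLain" using supported_subset_carrier[OF L_roots_subset_Phi] by blast
    have "n = g \<star> mc_inv l'" using that(3) l'G by (simp add: mc_assoc one_McLain)
    then have "n \<in> carrier McLain" using g l'G by simp
    then have "restr ?L g = restr ?L n \<star> restr ?L l'" using that(3) l'G by (simp add: restr_L_mult)
    then show ?thesis using ker[OF that(2)] l' by (simp add: restr_id)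
  qed
  show ?thesis unfolding L_proj_def
    by (rule the_equality) (use ex l uniq in \<open>auto simp: L_group_eq\<close>)
qed

text \<open>The entry at (\<alpha>, \<beta>) is additive on \<open>P\<close>, because (\<alpha>,
  \<beta>) is the only position of \<open>P_roots\<close> in row \<alpha>. Uniqueness holds since
  every element of \<open>P\<close> is a product of root elements, where the values are
  prescribed.\<close>

lemma P_char_eq:
  fixes \<mu> :: "'r::ring_1 \<Rightarrow> 'f::field"
  assumes "\<alpha> < \<beta>" and \<mu>: "linear_char \<mu>"
  shows "P_char \<alpha> \<beta> \<mu> = (\<lambda>p\<in>P_group \<alpha> \<beta>. \<mu> (Poly_Mapping.lookup p (\<alpha>, \<beta>)))"
  unfolding P_char_def
proof (rule the_equality)
  let ?\<chi> = "\<lambda>p\<in>P_group \<alpha> \<beta>. \<mu> (Poly_Mapping.lookup p (\<alpha>, \<beta>))"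
  have mem: "Poly_Mapping.single a r \<in> P_group \<alpha> \<beta>" if "a \<in> P_roots \<alpha> \<beta>" for a and r :: 'r
    using that by (simp add: P_group_eq)
  have ab: "(\<alpha>, \<beta>) \<in> P_roots \<alpha> \<beta>" using assms(1) by (auto simp: P_roots_def)
  have mult: "p \<star> q \<in> P_group \<alpha> \<beta>" if "p \<in> P_group \<alpha> \<beta>" "q \<in> P_group \<alpha> \<beta>" for p q :: "'a \<times> 'a \<Rightarrow>\<^sub>0 'r"
    using supported_mult[OF closed_P_roots] that unfolding P_group_eq by blast
  have look: "Poly_Mapping.lookup (p \<star> q) (\<alpha>, \<beta>) = Poly_Mapping.lookup p (\<alpha>, \<beta>) + Poly_Mapping.lookup q (\<alpha>, \<beta>)"
    if "p \<in> P_group \<alpha> \<beta>" "q \<in> P_group \<alpha> \<beta>" for p q :: "'a \<times> 'a \<Rightarrow>\<^sub>0 'r"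
    by (rule lookup_mult_eq_add) (use that in \<open>unfold P_group_eq, auto simp: P_roots_def\<close>)
  show "is_P_char \<alpha> \<beta> \<mu> ?\<chi>"
    unfolding is_P_char_def
    using \<mu> linear_char_zero[OF \<mu>] ab
    by (auto simp: mem mult look linear_char_def lookup_single when_def)
  fix \<chi> assume \<chi>: "is_P_char \<alpha> \<beta> \<mu> \<chi>"
  show "\<chi> = ?\<chi>"
  proof (rule extensionalityI)
    show "\<chi> \<in> extensional (P_group \<alpha> \<beta>)" using \<chi> by (simp add: is_P_char_def)
    show "?\<chi> \<in> extensional (P_group \<alpha> \<beta>)" by simp
    fix p :: "'a \<times> 'a \<Rightarrow>\<^sub>0 'r" assume "p \<in> P_group \<alpha> \<beta>"
    then have "p \<in> supported (P_roots \<alpha> \<beta>)" by (simp add: P_group_eq)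
    then have "\<chi> p = \<mu> (Poly_Mapping.lookup p (\<alpha>, \<beta>))"
      using P_roots_subset_Phi
    proof (induct rule: supported_induct)
      case zero
      have "\<chi> (Poly_Mapping.single (\<alpha>, \<beta>) 0) = \<mu> 0" using \<chi> unfolding is_P_char_def by blast
      then show ?case by simp
    next
      case (mult k r y)
      have k: "Poly_Mapping.single k r \<in> P_group \<alpha> \<beta>" and y: "y \<in> P_group \<alpha> \<beta>"
        using mem[OF mult(1)] mult(2) by (auto simp: P_group_eq)
      have "\<chi> (Poly_Mapping.single k r \<star> y) = \<chi> (Poly_Mapping.single k r) * \<chi> y"
        using \<chi> k y unfolding is_P_char_def by blast
      also have "\<chi> (Poly_Mapping.single k r) = \<mu> (Poly_Mapping.lookup (Poly_Mapping.single k r) (\<alpha>, \<beta>))"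
        using \<chi> mult(1) linear_char_zero[OF \<mu>] unfolding is_P_char_def
        by (cases "k = (\<alpha>, \<beta>)") (auto simp: lookup_single when_def)
      finally show ?case using mult(3) look[OF k y] \<mu> by (simp add: linear_char_def)
    qed
    then show "\<chi> p = ?\<chi> p" using \<open>p \<in> P_group \<alpha> \<beta>\<close> by simp
  qed
qed

text \<open>Cosets of \<open>P\<close> are represented by inverses of rows. For \<open>g\<close> in
  \<open>L\<close> the element \<open>\<kappa> g \<star> g\<close> has empty truncated row and so
  lies in \<open>P\<close>; this gives both the coset decomposition and the scalar.\<close>

lemma elem_module_coordinates:
  fixes \<mu> :: "'r::ring_1 \<Rightarrow> 'f::field" and \<alpha> \<beta> :: "'l::linorder"
  assumes "\<alpha> < \<beta>" and \<mu>: "linear_char \<mu>"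
  shows "\<exists>T. coordinates (elem_module \<alpha> \<beta> \<mu>) (supported (row_roots (\<alpha>, \<beta>))) T \<and>
    (\<forall>g\<in>carrier McLain. \<forall>x\<in>carrier (elem_module \<alpha> \<beta> \<mu>).
      act (elem_module \<alpha> \<beta> \<mu>) g x \<in> carrier (elem_module \<alpha> \<beta> \<mu>) \<and>
      T (act (elem_module \<alpha> \<beta> \<mu>) g x)
      = lext (\<lambda>b. Poly_Mapping.single (row_act (\<alpha>, \<beta>) g b) (row_coef (\<alpha>, \<beta>) \<mu> g b)) (T x))"
proof -
  let ?d = "(\<alpha>, \<beta>)" and ?G = "McLain\<lparr>carrier := L_group \<alpha> \<beta>\<rparr> :: ('l \<times> 'l \<Rightarrow>\<^sub>0 'r) monoid"
  let ?L = "L_roots \<alpha> \<beta>" and ?P = "P_roots \<alpha> \<beta>"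
  define \<kappa> where "\<kappa> g = restr (row_roots ?d) (mc_inv g)" for g :: "'l \<times> 'l \<Rightarrow>\<^sub>0 'r"
  define coef where "coef g = \<mu> (Poly_Mapping.lookup (\<kappa> g \<star> g) ?d)" for g
  have \<kappa>: "\<kappa> g \<in> supported (row_roots ?d)" "\<kappa> g \<in> carrier McLain" "\<kappa> g \<in> supported ?L" for g
    using row_subset_L_roots[of \<alpha> \<beta>] row_subset_Phi[of ?d] by (auto simp: \<kappa>_def keys_restr carrier_McLain)
  have sub: "subgroup (supported ?L) (McLain :: ('l \<times> 'l \<Rightarrow>\<^sub>0 'r) monoid)"
    "subgroup (supported ?P) (McLain :: ('l \<times> 'l \<Rightarrow>\<^sub>0 'r) monoid)"
    by (rule subgroup_supported[OF closed_L_roots L_roots_subset_Phi]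
        subgroup_supported[OF closed_P_roots P_roots_subset_Phi])+
  have LG: "g \<in> carrier McLain" if "g \<in> supported ?L" for g :: "'l \<times> 'l \<Rightarrow>\<^sub>0 'r"
    using that subgroup.mem_carrier[OF sub(1)] by blast
  have P_iff: "p \<in> supported ?P \<longleftrightarrow> p \<in> supported ?L \<and> restr (row_roots ?d) p = 0" for p :: "'l \<times> 'l \<Rightarrow>\<^sub>0 'r"
    unfolding P_roots_eq[OF assms(1)] by (auto simp: restr_eq_zero_iff)
  have \<kappa>_row_act: "\<kappa> (g \<star> mc_inv b) = row_act ?d g b" if "g \<in> carrier McLain" "b \<in> supported (row_roots ?d)" for g b
    using that supported_row_carrier[OF that(2)] by (simp add: \<kappa>_def row_act_def McLain.inv_mult_group)
  have \<chi>: "P_char \<alpha> \<beta> \<mu> h = \<mu> (Poly_Mapping.lookup h ?d)" if "h \<in> supported ?P" for h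
    using that by (simp add: P_char_eq[OF assms] P_group_eq)
  have \<kappa>0: "restr (row_roots ?d) (\<kappa> g \<star> g) = 0" if "g \<in> carrier McLain" for g
  proof -
    have "restr (row_roots ?d) (\<kappa> g \<star> g) = restr (row_roots ?d) (mc_inv g \<star> g)"
      unfolding \<kappa>_def by (rule restr_mult_left) (use that in \<open>auto intro: row_initial\<close>)
    then show ?thesis using that by (simp add: one_McLain)
  qed
  have rowL: "b \<in> supported ?L" if "b \<in> supported (row_roots ?d)" for b :: "'l \<times> 'l \<Rightarrow>\<^sub>0 'r"
    using that row_subset_L_roots[of \<alpha> \<beta>] by auto
  have "\<exists>T. coordinates (induced ?G (supported ?P) (line (P_char \<alpha> \<beta> \<mu>))) (supported (row_roots ?d)) T \<and>
    (\<forall>g\<in>carrier ?G. \<forall>x\<in>carrier (induced ?G (supported ?P) (line (P_char \<alpha> \<beta> \<mu>))).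
      act (induced ?G (supported ?P) (line (P_char \<alpha> \<beta> \<mu>))) g x \<in> carrier (induced ?G (supported ?P) (line (P_char \<alpha> \<beta> \<mu>))) \<and>
      T (act (induced ?G (supported ?P) (line (P_char \<alpha> \<beta> \<mu>))) g x)
      = lext (\<lambda>b. Poly_Mapping.single (\<kappa> (g \<otimes>\<^bsub>?G\<^esub> mc_inv b)) (coef (g \<otimes>\<^bsub>?G\<^esub> mc_inv b))) (T x))"
  proof (rule induced_line_coordinates)
    show "group ?G" using McLain.subgroup_imp_group[OF sub(1)] by (simp add: L_group_eq)
    show "supported ?P \<subseteq> carrier ?G" using P_iff by (auto simp: L_group_eq)
    show "\<one>\<^bsub>?G\<^esub> \<in> supported ?P" by (simp add: one_McLain)
    show "P_char \<alpha> \<beta> \<mu> \<one>\<^bsub>?G\<^esub> = 1" using \<chi>[of 0] linear_char_zero[OF \<mu>] by (simp add: one_McLain)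
    show "\<kappa> g \<in> supported (row_roots ?d)" for g by (rule \<kappa>(1))
  next
    fix b :: "'l \<times> 'l \<Rightarrow>\<^sub>0 'r" assume b: "b \<in> supported (row_roots ?d)"
    have bG: "b \<in> carrier McLain" by (rule supported_row_carrier[OF b])
    show "mc_inv b \<in> carrier ?G"
      using subgroup.m_inv_closed[OF sub(1) rowL[OF b]] by (simp add: L_group_eq)
    show k: "\<kappa> (mc_inv b) = b" using b bG by (simp add: \<kappa>_def restr_id)
    show "coef (mc_inv b) = 1" using bG linear_char_zero[OF \<mu>] by (simp add: coef_def k one_McLain)
  next
    fix g h :: "'l \<times> 'l \<Rightarrow>\<^sub>0 'r" assume g: "g \<in> carrier ?G" and h: "h \<in> supported ?P"
    have gG: "g \<in> carrier McLain" using g LG by (simp add: L_group_eq)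
    have hG: "h \<in> carrier McLain" using h subgroup.mem_carrier[OF sub(2)] by blast
    have h0: "restr (row_roots ?d) (mc_inv h) = 0" using P_iff subgroup.m_inv_closed[OF sub(2) h] by blast
    \<comment> \<open>The inverse of \<open>h\<close> has empty truncated row, so the label depends
      on \<open>g\<close> alone.\<close>
    have "\<kappa> (g \<star> h) = row_act ?d g (restr (row_roots ?d) (mc_inv h))"
      using gG hG by (simp add: \<kappa>_def McLain.inv_mult_group row_act_restr)
    then show k: "\<kappa> (g \<otimes>\<^bsub>?G\<^esub> h) = \<kappa> g" by (simp add: h0 \<kappa>_def row_act_def)
    have "Poly_Mapping.lookup ((\<kappa> g \<star> g) \<star> h) ?d = Poly_Mapping.lookup (\<kappa> g \<star> g) ?d + Poly_Mapping.lookup h ?d"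
      using lookup_mult_row[of "\<kappa> g \<star> g" h ?d] McLain.m_closed[OF \<kappa>(2) gG] hG \<kappa>0[OF gG] by simp
    then show "coef (g \<otimes>\<^bsub>?G\<^esub> h) = coef g * P_char \<alpha> \<beta> \<mu> h"
      using k \<chi>[OF h] \<mu> by (simp add: coef_def linear_char_def mc_assoc)
  next
    fix g assume g: "g \<in> carrier ?G"
    then have gL: "g \<in> supported ?L" by (simp add: L_group_eq)
    show "\<exists>h\<in>supported ?P. g = mc_inv (\<kappa> g) \<otimes>\<^bsub>?G\<^esub> h"
    proof (rule bexI[of _ "\<kappa> g \<star> g"])
      show "g = mc_inv (\<kappa> g) \<otimes>\<^bsub>?G\<^esub> (\<kappa> g \<star> g)" using \<kappa>(2) by (simp add: mc_cancel)
      show "\<kappa> g \<star> g \<in> supported ?P"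
        using P_iff \<kappa>0[OF LG[OF gL]] supported_mult[OF closed_L_roots \<kappa>(3) gL] by blast
    qed
  qed
  then obtain T where T: "coordinates (induced ?G (P_group \<alpha> \<beta>) (line (P_char \<alpha> \<beta> \<mu>))) (supported (row_roots ?d)) T"
    and act: "\<And>g x. g \<in> supported ?L \<Longrightarrow> x \<in> carrier (induced ?G (P_group \<alpha> \<beta>) (line (P_char \<alpha> \<beta> \<mu>))) \<Longrightarrow>
      act (induced ?G (P_group \<alpha> \<beta>) (line (P_char \<alpha> \<beta> \<mu>))) g x \<in> carrier (induced ?G (P_group \<alpha> \<beta>) (line (P_char \<alpha> \<beta> \<mu>))) \<and>
      T (act (induced ?G (P_group \<alpha> \<beta>) (line (P_char \<alpha> \<beta> \<mu>))) g x)
      = lext (\<lambda>b. Poly_Mapping.single (\<kappa> (g \<star> mc_inv b)) (coef (g \<star> mc_inv b))) (T x)"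
    unfolding P_group_eq by (auto simp: L_group_eq)
  \<comment> \<open>Replacing \<open>g\<close> by its projection to \<open>L\<close> changes neither
    label nor scalar, since truncation to \<open>L_roots\<close> is a homomorphism and both are read
    off at positions of \<open>L_roots\<close>.\<close>
  have label: "\<kappa> (restr ?L g \<star> mc_inv b) = row_act ?d g b" "coef (restr ?L g \<star> mc_inv b) = row_coef ?d \<mu> g b"
    if g: "g \<in> carrier McLain" and b: "b \<in> supported (row_roots ?d)" for g b
  proof -
    let ?l = "restr ?L g"
    have bG: "b \<in> carrier McLain" by (rule supported_row_carrier[OF b])
    have lL: "?l \<in> supported ?L" by (auto simp: keys_restr)
    have lG: "?l \<in> carrier McLain" using LG[OF lL] .
    have Lb: "restr ?L x = x" if "x \<in> supported (row_roots ?d)" for x :: "'l \<times> 'l \<Rightarrow>\<^sub>0 'r"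
      using rowL[OF that] by (simp add: restr_id)
    have "restr ?L (b \<star> mc_inv g) = b \<star> mc_inv ?l"
      using g bG b group_hom.hom_inv[OF restr_L_hom g, of \<alpha> \<beta>] by (simp add: restr_L_mult Lb)
    then have "row_act ?d ?l b = restr (row_roots ?d) (restr ?L (b \<star> mc_inv g))"
      by (simp add: row_act_def)
    also have "\<dots> = row_act ?d g b"
      using row_subset_L_roots[of \<alpha> \<beta>] by (simp add: restr_restr row_act_def inf.absorb1)
    finally have ra: "row_act ?d ?l b = row_act ?d g b" .
    show k: "\<kappa> (?l \<star> mc_inv b) = row_act ?d g b" using \<kappa>_row_act[OF lG b] ra by simp
    let ?b = "row_act ?d g b"
    have b': "?b \<in> supported (row_roots ?d)" by (rule row_act_closed)
    have "mc_inv b \<in> supported (row_roots ?d)"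
      by (rule subgroup.m_inv_closed[OF subgroup_supported[OF closed_row row_subset_Phi] b])
    then have ib: "Poly_Mapping.lookup (mc_inv b) ?d = 0" "\<And>\<gamma>. (\<gamma>, \<beta>) \<notin> Poly_Mapping.keys (mc_inv b)"
      by (auto simp: row_roots_def subset_iff simp flip: not_in_keys_iff_lookup_eq_zero)
    \<comment> \<open>The inverse of \<open>b\<close> has no entry in column \<beta>, so it leaves
      the entry at (\<alpha>, \<beta>) alone.\<close>
    have "Poly_Mapping.lookup (?b \<star> (?l \<star> mc_inv b)) ?d = Poly_Mapping.lookup (?b \<star> ?l) ?d"
      unfolding mc_assoc[symmetric] using ib by (subst lookup_mult_eq_add) auto
    also have "\<dots> = Poly_Mapping.lookup (restr ?L (?b \<star> g)) ?d"
      using g supported_row_carrier[OF b'] b' by (simp add: restr_L_mult Lb)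
    also have "\<dots> = Poly_Mapping.lookup (?b \<star> g) ?d"
      using assms(1) by (simp add: lookup_restr L_roots_def)
    finally show "coef (?l \<star> mc_inv b) = row_coef ?d \<mu> g b" by (simp add: coef_def row_coef_def k)
  qed
  have E: "elem_module \<alpha> \<beta> \<mu> = (induced ?G (P_group \<alpha> \<beta>) (line (P_char \<alpha> \<beta> \<mu>)))
    \<lparr>act := (\<lambda>g. act (induced ?G (P_group \<alpha> \<beta>) (line (P_char \<alpha> \<beta> \<mu>))) (L_proj \<alpha> \<beta> g))\<rparr>"
    by (simp add: elem_module_def Let_def)
  show ?thesis
  proof (intro exI conjI ballI)
    show "coordinates (elem_module \<alpha> \<beta> \<mu>) (supported (row_roots ?d)) T"
      using T unfolding E coordinates_def by simp
    fix g :: "'l \<times> 'l \<Rightarrow>\<^sub>0 'r" and x assume g: "g \<in> carrier McLain" and "x \<in> carrier (elem_module \<alpha> \<beta> \<mu>)"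
    then have x: "x \<in> carrier (induced ?G (P_group \<alpha> \<beta>) (line (P_char \<alpha> \<beta> \<mu>)))" by (simp add: E)
    have l: "restr ?L g \<in> supported ?L" by (auto simp: keys_restr)
    note a = act[OF l x]
    show "act (elem_module \<alpha> \<beta> \<mu>) g x \<in> carrier (elem_module \<alpha> \<beta> \<mu>)"
      using a by (simp add: E L_proj_eq[OF g])
    have "T x \<in> supported (supported (row_roots ?d))" by (rule coordinates.T_closed[OF T x])
    then show "T (act (elem_module \<alpha> \<beta> \<mu>) g x)
      = lext (\<lambda>b. Poly_Mapping.single (row_act ?d g b) (row_coef ?d \<mu> g b)) (T x)"
      using a label[OF g] by (auto simp: E L_proj_eq[OF g] intro!: lext_cong)
  qed
qed

section \<open>Basic modules\<close>

lemma finite_Omega: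
  assumes "finite D"
  shows "finite (Omega D)"
  by (rule finite_subset[of _ "fst ` D \<times> fst ` D"]) (use assms in \<open>force simp: Omega_def\<close>)+

lemma Gamma_eq: "Gamma D = Phi - (\<Union>d\<in>D. row_roots d)"
  by (force simp: Gamma_def row_roots_def Phi_def)

lemma Omega_subset_rows: "Omega D \<subseteq> (\<Union>d\<in>D. row_roots d)"
  by (force simp: Omega_def row_roots_def)

lemma Omega_subset_Phi: "Omega D \<subseteq> Phi"
  by (auto simp: Omega_def)

text \<open>As first indices are distinct, \<open>d\<close> is the only root of \<open>D\<close>
  starting at \<open>fst d\<close>, and the choice of \<beta> in the definition disappears.\<close>

lemma Omega_iff_row:
  assumes "inj_on fst D" "d \<in> D"
  shows "(fst d, \<gamma>) \<in> Omega D \<longleftrightarrow> (fst d, \<gamma>) \<in> row_roots d \<and> (\<exists>\<delta>. (\<gamma>, \<delta>) \<in> D \<and> snd d < \<delta>)"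
proof -
  obtain \<alpha> \<beta> where d: "d = (\<alpha>, \<beta>)" by (cases d)
  have "\<beta>' = \<beta>" if "(\<alpha>, \<beta>') \<in> D" for \<beta>'
    using inj_onD[OF assms(1) _ that assms(2)] d by simp
  then have "(\<alpha>, \<beta>') \<in> D \<longleftrightarrow> \<beta>' = \<beta>" for \<beta>' using assms(2) d by blast
  then show ?thesis unfolding d by (auto simp: Omega_def row_roots_def Phi_def)
qed

text \<open>The removed part of a row is an initial segment: if (a, c) were removed, so would be (a,
  b).\<close>

lemma closed_Gamma: "closed_roots (Gamma D)"
proof -
  have "(a, c) \<in> Gamma D" if "(a, b) \<in> Gamma D" "(b, c) \<in> Gamma D" for a b c
  proof -
    have "a < b" "b < c" using that by (auto simp: Gamma_eq Phi_def)
    then show ?thesis using that row_initial by (fastforce simp: Gamma_eq Phi_def)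
  qed
  then show ?thesis unfolding closed_roots_def by blast
qed

text \<open>Let (a, c) lie in a removed row. Then so does (a, b), which therefore is in
  \<open>Omega D\<close> and yields a root (b, \<delta>) of \<open>D\<close> ending further right.
  Now (b, c) lies in the row of that root, hence in \<open>Omega D\<close>, and yields a root (c,
  \<epsilon>) ending further right still; this puts (a, c) into \<open>Omega D\<close>.\<close>

lemma closed_Gamma_Omega:
  assumes "inj_on fst D"
  shows "closed_roots (Gamma D \<union> Omega D)"
proof -
  have "(a, c) \<in> Gamma D \<union> Omega D"
    if ab: "(a, b) \<in> Gamma D \<union> Omega D" and bc: "(b, c) \<in> Gamma D \<union> Omega D" for a b c
  proof (cases "(a, c) \<in> (\<Union>d\<in>D. row_roots d)")
    case False
    have "a < b" "b < c" using that Omega_subset_Phi by (auto simp: Gamma_eq Phi_def)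
    then show ?thesis using False by (auto simp: Gamma_eq Phi_def)
  next
    case True
    have lt: "a < b" "b < c" using that Omega_subset_Phi by (auto simp: Gamma_eq Phi_def)
    from True obtain d where d: "d \<in> D" "(a, c) \<in> row_roots d" by blast
    then have a: "a = fst d" by (auto simp: row_roots_def)
    have "(a, b) \<in> row_roots d" using row_initial d(2) lt by blast
    then have "(a, b) \<in> Omega D" using ab d(1) by (auto simp: Gamma_eq)
    then obtain \<delta> where \<delta>: "(b, \<delta>) \<in> D" "snd d < \<delta>" using Omega_iff_row[OF assms d(1)] a by auto
    have "(b, c) \<in> row_roots (b, \<delta>)" using lt d(2) \<delta> by (auto simp: row_roots_def)
    then have "(b, c) \<in> Omega D" using bc \<delta>(1) by (auto simp: Gamma_eq)
    then obtain \<epsilon> where "(c, \<epsilon>) \<in> D" "\<delta> < \<epsilon>" using Omega_iff_row[OF assms \<delta>(1)] by auto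
    then have "(a, c) \<in> Omega D"
      using Omega_iff_row[OF assms d(1), of c] d(2) a \<delta>(2) by (auto intro: less_trans)
    then show ?thesis by simp
  qed
  then show ?thesis unfolding closed_roots_def by blast
qed

section \<open>Cosets of \<open>H\<close> in \<open>I\<close>\<close>

lemma H_group_eq: "H_group D = supported (Gamma D)"
  unfolding H_group_def by (rule McLain_sub_eq_supported[OF closed_Gamma]) (auto simp: Gamma_def)

lemma I_group_eq: "inj_on fst D \<Longrightarrow> I_group D = supported (Gamma D \<union> Omega D)"
  unfolding I_group_def using Omega_subset_Phi
  by (intro McLain_sub_eq_supported[OF closed_Gamma_Omega]) (auto simp: Gamma_def)

text \<open>Rows of different members of \<open>D\<close> are disjoint because their first indices
  differ. A label tuple and the single matrix holding all its rows thus carry the same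
  information.\<close>

lemma restr_row_sum:
  assumes "finite D" "inj_on fst D" "d \<in> D" and u: "\<And>e. e \<in> D \<Longrightarrow> u e \<in> supported (row_roots e)"
  shows "restr (row_roots d) (\<Sum>e\<in>D. u e) = u d"
proof (rule poly_mapping_eqI)
  fix k
  show "Poly_Mapping.lookup (restr (row_roots d) (\<Sum>e\<in>D. u e)) k = Poly_Mapping.lookup (u d) k"
  proof (cases "k \<in> row_roots d")
    case True
    have "Poly_Mapping.lookup (u e) k = (if e = d then Poly_Mapping.lookup (u d) k else 0)" if "e \<in> D" for e
    proof (cases "e = d")
      case False
      then have "fst e \<noteq> fst d" using assms(2,3) that by (auto dest: inj_onD)
      then have "k \<notin> row_roots e" using True by (auto simp: row_roots_def)
      then show ?thesis using u[OF that] False by (auto simp flip: not_in_keys_iff_lookup_eq_zero)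
    qed simp
    then have "(\<Sum>e\<in>D. Poly_Mapping.lookup (u e) k) = (\<Sum>e\<in>D. if e = d then Poly_Mapping.lookup (u d) k else 0)"
      by (rule sum.cong[OF refl])
    then show ?thesis using True assms(1,3) by (simp add: lookup_restr lookup_sum)
  next
    case False
    then have "k \<notin> Poly_Mapping.keys (u d)" using u[OF assms(3)] by blast
    then show ?thesis using False by (simp add: lookup_restr in_keys_iff)
  qed
qed

text \<open>\<open>H\<close> consists of the elements whose truncation to all rows of
  \<open>D\<close> vanishes, so this truncation is constant on a right coset H x. On
  \<open>I\<close> its values are supported on \<open>Omega D\<close>, and each such value is the
  truncation of itself.\<close>

lemma coset_index_eq:
  fixes D :: "('l::linorder \<times> 'l) set"
  assumes "inj_on fst D"
  shows "|supported (Omega D) :: ('l \<times> 'l \<Rightarrow>\<^sub>0 'r::ring_1) set|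
    =o coset_index (McLain :: ('l \<times> 'l \<Rightarrow>\<^sub>0 'r) monoid) (I_group D) (H_group D)"
proof -
  let ?\<Delta> = "\<Union>d\<in>D. row_roots d" and ?Om = "supported (Omega D) :: ('l \<times> 'l \<Rightarrow>\<^sub>0 'r) set"
  let ?I = "I_group D :: ('l \<times> 'l \<Rightarrow>\<^sub>0 'r) set" and ?H = "H_group D :: ('l \<times> 'l \<Rightarrow>\<^sub>0 'r) set"
  let ?F = "\<lambda>x. ?H #>\<^bsub>McLain\<^esub> x"
  have initial: "(a, b) \<in> ?\<Delta>" if "(a, c) \<in> ?\<Delta>" "a < b" "b < c" for a b c
    using that row_initial by blast
  have H: "subgroup ?H McLain" unfolding H_group_eq
    by (rule subgroup_supported[OF closed_Gamma]) (auto simp: Gamma_def)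
  have I: "subgroup ?I McLain" unfolding I_group_eq[OF assms]
    by (rule subgroup_supported[OF closed_Gamma_Omega[OF assms]])
      (use Omega_subset_Phi in \<open>auto simp: Gamma_def\<close>)
  have H_iff: "x \<in> ?H \<longleftrightarrow> x \<in> carrier McLain \<and> restr ?\<Delta> x = 0" for x
    by (auto simp: H_group_eq Gamma_eq restr_eq_zero_iff carrier_McLain)
  have Om_I: "x \<in> ?I" if "x \<in> ?Om" for x using that by (auto simp: I_group_eq[OF assms])
  have Om_restr: "restr ?\<Delta> x = x" if "x \<in> ?Om" for x
    using that Omega_subset_rows[of D] by (intro restr_id) auto
  have "bij_betw ?F ?Om (?F ` ?I)"
    unfolding bij_betw_def
  proof
    show "inj_on ?F ?Om"
    proof (rule inj_onI)
      fix x x' assume x: "x \<in> ?Om" "x' \<in> ?Om" and eq: "?F x = ?F x'"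
      have xG: "x \<in> carrier McLain" "x' \<in> carrier McLain"
        using x Om_I subgroup.mem_carrier[OF I] by blast+
      have "x \<in> ?F x'" unfolding eq[symmetric] by (rule McLain.rcos_self[OF xG(1) H])
      then obtain h where h: "h \<in> ?H" "x = h \<star> x'" by (auto simp: r_coset_def)
      then have "restr ?\<Delta> x = restr ?\<Delta> (restr ?\<Delta> h \<star> x')"
        using H_iff xG initial by (subst restr_mult_left) auto
      then show "x = x'" using h(1) H_iff Om_restr x by simp
    qed
    show "?F ` ?Om = ?F ` ?I"
    proof
      show "?F ` ?Om \<subseteq> ?F ` ?I" using Om_I by blast
      show "?F ` ?I \<subseteq> ?F ` ?Om"
      proof
        fix C assume "C \<in> ?F ` ?I"
        then obtain g where g: "g \<in> ?I" "C = ?F g" by blast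
        define x where "x = restr ?\<Delta> g"
        have x: "x \<in> ?Om" using g(1) by (auto simp: x_def keys_restr I_group_eq[OF assms] Gamma_eq)
        have G: "g \<in> carrier McLain" "x \<in> carrier McLain"
          using g x Om_I subgroup.mem_carrier[OF I] by blast+
        \<comment> \<open>Truncated products do not distinguish \<open>g\<close> from its truncation
          \<open>x\<close>, so g x^-1 truncates like x x^-1, that is, to 0.\<close>
        have "restr ?\<Delta> (g \<star> mc_inv x) = restr ?\<Delta> (x \<star> mc_inv x)"
          unfolding x_def using G initial unfolding x_def by (intro restr_mult_left[symmetric]) auto
        then have "g \<star> mc_inv x \<in> ?H" using G by (simp add: H_iff one_McLain)
        moreover have "g = (g \<star> mc_inv x) \<star> x" using G by (simp add: mc_assoc one_McLain)
        ultimately have "g \<in> ?F x" unfolding r_coset_def by blast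
        then have "?F x = ?F g" by (rule McLain.repr_independence[OF _ G(2) H])
        then show "C \<in> ?F ` ?Om" using x g(2) by blast
      qed
    qed
  qed
  moreover have "?F ` ?I = rcosets\<^bsub>McLain\<lparr>carrier := ?I\<rparr>\<^esub> ?H"
    by (auto simp: RCOSETS_def r_coset_def)
  ultimately show ?thesis unfolding coset_index_def using card_of_ordIsoI by metis
qed

text \<open>On a finite set every function is finitely supported; \<open>Func S UNIV\<close> is the
  set whose cardinal is the power \<open>^c\<close>, also over an infinite base.\<close>

lemma card_supported:
  assumes "finite S"
  shows "|supported S :: ('a \<Rightarrow>\<^sub>0 'r::comm_monoid_add) set| =o |UNIV :: 'r set| ^c |S|"
proof -
  let ?F = "\<lambda>x :: 'a \<Rightarrow>\<^sub>0 'r. \<lambda>k\<in>S. Poly_Mapping.lookup x k"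
  let ?G = "\<lambda>g. \<Sum>k\<in>S. Poly_Mapping.single k (g k :: 'r)"
  have look: "Poly_Mapping.lookup (?G g) k = (if k \<in> S then g k else 0)" for g k
    using assms by (simp add: lookup_sum lookup_single when_def)
  have "bij_betw ?F (supported S) (Func S UNIV)"
  proof (rule bij_betw_byWitness[of _ ?G])
    show "\<forall>x\<in>supported S. ?G (?F x) = x"
      by (auto intro!: poly_mapping_eqI simp: look simp flip: not_in_keys_iff_lookup_eq_zero)
    show "\<forall>g\<in>Func S UNIV. ?F (?G g) = g"
      by (auto simp: Func_def look fun_eq_iff)
    show "?F ` supported S \<subseteq> Func S UNIV" by (auto simp: Func_def)
    show "?G ` Func S UNIV \<subseteq> supported S" by (auto simp: in_keys_iff look split: if_splits)
  qed
  then show ?thesis unfolding cexp_def Field_card_of by (rule card_of_ordIsoI)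
qed

text \<open>The multiples \<open>a * r\<close> form a right ideal, non-zero since it contains a = a
  1, so it is not contained in the kernel.\<close>

lemma right_primitive_witness:
  assumes "right_primitive \<mu>" "a \<noteq> 0"
  obtains r where "\<mu> (a * r) \<noteq> 1"
proof -
  let ?A = "{a * r | r. True}"
  have "right_ideal ?A"
    unfolding right_ideal_def
    by (auto simp: mult.assoc simp flip: distrib_left mult_minus_right intro: exI[of _ 0])
  moreover have "a \<in> ?A" by (auto intro: exI[of _ 1])
  ultimately have "\<not> ?A \<subseteq> {r. \<mu> r = 1}" using assms unfolding right_primitive_def by blast
  then show ?thesis using that by auto
qed

section \<open>Elements of \<open>H\<close> acting on labels\<close>

lemma lookup_mult_single:
  "Poly_Mapping.lookup (x \<star> Poly_Mapping.single (\<gamma>, \<beta>) r) (a, \<beta>)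
    = Poly_Mapping.lookup x (a, \<beta>) + (if a = \<gamma> then r else 0) + Poly_Mapping.lookup x (a, \<gamma>) * r"
proof -
  let ?C = "insert \<gamma> (snd ` Poly_Mapping.keys x)"
  have "(\<Sum>b\<in>?C. Poly_Mapping.lookup x (a, b) * Poly_Mapping.lookup (Poly_Mapping.single (\<gamma>, \<beta>) r) (b, \<beta>))
    = (\<Sum>b\<in>?C. if b = \<gamma> then Poly_Mapping.lookup x (a, \<gamma>) * r else 0)"
    by (rule sum.cong) (auto simp: lookup_single when_def)
  then show ?thesis
    by (subst lookup_mult[of ?C]) (auto simp: lookup_single when_def)
qed

text \<open>By definition the action on the zero label shows the row of the inverse of
  \<open>h\<close>; as stabilisers are closed under inversion, the row of \<open>h\<close> vanishes
  as well.\<close>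

lemma stabilizer_row:
  assumes "h \<in> carrier McLain" "row_act d h 0 = 0"
  shows "restr (row_roots d) h = 0" "restr (row_roots d) (mc_inv h) = 0"
proof -
  show "restr (row_roots d) (mc_inv h) = 0" using assms(2) by (simp add: row_act_def)
  have "row_act d (mc_inv h) 0 = row_act d (mc_inv h) (row_act d h 0)" using assms(2) by simp
  also have "\<dots> = row_act d (mc_inv h \<star> h) 0" using assms(1) by (intro row_act_mult[symmetric]) auto
  also have "\<dots> = 0" using assms(1) by (simp add: one_McLain row_act_one)
  finally show "restr (row_roots d) h = 0" using assms(1) by (simp add: row_act_def)
qed

text \<open>An entry of \<open>b\<close> at (fst d, \<delta>) meets row \<delta> of \<open>h\<close>
  or of its inverse. By the choice of \<open>Omega D\<close> some (\<delta>, \<epsilon>) in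
  \<open>D\<close> has \<epsilon> beyond \<open>snd d\<close>, and since \<open>h\<close> stabilises
  the zero label of that factor, row \<delta> is empty before column \<epsilon>.\<close>

lemma row_fixed:
  assumes D: "inj_on fst D" "d \<in> D" and h: "h \<in> carrier McLain" "\<And>e. e \<in> D \<Longrightarrow> row_act e h 0 = 0"
    and b: "b \<in> supported (row_roots d)" "b \<in> supported (Omega D)"
  shows "row_act d h b = b" "row_coef d \<mu> h b = row_coef d \<mu> h 0"
proof -
  \<comment> \<open>The bound includes \<gamma> = \<open>snd d\<close>, the column from which the
    scalar is read; this uses the strict inequality between the ends in
    \<open>Omega\<close>.\<close>
  have clash: "(\<delta>, \<gamma>) \<notin> Poly_Mapping.keys k"
    if "(fst d, \<delta>) \<in> Poly_Mapping.keys b" "\<gamma> \<le> snd d" "k \<in> carrier McLain"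
      "\<And>e. e \<in> D \<Longrightarrow> restr (row_roots e) k = 0" for k \<gamma> \<delta>
  proof
    assume k: "(\<delta>, \<gamma>) \<in> Poly_Mapping.keys k"
    then have "\<delta> < \<gamma>" using that(3) by (auto simp: carrier_McLain Phi_def)
    have "(fst d, \<delta>) \<in> Omega D" using that(1) b(2) by blast
    then obtain \<epsilon> where \<epsilon>: "(\<delta>, \<epsilon>) \<in> D" "snd d < \<epsilon>" using Omega_iff_row[OF D, of \<delta>] by auto
    then have "(\<delta>, \<gamma>) \<in> row_roots (\<delta>, \<epsilon>)" using \<open>\<delta> < \<gamma>\<close> that(2) by (auto simp: row_roots_def)
    then show False using that(4)[OF \<epsilon>(1)] k by (auto simp: restr_eq_zero_iff)
  qed
  have 0: "restr (row_roots e) h = 0" "restr (row_roots e) (mc_inv h) = 0" if "e \<in> D" for e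
    using stabilizer_row[OF h(1) h(2)[OF that]] by auto
  show ra: "row_act d h b = b"
  proof (rule poly_mapping_eqI)
    fix k
    show "Poly_Mapping.lookup (row_act d h b) k = Poly_Mapping.lookup b k"
    proof (cases "k \<in> row_roots d")
      case True
      then obtain \<gamma> where k: "k = (fst d, \<gamma>)" "\<gamma> < snd d" by (auto simp: row_roots_def)
      have "Poly_Mapping.lookup (b \<star> mc_inv h) k = Poly_Mapping.lookup b k + Poly_Mapping.lookup (mc_inv h) k"
        unfolding k(1) by (rule lookup_mult_eq_add) (use clash[of _ \<gamma> "mc_inv h"] k(2) h(1) 0 in auto)
      moreover have "Poly_Mapping.lookup (mc_inv h) k = 0"
        using 0(2)[OF D(2)] True by (auto simp: restr_eq_zero_iff simp flip: not_in_keys_iff_lookup_eq_zero)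
      ultimately show ?thesis using True by (simp add: row_act_def lookup_restr)
    next
      case False
      then have "k \<notin> Poly_Mapping.keys b" using b(1) by blast
      then show ?thesis using False by (simp add: row_act_def lookup_restr in_keys_iff)
    qed
  qed
  have "Poly_Mapping.lookup (b \<star> h) (fst d, snd d) = Poly_Mapping.lookup b (fst d, snd d) + Poly_Mapping.lookup h (fst d, snd d)"
    by (rule lookup_mult_eq_add) (use clash[of _ "snd d" h] h(1) 0 in auto)
  moreover have "(fst d, snd d) \<notin> Poly_Mapping.keys b" using b(1) end_notin_row[of d] by auto
  ultimately show "row_coef d \<mu> h b = row_coef d \<mu> h 0"
    using h(2)[OF D(2)] by (simp add: row_coef_def ra in_keys_iff)
qed

text \<open>Among the rows of \<open>u\<close> with an entry outside \<open>Omega D\<close> in column \<open>\<gamma>\<close> take the one,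
  belonging to \<open>d\<close>, whose root ends furthest to the right. Then some element of the root group of
  \<open>(\<gamma>, snd d)\<close> fixes all rows of \<open>u\<close> and of the zero label but acts on them by different scalars.\<close>

lemma row_separated:
  fixes D :: "('l::linorder \<times> 'l) set" and f :: "'l \<times> 'l \<Rightarrow> 'r::ring_1 \<Rightarrow> 'f::field"
  assumes D: "finite D" "inj_on fst D" "inj_on snd D"
    and f: "\<And>d. d \<in> D \<Longrightarrow> right_primitive (f d)"
    and u: "\<And>d. d \<in> D \<Longrightarrow> u d \<in> supported (row_roots d)"
    and d0: "d0 \<in> D" "u d0 \<notin> supported (Omega D)"
  shows "\<exists>h\<in>carrier McLain. (\<forall>e\<in>D. row_act e h 0 = 0 \<and> row_act e h (u e) = u e) \<and>
    (\<Prod>e\<in>D. row_coef e (f e) h (u e)) \<noteq> (\<Prod>e\<in>D. row_coef e (f e) h 0)"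
proof -
  obtain \<gamma> where \<gamma>: "(fst d0, \<gamma>) \<in> Poly_Mapping.keys (u d0)" "(fst d0, \<gamma>) \<notin> Omega D"
    using u[OF d0(1)] d0(2) by (auto simp: row_roots_def)
  define X where "X = {d \<in> D. (fst d, \<gamma>) \<in> Poly_Mapping.keys (u d) \<and> (fst d, \<gamma>) \<notin> Omega D}"
  have "d0 \<in> X" using d0(1) \<gamma> by (simp add: X_def)
  then have "X \<noteq> {}" by blast
  have "finite X" using D(1) by (simp add: X_def)
  note X = this \<open>X \<noteq> {}\<close>
  then have "Max (snd ` X) \<in> snd ` X" by (intro Max_in) auto
  then obtain d where d: "d \<in> X" "snd d = Max (snd ` X)" by auto
  have max: "snd e \<le> snd d" if "e \<in> X" for e unfolding d(2) using X that by simp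
  have dD: "d \<in> D" and dk: "(fst d, \<gamma>) \<in> Poly_Mapping.keys (u d)" and dn: "(fst d, \<gamma>) \<notin> Omega D"
    using d(1) by (auto simp: X_def)
  have d_row: "(fst d, \<gamma>) \<in> row_roots d" using u[OF dD] dk by auto
  then have lt: "fst d < \<gamma>" "\<gamma> < snd d" by (auto simp: row_roots_def)
  \<comment> \<open>A root of \<open>D\<close> from \<gamma> to beyond \<open>snd d\<close> would
    put (fst d, \<gamma>) into \<open>Omega D\<close>.\<close>
  have no_root: "\<delta> \<le> snd d" if "(\<gamma>, \<delta>) \<in> D" for \<delta>
    using dn Omega_iff_row[OF D(2) dD, of \<gamma>] d_row that by (meson not_less)
  obtain r where r: "f d (Poly_Mapping.lookup (u d) (fst d, \<gamma>) * r) \<noteq> 1"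
    using right_primitive_witness[OF f[OF dD]] dk by (metis in_keys_iff)
  define h where "h = Poly_Mapping.single (\<gamma>, snd d) r"
  have hG: "h \<in> carrier McLain" using lt by (auto simp: h_def carrier_McLain Phi_def)
  have inv_h: "mc_inv h = Poly_Mapping.single (\<gamma>, snd d) (- r)"
    using lt hG by (intro McLain.inv_equality)
      (auto simp: h_def mult_single_neg one_McLain carrier_McLain Phi_def)
  have keys_inv: "k = (\<gamma>, snd d)" if "k \<in> Poly_Mapping.keys (mc_inv h)" for k
    using that by (auto simp: inv_h split: if_splits)
  have keys_h: "k = (\<gamma>, snd d)" if "k \<in> Poly_Mapping.keys h" for k
    using that by (auto simp: h_def split: if_splits)
  \<comment> \<open>In terms of supports, \<open>h\<close> belongs to \<open>H\<close>: a row of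
    \<open>D\<close> starting at \<gamma> stops before column \<open>snd d\<close>.\<close>
  have row_inv: "restr (row_roots e) (mc_inv h) = 0" if e: "e \<in> D" for e
  proof -
    have False if "(\<gamma>, snd d) \<in> row_roots e"
    proof -
      have "\<gamma> = fst e" "snd d < snd e" using that by (auto simp: row_roots_def)
      then show False using no_root[of "snd e"] e by simp
    qed
    then show ?thesis unfolding restr_eq_zero_iff using keys_inv by blast
  qed
  have act0: "row_act e h 0 = 0" if "e \<in> D" for e using row_inv[OF that] by (simp add: row_act_def)
  have act: "row_act e h (u e) = u e" if e: "e \<in> D" for e
  proof (rule poly_mapping_eqI)
    fix k
    show "Poly_Mapping.lookup (row_act e h (u e)) k = Poly_Mapping.lookup (u e) k"
    proof (cases "k \<in> row_roots e")
      case True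
      then obtain c where k: "k = (fst e, c)" "c < snd e" by (auto simp: row_roots_def)
      have "Poly_Mapping.lookup (u e \<star> mc_inv h) k = Poly_Mapping.lookup (u e) k + Poly_Mapping.lookup (mc_inv h) k"
        unfolding k(1)
      proof (rule lookup_mult_eq_add, rule notI)
        fix b assume b: "(fst e, b) \<in> Poly_Mapping.keys (u e)" "(b, c) \<in> Poly_Mapping.keys (mc_inv h)"
        then have bc: "b = \<gamma>" "snd d < snd e" using keys_inv k(2) by auto
        \<comment> \<open>Row \<open>e\<close> could change only through an entry in column
          \<gamma>, and only if it extends beyond \<open>snd d\<close>. Maximality of
          \<open>d\<close> then forces that entry into \<open>Omega D\<close>, hence a root of
          \<open>D\<close> from \<gamma> to beyond \<open>snd e\<close>, contrary to
          \<open>no_root\<close>.\<close>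
        have "(fst e, \<gamma>) \<in> Omega D" using max[of e] b(1) bc e by (force simp: X_def)
        then obtain \<delta> where "(\<gamma>, \<delta>) \<in> D" "snd e < \<delta>" using Omega_iff_row[OF D(2) e] by auto
        then show False using no_root[of \<delta>] bc(2) by simp
      qed
      moreover have "Poly_Mapping.lookup (mc_inv h) k = 0"
        using row_inv[OF e] True by (auto simp: restr_eq_zero_iff simp flip: not_in_keys_iff_lookup_eq_zero)
      ultimately show ?thesis using True by (simp add: row_act_def lookup_restr)
    next
      case False
      then have "k \<notin> Poly_Mapping.keys (u e)" using u[OF e] by blast
      then show ?thesis using False by (simp add: row_act_def lookup_restr in_keys_iff)
    qed
  qed
  have u_end: "Poly_Mapping.lookup (u e) (fst e, snd e) = 0" if "e \<in> D" for e
  proof -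
    have "e \<notin> Poly_Mapping.keys (u e)" using u[OF that] end_notin_row by blast
    then show ?thesis by (simp add: in_keys_iff)
  qed
  have h_end: "Poly_Mapping.lookup h (fst e, snd e) = 0" if e: "e \<in> D" for e
  proof -
    \<comment> \<open>The only member of \<open>D\<close> ending at \<open>snd d\<close> is
      \<open>d\<close>, which does not start at \<gamma>.\<close>
    have "fst e \<noteq> \<gamma> \<or> snd e \<noteq> snd d" using lt(1) inj_onD[OF D(3) _ e dD] by blast
    then show ?thesis by (auto simp: h_def lookup_single when_def)
  qed
  have one: "f e 0 = 1" if "e \<in> D" for e
    using f[OF that] linear_char_zero unfolding right_primitive_def by blast
  have coef0: "row_coef e (f e) h 0 = 1" if "e \<in> D" for e
    using act0[OF that] h_end[OF that] one[OF that] by (simp add: row_coef_def)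
  have coef: "row_coef e (f e) h (u e) = (if e = d then f d (Poly_Mapping.lookup (u d) (fst d, \<gamma>) * r) else 1)"
    if e: "e \<in> D" for e
  proof (cases "e = d")
    case True
    have "Poly_Mapping.lookup (u d \<star> h) (fst d, snd d) = Poly_Mapping.lookup (u d) (fst d, \<gamma>) * r"
      unfolding h_def lookup_mult_single using u_end[OF dD] less_imp_neq[OF lt(1)] by simp
    then show ?thesis using True act[OF e] by (simp add: row_coef_def)
  next
    case False
    then have "snd e \<noteq> snd d" using inj_onD[OF D(3) _ e dD] by blast
    \<comment> \<open>As the ends are distinct, \<open>h\<close> has no entry in column
      \<open>snd e\<close>.\<close>
    then have "Poly_Mapping.lookup (u e \<star> h) (fst e, snd e)
        = Poly_Mapping.lookup (u e) (fst e, snd e) + Poly_Mapping.lookup h (fst e, snd e)"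
      using keys_h by (intro lookup_mult_eq_add) auto
    then show ?thesis using False act[OF e] u_end[OF e] h_end[OF e] one[OF e] by (simp add: row_coef_def)
  qed
  have "(\<Prod>e\<in>D. row_coef e (f e) h (u e)) = f d (Poly_Mapping.lookup (u d) (fst d, \<gamma>) * r)"
    using coef D(1) dD by simp
  moreover have "(\<Prod>e\<in>D. row_coef e (f e) h 0) = 1" using coef0 by simp
  ultimately show ?thesis using hG act0 act r by (intro bexI[of _ h]) auto
qed

section \<open>Endomorphisms of the basic module\<close>

lemma basic_module_coordinates:
  fixes D :: "('l::linorder \<times> 'l) set" and f :: "'l \<times> 'l \<Rightarrow> 'r::ring_1 \<Rightarrow> 'f::field"
  assumes D: "basic D" and f: "\<And>d. d \<in> D \<Longrightarrow> right_primitive (f d)"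
  shows "\<exists>T. coordinates (basic_module D f) (\<Pi>\<^sub>E d\<in>D. supported (row_roots d)) T \<and>
    (\<forall>g\<in>carrier McLain. \<forall>x\<in>carrier (basic_module D f).
      act (basic_module D f) g x \<in> carrier (basic_module D f) \<and>
      T (act (basic_module D f) g x) = lext (\<lambda>u. Poly_Mapping.single
        (\<lambda>d\<in>D. row_act d g (u d)) (\<Prod>d\<in>D. row_coef d (f d) g (u d))) (T x))"
proof -
  let ?V = "\<lambda>d. elem_module (fst d) (snd d) (f d)"
  have V: "basic_module D f = tensor D ?V"
    by (simp add: basic_module_def case_prod_unfold)
  have "\<forall>d\<in>D. \<exists>T. coordinates (?V d) (supported (row_roots d)) T \<and>
    (\<forall>g\<in>carrier McLain. \<forall>x\<in>carrier (?V d). act (?V d) g x \<in> carrier (?V d) \<and>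
      T (act (?V d) g x) = lext (\<lambda>b. Poly_Mapping.single (row_act d g b) (row_coef d (f d) g b)) (T x))"
  proof
    fix d assume "d \<in> D"
    then have "fst d < snd d" using D by (auto simp: basic_def Phi_def)
    moreover have "linear_char (f d)" using f[OF \<open>d \<in> D\<close>] by (simp add: right_primitive_def)
    ultimately show "\<exists>T. coordinates (?V d) (supported (row_roots d)) T \<and>
      (\<forall>g\<in>carrier McLain. \<forall>x\<in>carrier (?V d). act (?V d) g x \<in> carrier (?V d) \<and>
        T (act (?V d) g x) = lext (\<lambda>b. Poly_Mapping.single (row_act d g b) (row_coef d (f d) g b)) (T x))"
      using elem_module_coordinates[of "fst d" "snd d" "f d"] by simp
  qed
  then obtain T where T: "\<forall>d\<in>D. coordinates (?V d) (supported (row_roots d)) (T d) \<and>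
    (\<forall>g\<in>carrier McLain. \<forall>x\<in>carrier (?V d). act (?V d) g x \<in> carrier (?V d) \<and>
      T d (act (?V d) g x) = lext (\<lambda>b. Poly_Mapping.single (row_act d g b) (row_coef d (f d) g b)) (T d x))"
    unfolding bchoice_iff by (elim exE)
  show ?thesis
    unfolding V
  proof (rule tensor_coordinates)
    show "finite D" using D by (simp add: basic_def)
    show "coordinates (?V d) (supported (row_roots d)) (T d)" if "d \<in> D" for d using T that by blast
    show "act (?V d) g x \<in> carrier (?V d) \<and>
        T d (act (?V d) g x) = lext (\<lambda>b. Poly_Mapping.single (row_act d g b) (row_coef d (f d) g b)) (T d x)"
      if "d \<in> D" "g \<in> carrier McLain" "x \<in> carrier (?V d)" for d g x
      using T that by blast
  qed
qed

lemma hom_space_basic_module: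
  fixes D :: "('l::linorder \<times> 'l) set" and f :: "'l \<times> 'l \<Rightarrow> 'r::ring_1 \<Rightarrow> 'f::field"
  assumes D: "basic D" and f: "\<And>d. d \<in> D \<Longrightarrow> right_primitive (f d)"
  shows "\<exists>T. coordinates (hom_space (McLain :: ('l \<times> 'l \<Rightarrow>\<^sub>0 'r) monoid) (basic_module D f) (basic_module D f))
    ((\<Pi>\<^sub>E d\<in>D. supported (row_roots d) \<inter> supported (Omega D)) :: ('l \<times> 'l \<Rightarrow> 'l \<times> 'l \<Rightarrow>\<^sub>0 'r) set) T"
proof -
  let ?B = "(\<Pi>\<^sub>E d\<in>D. supported (row_roots d)) :: ('l \<times> 'l \<Rightarrow> 'l \<times> 'l \<Rightarrow>\<^sub>0 'r) set"
  let ?B1 = "(\<Pi>\<^sub>E d\<in>D. supported (row_roots d) \<inter> supported (Omega D)) :: ('l \<times> 'l \<Rightarrow> 'l \<times> 'l \<Rightarrow>\<^sub>0 'r) set"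
  have fin: "finite D" and inj: "inj_on fst D" "inj_on snd D" using D by (auto simp: basic_def)
  have lin: "linear_char (f d)" if "d \<in> D" for d using f[OF that] by (simp add: right_primitive_def)
  define p where "p g u = (\<lambda>d\<in>D. row_act d g (u d))" for g :: "'l \<times> 'l \<Rightarrow>\<^sub>0 'r" and u
  define c where "c g u = (\<Prod>d\<in>D. row_coef d (f d) g (u d))" for g :: "'l \<times> 'l \<Rightarrow>\<^sub>0 'r" and u
  define b0 :: "'l \<times> 'l \<Rightarrow> 'l \<times> 'l \<Rightarrow>\<^sub>0 'r" where "b0 = (\<lambda>d\<in>D. 0)"
  have p_b0: "p h b0 = b0 \<longleftrightarrow> (\<forall>d\<in>D. row_act d h 0 = 0)" for h
    by (auto simp: p_def b0_def fun_eq_iff restrict_def)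
  have p_eq: "p h u = u \<longleftrightarrow> (\<forall>d\<in>D. row_act d h (u d) = u d)" if "u \<in> ?B" for h u
    using that by (auto simp: p_def fun_eq_iff restrict_def PiE_iff extensional_def)
  have c_b0: "c h b0 = (\<Prod>d\<in>D. row_coef d (f d) h 0)" for h by (simp add: c_def b0_def)
  obtain T where T: "coordinates (basic_module D f) ?B T"
    "\<And>g x. g \<in> carrier McLain \<Longrightarrow> x \<in> carrier (basic_module D f) \<Longrightarrow>
      act (basic_module D f) g x \<in> carrier (basic_module D f) \<and>
      T (act (basic_module D f) g x) = lext (\<lambda>u. Poly_Mapping.single (p g u) (c g u)) (T x)"
    using basic_module_coordinates[where f = f, OF D f] unfolding p_def c_def by blast
  show ?thesis
  proof (rule hom_space_monomial_coordinates[OF group_McLain T])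
    show "p g u \<in> ?B" for g u unfolding p_def unfolding restrict_PiE_iff using row_act_closed by blast
    show "c g u \<noteq> 0" for g u
      unfolding c_def prod_zero_iff[OF fin] using row_coef_nonzero[OF lin] by blast
    show "p \<one>\<^bsub>McLain\<^esub> u = u" if "u \<in> ?B" for u
      using that by (auto simp: p_eq one_McLain PiE_iff intro!: row_act_one)
    show "p (g \<star> h) u = p g (p h u)" "c (g \<star> h) u = c g (p h u) * c h u"
      if "g \<in> carrier McLain" "h \<in> carrier McLain" "u \<in> ?B" for g h u
    proof -
      have u: "u d \<in> supported (row_roots d)" if "d \<in> D" for d using \<open>u \<in> ?B\<close> that by auto
      show "p (g \<star> h) u = p g (p h u)"
        unfolding p_def by (rule restrict_ext) (use row_act_mult[OF that(1,2) u] in simp)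
      have "c (g \<star> h) u = (\<Prod>d\<in>D. row_coef d (f d) g (row_act d h (u d)) * row_coef d (f d) h (u d))"
        unfolding c_def by (rule prod.cong[OF refl]) (use row_coef_mult[OF lin that(1,2) u] in simp)
      then show "c (g \<star> h) u = c g (p h u) * c h u"
        by (simp add: c_def p_def prod.distrib)
    qed
    show "b0 \<in> ?B" by (auto simp: b0_def)
    show "\<exists>g\<in>carrier McLain. p g b0 = u" if "u \<in> ?B" for u
    proof -
      have u: "u d \<in> supported (row_roots d)" if "d \<in> D" for d using \<open>u \<in> ?B\<close> that by auto
      \<comment> \<open>The matrix holding all rows of \<open>u\<close>. Its inverse carries the
        zero label to \<open>u\<close>, because labels are multiplied by inverses.\<close>
      define X where "X = (\<Sum>d\<in>D. u d)"
      have X: "X \<in> carrier McLain" unfolding X_def carrier_McLain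
        by (rule supported_sum) (use u row_subset_Phi in blast)
      have "row_act d (mc_inv X) 0 = u d" if "d \<in> D" for d
        using restr_row_sum[OF fin inj(1) that u] X by (simp add: row_act_def X_def)
      then have "p (mc_inv X) b0 = u"
        using that by (auto simp: p_def b0_def fun_eq_iff restrict_def PiE_iff extensional_def)
      then show ?thesis using X by blast
    qed
    show "?B1 \<subseteq> ?B" by (auto simp: PiE_iff)
    show "p h u = u \<and> c h u = c h b0" if "h \<in> carrier McLain" "p h b0 = b0" "u \<in> ?B1" for h u
    proof -
      have u: "u d \<in> supported (row_roots d)" "u d \<in> supported (Omega D)" if "d \<in> D" for d
        using \<open>u \<in> ?B1\<close> that by auto
      have h: "row_act e h 0 = 0" if "e \<in> D" for e using \<open>p h b0 = b0\<close> that by (simp add: p_b0)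
      have "row_act d h (u d) = u d" "row_coef d (f d) h (u d) = row_coef d (f d) h 0" if "d \<in> D" for d
        using row_fixed[OF inj(1) that \<open>h \<in> carrier McLain\<close> h u[OF that]] by blast+
      moreover have "u \<in> ?B" using that(3) by (auto simp: PiE_iff)
      ultimately show ?thesis unfolding c_b0 by (simp add: p_eq c_def)
    qed
    show "\<exists>h\<in>carrier McLain. p h b0 = b0 \<and> p h u = u \<and> c h u \<noteq> c h b0" if "u \<in> ?B - ?B1" for u
    proof -
      have uB: "u \<in> ?B" using that by blast
      then have u: "u d \<in> supported (row_roots d)" if "d \<in> D" for d using that by auto
      have "\<exists>d0\<in>D. u d0 \<notin> supported (Omega D)"
      proof (rule ccontr)
        assume "\<not> ?thesis"
        then have "u \<in> ?B1" using uB by (simp add: PiE_iff)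
        then show False using that by blast
      qed
      then obtain d0 where "d0 \<in> D" "u d0 \<notin> supported (Omega D)" by blast
      from row_separated[where f = f and u = u, OF fin inj f u this] show ?thesis
        unfolding p_b0 p_eq[OF uB] c_b0 unfolding c_def by blast
    qed
  qed
qed

text \<open>Summation and truncation to the rows are mutually inverse, because
  \<open>Omega D\<close> is contained in the disjoint union of the rows.\<close>

lemma card_labels:
  fixes D :: "('l::linorder \<times> 'l) set"
  assumes "finite D" "inj_on fst D"
  shows "|(\<Pi>\<^sub>E d\<in>D. supported (row_roots d) \<inter> supported (Omega D)) :: ('l \<times> 'l \<Rightarrow> 'l \<times> 'l \<Rightarrow>\<^sub>0 'r::comm_monoid_add) set|
    =o |supported (Omega D) :: ('l \<times> 'l \<Rightarrow>\<^sub>0 'r) set|"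
proof -
  let ?B1 = "(\<Pi>\<^sub>E d\<in>D. supported (row_roots d) \<inter> supported (Omega D)) :: ('l \<times> 'l \<Rightarrow> 'l \<times> 'l \<Rightarrow>\<^sub>0 'r) set"
  let ?R = "\<lambda>x :: 'l \<times> 'l \<Rightarrow>\<^sub>0 'r. \<lambda>d\<in>D. restr (row_roots d) x"
  have "bij_betw (\<lambda>u. \<Sum>d\<in>D. u d) ?B1 (supported (Omega D))"
  proof (rule bij_betw_byWitness[of _ ?R])
    show "\<forall>u\<in>?B1. ?R (\<Sum>d\<in>D. u d) = u"
    proof
      fix u assume u: "u \<in> ?B1"
      then have "u e \<in> supported (row_roots e)" if "e \<in> D" for e using that by auto
      from restr_row_sum[OF assms _ this] show "?R (\<Sum>d\<in>D. u d) = u"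
        using u by (auto simp: fun_eq_iff restrict_def PiE_iff extensional_def)
    qed
    show "\<forall>x\<in>supported (Omega D). (\<Sum>d\<in>D. ?R x d) = x"
    proof (intro ballI poly_mapping_eqI)
      fix x :: "'l \<times> 'l \<Rightarrow>\<^sub>0 'r" and k assume x: "x \<in> supported (Omega D)"
      show "Poly_Mapping.lookup (\<Sum>d\<in>D. ?R x d) k = Poly_Mapping.lookup x k"
      proof (cases "k \<in> (\<Union>d\<in>D. row_roots d)")
        case True
        then obtain d where d: "d \<in> D" "k \<in> row_roots d" by blast
        have "Poly_Mapping.lookup (\<Sum>d\<in>D. ?R x d) k
          = Poly_Mapping.lookup (restr (row_roots d) (\<Sum>d\<in>D. ?R x d)) k"
          using d by (simp add: lookup_restr)
        also have "restr (row_roots d) (\<Sum>d\<in>D. ?R x d) = ?R x d"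
          by (rule restr_row_sum[OF assms d(1)]) (auto simp: keys_restr)
        finally show ?thesis using d by (simp add: lookup_restr)
      next
        case False
        then have "k \<notin> Poly_Mapping.keys x" using x Omega_subset_rows[of D] by blast
        then show ?thesis using False by (simp add: lookup_sum lookup_restr in_keys_iff)
      qed
    qed
    show "(\<lambda>u. \<Sum>d\<in>D. u d) ` ?B1 \<subseteq> supported (Omega D)"
      by (intro image_subsetI supported_sum) auto
    show "?R ` supported (Omega D) \<subseteq> ?B1" by (auto simp: keys_restr)
  qed
  then show ?thesis by (rule card_of_ordIsoI)
qed

theorem theorem8p1:
  fixes D :: "('l::linorder \<times> 'l) set"
    and f :: "'l \<times> 'l \<Rightarrow> 'r::ring_1 \<Rightarrow> 'f::field"
  assumes "\<exists>\<mu> :: 'r \<Rightarrow> 'f. right_primitive \<mu>"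
    and "basic D"
    and "\<forall>d\<in>D. right_primitive (f d)"
  shows "has_dim
           (hom_space (McLain :: ('l \<times> 'l \<Rightarrow>\<^sub>0 'r) monoid) (basic_module D f) (basic_module D f))
           (coset_index (McLain :: ('l \<times> 'l \<Rightarrow>\<^sub>0 'r) monoid) (I_group D) (H_group D))
       \<and> coset_index (McLain :: ('l \<times> 'l \<Rightarrow>\<^sub>0 'r) monoid) (I_group D) (H_group D)
           =o |UNIV :: 'r set| ^c |Omega D|"
proof
  let ?Om = "supported (Omega D) :: ('l \<times> 'l \<Rightarrow>\<^sub>0 'r) set"
  have fin: "finite D" and inj: "inj_on fst D" using assms(2) by (auto simp: basic_def)
  have index: "|?Om| =o coset_index (McLain :: ('l \<times> 'l \<Rightarrow>\<^sub>0 'r) monoid) (I_group D) (H_group D)"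
    by (rule coset_index_eq[OF inj])
  obtain T where "coordinates (hom_space (McLain :: ('l \<times> 'l \<Rightarrow>\<^sub>0 'r) monoid) (basic_module D f) (basic_module D f))
    (\<Pi>\<^sub>E d\<in>D. supported (row_roots d) \<inter> ?Om) T"
    using hom_space_basic_module[where f = f, OF assms(2)] assms(3) by blast
  \<comment> \<open>The basis is indexed by label tuples inside \<open>Omega D\<close>; they
    correspond to the matrices supported on \<open>Omega D\<close>, which represent the
    cosets.\<close>
  then show "has_dim
      (hom_space (McLain :: ('l \<times> 'l \<Rightarrow>\<^sub>0 'r) monoid) (basic_module D f) (basic_module D f))
      (coset_index (McLain :: ('l \<times> 'l \<Rightarrow>\<^sub>0 'r) monoid) (I_group D) (H_group D))"
    by (rule coordinates.has_dim) (rule ordIso_transitive[OF card_labels[OF fin inj] index])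
  show "coset_index (McLain :: ('l \<times> 'l \<Rightarrow>\<^sub>0 'r) monoid) (I_group D) (H_group D)
      =o |UNIV :: 'r set| ^c |Omega D|"
    by (rule ordIso_transitive[OF ordIso_symmetric[OF index] card_supported[OF finite_Omega[OF fin]]])
qed

end
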